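(* Let $1\le r\le N$, let $S_0\in\mathbb{C}^{r\times r}$ be the diagonal matrix of the $r$ eigenvalues of largest modulus of a given $W_0\in\mathfrak{su}(N)$, and consider the problem $$\dot U+\frac{1}{\hbar_N}P(US_0U^* )U=0,\qquad U(t)\in \mathrm{St}(r,\mathbb{C}^N),$$ over a time interval $(t_\tau,t_{\tau+1}]$ of length $\Delta t$. Apply to it one step of the explicit $N_s$-stage Runge--Kutta Munthe-Kaas (RK-MK) scheme described in the context, with coordinate map $\Psi$ the Cayley transform $\mathrm{cay}(\Omega)=(I-\Omega/2)^{-1}(I+\Omega/2)$. The arithmetic complexity of this step is $$O(Nr^2N_s^2)+O(r^3N_s^4)+O(N^2rN_s).$$
   Context: Let $N\ge 2$, $\hbar_N=2/\sqrt{N^2-1}$. $\mathfrak{u}(N)$ denotes the skew-Hermitian $N\times N$ matrices, $\mathfrak{su}(N)$ the traceless ones, and $\mathrm{St}(r,\mathbb{C}^N)=\{U\in\mathbb{C}^{N\times r}:U^*U=I_r\}$. Put $s=(N-1)/2$ and, for $0\le\ell\le N-1$, $-\ell\le m\le\ell$, let $T^N_{\ell,m}\in\mathbb{C}^{N\times N}$ (rows and columns indexed by $m_1,m_2\in\{-s,\dots,s\}$) be $$(T^N_{\ell,m})_{m_1,m_2}=\sqrt{\tfrac{N}{4\pi}}\,(-1)^{s-m_1}\sqrt{2\ell+1}\begin{pmatrix}s&\ell&s\\-m_1&m&m_2\end{pmatrix}$$ (Wigner 3j-symbol), a basis of $\mathbb{C}^{N\times N}$. The discrete Laplacian $\Delta_N$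 is the linear map with $\Delta_NT^N_{\ell,m}=-\ell(\ell+1)T^N_{\ell,m}$; its kernel consists of multiples of the identity. $\Delta_N^{-1}$ is its inverse on traceless matrices, extended linearly by $\Delta_N^{-1}I=0$, and $P(X)=\Delta_N^{-1}X$. It is known that $\Delta_N$ maps the $m$th diagonal of a matrix to the $m$th diagonal through a tridiagonal symmetric matrix $\Delta^m$ of size $N-|m|$, with $\Delta^{-m}=\Delta^{m}$; the entries of the $\Delta^m$ are given. RK-MK step. Set $\mathcal{F}_{S_0}(U)=-\hbar_N^{-1}P(US_0U^* )U$ and $\mathcal{L}_{S_0}(U)=(I-UU^* )\mathcal{F}_{S_0}(U)U^*-U\mathcal{F}_{S_0}(U)^*\in\mathfrak{u}(N)$. For a coordinate map $\Psi:\mathfrak{u}(N)\to \mathrm{U}(N)$ the right trivialized tangent $\mathrm{d}\Psi$ is defined by $\frac{d}{dt}\Psi(A(t))=\mathrm{d}\Psi_{A(t)}(\dot A(t))\,\Psi(A(t))$; for $\Psi=\mathrm{cay}$ one has $\mathrm{d}\Psi_\Omega^{-1}(A)=(I-\Omega/2)A(I+\Omega/2)$. Let $\{b_i\}_{i=1}^{N_s}$, $\{a_{i,j}\}_{i,j=1}^{N_s}$ be the coefficients of an explicit Runge--Kutta method ($a_{i,j}=0$ for $j\ge i$). Given $U_\tau\in \mathrm{St}(r,\mathbb{C}^N)$: put $\Omega_\tau^1=0$, $U_\tau^1=U_\tau$; for $i=2,\dots,N_s$ compute $\Omega_\tau^i=\Delta t\sum_{j=1}^{i-1}a_{i,j}\,\mathrm{d}\Psi^{-1}_{\Omega_\tau^j}(\mathcal{L}_{S_0}(U_\tau^j))$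 and $U_\tau^i=\Psi(\Omega_\tau^i)U_\tau$; then $\Omega_{\tau+1}=\Delta t\sum_{i=1}^{N_s}b_i\,\mathrm{d}\Psi^{-1}_{\Omega_\tau^i}(\mathcal{L}_{S_0}(U_\tau^i))$ and return $U_{\tau+1}=\Psi(\Omega_{\tau+1})U_\tau$. Arithmetic complexity is the number of complex arithmetic operations sufficient to compute $U_{\tau+1}$ from $U_\tau$ (matrices such as $\mathcal{L}_{S_0}(U^i_\tau)$ and $\Omega^i_\tau$ may be handled in low-rank factored form), with constants independent of $N,r,N_s$. *)

theory Defs
  imports "Jordan_Normal_Form.Schur_Decomposition" "Jordan_Normal_Form.Gauss_Jordan_Elimination"
begin

section \<open>Matrices\<close>

definition mat_trace :: "'a::comm_monoid_add mat \<Rightarrow> 'a" where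
  "mat_trace A = (\<Sum>i<dim_row A. A $$ (i, i))"

definition u_alg :: "nat \<Rightarrow> complex mat set" where
  "u_alg N = {A \<in> carrier_mat N N. mat_adjoint A = - A}"

definition su_alg :: "nat \<Rightarrow> complex mat set" where
  "su_alg N = {A \<in> u_alg N. mat_trace A = 0}"

definition stiefel :: "nat \<Rightarrow> nat \<Rightarrow> complex mat set" where
  "stiefel r N = {U \<in> carrier_mat N r. mat_adjoint U * U = 1\<^sub>m r}"

text \<open>Eigenvalues are counted with algebraic multiplicity.  Neither the order of the chosen
  eigenvalues nor the choice among eigenvalues of equal modulus is prescribed.\<close>

definition is_dominant_eigenvalue_matrix :: "nat \<Rightarrow> nat \<Rightarrow> complex mat \<Rightarrow> complex mat \<Rightarrow> bool" where
  "is_dominant_eigenvalue_matrix N r W S \<longleftrightarrow>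
     (\<exists>es fs. length es = r \<and>
        char_poly W = (\<Prod>e\<leftarrow>es @ fs. [:- e, 1:]) \<and>
        (\<forall>x\<in>set es. \<forall>y\<in>set fs. cmod y \<le> cmod x) \<and>
        S = mat_diag r (\<lambda>i. es ! i))"


section \<open>The discrete Laplacian\<close>

text \<open>Wigner 3j-symbol by Racah's formula, for (half-)integers \<open>j1, j2, j3\<close> and \<open>m1, m2, m3\<close> such that
  the \<open>ji - mi\<close> and \<open>j1 + j2 + j3\<close> are integers.  All arguments of \<open>ifact\<close> below are then integers, and
  the sum ranges over those \<open>t\<close> for which the arguments are nonnegative.\<close>

definition ifact :: "real \<Rightarrow> real" where
  "ifact x = fact (nat \<lfloor>x\<rfloor>)"

definition wigner3j :: "real \<Rightarrow> real \<Rightarrow> real \<Rightarrow> real \<Rightarrow> real \<Rightarrow> real \<Rightarrow> real" where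
  "wigner3j j1 j2 j3 m1 m2 m3 =
    (if m1 + m2 + m3 = 0 \<and> \<bar>m1\<bar> \<le> j1 \<and> \<bar>m2\<bar> \<le> j2 \<and> \<bar>m3\<bar> \<le> j3 \<and> \<bar>j1 - j2\<bar> \<le> j3 \<and> j3 \<le> j1 + j2
     then (-1) powi \<lfloor>j1 - j2 - m3\<rfloor>
        * sqrt (ifact (j1 + j2 - j3) * ifact (j1 - j2 + j3) * ifact (- j1 + j2 + j3)
                / ifact (j1 + j2 + j3 + 1))
        * sqrt (ifact (j1 - m1) * ifact (j1 + m1) * ifact (j2 - m2) * ifact (j2 + m2)
                * ifact (j3 - m3) * ifact (j3 + m3))
        * (\<Sum>t \<in> {t::nat. 0 \<le> j3 - j2 + t + m1 \<and> 0 \<le> j3 - j1 + t - m2 \<and>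
                         0 \<le> j1 + j2 - j3 - t \<and> 0 \<le> j1 - t - m1 \<and> 0 \<le> j2 - t + m2}.
             (-1) ^ t / (fact t * ifact (j3 - j2 + t + m1) * ifact (j3 - j1 + t - m2)
                * ifact (j1 + j2 - j3 - t) * ifact (j1 - t - m1) * ifact (j2 - t + m2)))
     else 0)"

text \<open>Row (column) \<open>i = 0, \<dots>, N - 1\<close> carries the label \<open>i - s\<close>.\<close>

definition T_mat :: "nat \<Rightarrow> nat \<Rightarrow> int \<Rightarrow> complex mat" where
  "T_mat N l m = mat N N (\<lambda>(i, j).
     let s = (real N - 1) / 2; m1 = real i - s; m2 = real j - s
     in complex_of_real (sqrt (real N / (4 * pi)) * (-1) powi \<lfloor>s - m1\<rfloor> * sqrt (2 * real l + 1)
          * wigner3j s (real l) s (- m1) (of_int m) m2))"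

definition is_linear_on_mats :: "nat \<Rightarrow> (complex mat \<Rightarrow> complex mat) \<Rightarrow> bool" where
  "is_linear_on_mats N L \<longleftrightarrow>
     (\<forall>X\<in>carrier_mat N N. L X \<in> carrier_mat N N) \<and>
     (\<forall>X\<in>carrier_mat N N. \<forall>Y\<in>carrier_mat N N. L (X + Y) = L X + L Y) \<and>
     (\<forall>c. \<forall>X\<in>carrier_mat N N. L (c \<cdot>\<^sub>m X) = c \<cdot>\<^sub>m L X)"

text \<open>Unique on \<open>carrier_mat N N\<close>, because the \<open>T_mat N l m\<close> form a basis.\<close>

definition discrete_laplacian :: "nat \<Rightarrow> complex mat \<Rightarrow> complex mat" where
  "discrete_laplacian N = (SOME L. is_linear_on_mats N L \<and>
     (\<forall>l<N. \<forall>m. \<bar>m\<bar> \<le> int l \<longrightarrow>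
        L (T_mat N l m) = (- (of_nat l * (of_nat l + 1))) \<cdot>\<^sub>m T_mat N l m))"

text \<open>The inverse on traceless matrices, extended linearly by \<open>1\<^sub>m N \<mapsto> 0\<close>.\<close>

definition laplacian_inv :: "nat \<Rightarrow> complex mat \<Rightarrow> complex mat" where
  "laplacian_inv N X =
     the_inv_into {Y \<in> carrier_mat N N. mat_trace Y = 0} (discrete_laplacian N)
       (X - (mat_trace X / of_nat N) \<cdot>\<^sub>m 1\<^sub>m N)"

text \<open>Entry \<open>(i, j)\<close> of the matrix \<open>\<Delta>\<^sup>m\<close> of size \<open>N - m\<close> by which the Laplacian acts on the \<open>m\<close>th
  diagonal \<open>(X (i + m) i)\<^sub>i\<close>.  It suffices to take \<open>m \<ge> 0\<close>, since \<open>\<Delta>\<^sup>-\<^sup>m = \<Delta>\<^sup>m\<close>.\<close>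

definition laplacian_diag :: "nat \<Rightarrow> nat \<Rightarrow> nat \<Rightarrow> nat \<Rightarrow> complex" where
  "laplacian_diag N m i j =
     discrete_laplacian N (mat N N (\<lambda>pq. if pq = (j + m, j) then 1 else 0)) $$ (i + m, i)"


section \<open>The Runge--Kutta Munthe-Kaas step\<close>

definition hbar :: "nat \<Rightarrow> real" where
  "hbar N = 2 / sqrt ((real N)\<^sup>2 - 1)"

text \<open>The differential equation reads \<open>U' = field_F N S U\<close>.\<close>

definition field_F :: "nat \<Rightarrow> complex mat \<Rightarrow> complex mat \<Rightarrow> complex mat" where
  "field_F N S U =
     (- inverse (complex_of_real (hbar N))) \<cdot>\<^sub>m (laplacian_inv N (U * S * mat_adjoint U) * U)"

definition field_L :: "nat \<Rightarrow> complex mat \<Rightarrow> complex mat \<Rightarrow> complex mat" where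
  "field_L N S U =
     (1\<^sub>m N - U * mat_adjoint U) * field_F N S U * mat_adjoint U - U * mat_adjoint (field_F N S U)"

definition cay :: "nat \<Rightarrow> complex mat \<Rightarrow> complex mat" where
  "cay N \<Omega> = the (mat_inverse (1\<^sub>m N - (1/2) \<cdot>\<^sub>m \<Omega>)) * (1\<^sub>m N + (1/2) \<cdot>\<^sub>m \<Omega>)"

definition has_mat_derivative_at_0 :: "nat \<Rightarrow> (real \<Rightarrow> complex mat) \<Rightarrow> complex mat \<Rightarrow> bool" where
  "has_mat_derivative_at_0 N A B \<longleftrightarrow>
     (\<forall>i<N. \<forall>j<N. ((\<lambda>t. A t $$ (i, j)) has_vector_derivative B $$ (i, j)) (at 0))"

text \<open>The right trivialized tangent of \<open>\<Psi>\<close> at \<open>\<Omega>\<close>, applied to \<open>B\<close>, and its inverse on \<open>u_alg N\<close>.\<close>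

definition right_triv_tangent ::
    "nat \<Rightarrow> (complex mat \<Rightarrow> complex mat) \<Rightarrow> complex mat \<Rightarrow> complex mat \<Rightarrow> complex mat" where
  "right_triv_tangent N \<Psi> \<Omega> B = (THE C. C \<in> carrier_mat N N \<and>
     (\<forall>A. (\<forall>t. A t \<in> u_alg N) \<and> A 0 = \<Omega> \<and> has_mat_derivative_at_0 N A B \<longrightarrow>
          has_mat_derivative_at_0 N (\<lambda>t. \<Psi> (A t)) (C * \<Psi> \<Omega>)))"

definition right_triv_tangent_inv ::
    "nat \<Rightarrow> (complex mat \<Rightarrow> complex mat) \<Rightarrow> complex mat \<Rightarrow> complex mat \<Rightarrow> complex mat" where
  "right_triv_tangent_inv N \<Psi> \<Omega> = the_inv_into (u_alg N) (right_triv_tangent N \<Psi> \<Omega>)"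

definition is_explicit_rk :: "nat \<Rightarrow> (nat \<Rightarrow> nat \<Rightarrow> real) \<Rightarrow> bool" where
  "is_explicit_rk Ns a \<longleftrightarrow> (\<forall>i\<in>{1..Ns}. \<forall>j\<in>{1..Ns}. i \<le> j \<longrightarrow> a i j = 0)"

text \<open>\<open>rkmk_Omega \<dots> i\<close> is the stage matrix \<open>\<Omega>\<^sub>\<tau>\<^sup>i\<close>; stages are numbered from 1.  Sums of matrices are
  written entrywise, as the type of matrices of arbitrary size has no zero.\<close>

fun rkmk_Omega ::
    "nat \<Rightarrow> (complex mat \<Rightarrow> complex mat) \<Rightarrow> complex mat \<Rightarrow> (nat \<Rightarrow> nat \<Rightarrow> real) \<Rightarrow> real \<Rightarrow>
     complex mat \<Rightarrow> nat \<Rightarrow> complex mat" where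
  "rkmk_Omega N \<Psi> S a dt U i =
     (if i \<le> 1 then 0\<^sub>m N N else
      mat N N (\<lambda>pq. complex_of_real dt * (\<Sum>j\<in>{1..<i}. complex_of_real (a i j) *
        right_triv_tangent_inv N \<Psi> (rkmk_Omega N \<Psi> S a dt U j)
          (field_L N S (if j = 1 then U else \<Psi> (rkmk_Omega N \<Psi> S a dt U j) * U)) $$ pq)))"

declare rkmk_Omega.simps [simp del]

definition rkmk_U ::
    "nat \<Rightarrow> (complex mat \<Rightarrow> complex mat) \<Rightarrow> complex mat \<Rightarrow> (nat \<Rightarrow> nat \<Rightarrow> real) \<Rightarrow> real \<Rightarrow>
     complex mat \<Rightarrow> nat \<Rightarrow> complex mat" where
  "rkmk_U N \<Psi> S a dt U i = (if i = 1 then U else \<Psi> (rkmk_Omega N \<Psi> S a dt U i) * U)"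

definition rkmk_step ::
    "nat \<Rightarrow> nat \<Rightarrow> (complex mat \<Rightarrow> complex mat) \<Rightarrow> complex mat \<Rightarrow> (nat \<Rightarrow> nat \<Rightarrow> real) \<Rightarrow>
     (nat \<Rightarrow> real) \<Rightarrow> real \<Rightarrow> complex mat \<Rightarrow> complex mat" where
  "rkmk_step N Ns \<Psi> S a b dt U =
     \<Psi> (mat N N (\<lambda>pq. complex_of_real dt * (\<Sum>i\<in>{1..Ns}. complex_of_real (b i) *
          right_triv_tangent_inv N \<Psi> (rkmk_Omega N \<Psi> S a dt U i)
            (field_L N S (rkmk_U N \<Psi> S a dt U i)) $$ pq))) * U"


section \<open>Arithmetic complexity\<close>

text \<open>Arithmetic cost is measured by straight-line programs over the complex numbers, without
  branching.  Each instruction is one operation, appends its value to the list of registers and may use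
  input values, integer constants and earlier registers.  Complex conjugation counts as an
  operation.  Division by zero, or use of a register not yet filled, makes a program fail.\<close>

datatype 'v operand = Input 'v | Const int | Reg nat

datatype 'v instr =
    Add "'v operand" "'v operand"
  | Sub "'v operand" "'v operand"
  | Mul "'v operand" "'v operand"
  | Div "'v operand" "'v operand"
  | Conj "'v operand"

fun operand_val :: "('v \<Rightarrow> complex) \<Rightarrow> complex list \<Rightarrow> 'v operand \<Rightarrow> complex option" where
  "operand_val env regs (Input v) = Some (env v)"
| "operand_val env regs (Const k) = Some (of_int k)"
| "operand_val env regs (Reg n) = (if n < length regs then Some (regs ! n) else None)"

definition binop :: "('a \<Rightarrow> 'a \<Rightarrow> 'b) \<Rightarrow> 'a option \<Rightarrow> 'a option \<Rightarrow> 'b option" where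
  "binop f x y = Option.bind x (\<lambda>u. Option.bind y (\<lambda>v. Some (f u v)))"

fun instr_val :: "('v \<Rightarrow> complex) \<Rightarrow> complex list \<Rightarrow> 'v instr \<Rightarrow> complex option" where
  "instr_val env regs (Add x y) = binop (+) (operand_val env regs x) (operand_val env regs y)"
| "instr_val env regs (Sub x y) = binop (-) (operand_val env regs x) (operand_val env regs y)"
| "instr_val env regs (Mul x y) = binop (*) (operand_val env regs x) (operand_val env regs y)"
| "instr_val env regs (Div x y) =
     (if operand_val env regs y = Some 0 then None
      else binop (/) (operand_val env regs x) (operand_val env regs y))"
| "instr_val env regs (Conj x) = map_option cnj (operand_val env regs x)"

fun slp_run :: "('v \<Rightarrow> complex) \<Rightarrow> complex list \<Rightarrow> 'v instr list \<Rightarrow> complex list option" where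
  "slp_run env regs [] = Some regs"
| "slp_run env regs (c # cs) =
     Option.bind (instr_val env regs c) (\<lambda>v. slp_run env (regs @ [v]) cs)"

text \<open>\<open>out i j\<close> tells where the program \<open>cs\<close> leaves the entry \<open>(i, j)\<close> of its result.\<close>

definition slp_computes ::
    "'v instr list \<Rightarrow> (nat \<Rightarrow> nat \<Rightarrow> 'v operand) \<Rightarrow> ('v \<Rightarrow> complex) \<Rightarrow> complex mat \<Rightarrow> bool" where
  "slp_computes cs out env Y \<longleftrightarrow>
     (\<exists>regs. slp_run env [] cs = Some regs \<and>
        (\<forall>i<dim_row Y. \<forall>j<dim_col Y. operand_val env regs (out i j) = Some (Y $$ (i, j))))"

datatype rkmk_input =
    In_U nat nat | In_S nat | In_a nat nat | In_b nat | In_dt | In_hbar | In_lap nat nat nat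

fun rkmk_env ::
    "nat \<Rightarrow> complex mat \<Rightarrow> (nat \<Rightarrow> nat \<Rightarrow> real) \<Rightarrow> (nat \<Rightarrow> real) \<Rightarrow> real \<Rightarrow> complex mat \<Rightarrow>
     rkmk_input \<Rightarrow> complex" where
  "rkmk_env N S a b dt U (In_U i j) = U $$ (i, j)"
| "rkmk_env N S a b dt U (In_S i) = S $$ (i, i)"
| "rkmk_env N S a b dt U (In_a i j) = complex_of_real (a i j)"
| "rkmk_env N S a b dt U (In_b i) = complex_of_real (b i)"
| "rkmk_env N S a b dt U In_dt = complex_of_real dt"
| "rkmk_env N S a b dt U In_hbar = complex_of_real (hbar N)"
| "rkmk_env N S a b dt U (In_lap m i j) = laplacian_diag N m i j"

end

theory Submission
  imports Defs
begin

text \<open>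
The stage matrices \<open>\<Omega>\<^sup>i\<close> are \<open>N \<times> N\<close>, but they have low rank and are never formed.  Write \<open>F\<close> for
the value of the vector field at a stage \<open>U\<close>.  As \<open>U\<^sup>*F\<close> is skew-Hermitian, \<open>\<L>(U) = F U\<^sup>* + U Z\<^sup>*\<close> with
\<open>Z = - (F + U (F\<^sup>*U))\<close>, a product of two factors with \<open>2r\<close> columns (\<open>field_L_factor\<close>).  For skew-Hermitian
\<open>\<Omega>\<close> the inverse trivialised tangent of the Cayley transform is \<open>A \<mapsto> (I - \<Omega>/2) A (I - \<Omega>/2)\<^sup>*\<close>
(\<open>right_triv_tangent_inv_cay\<close>), so it acts on the two factors separately.  Collecting the transformed factors
of all earlier stages as the columns of \<open>X\<close> and \<open>Y\<close> gives \<open>\<Omega>\<^sup>i = X D\<^sub>i Y\<^sup>*\<close> with \<open>2r(i - 1)\<close> columns, where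
only the diagonal matrix \<open>D\<^sub>i\<close> of Runge--Kutta coefficients depends on \<open>i\<close> beyond the number of columns
(\<open>Omega_low_rank\<close>).  By the Woodbury identity \<open>cay(\<Omega>\<^sup>i) U = U + X D\<^sub>i c\<close>, where \<open>c\<close> solves the small system
\<open>(I - Y\<^sup>*X D\<^sub>i / 2) c = Y\<^sup>*U\<close> (\<open>stage_U_low_rank\<close>).

Put \<open>k = 2 r N\<^sub>s\<close>, a bound for the number of columns.  A stage costs \<open>O(N r k)\<close> for transforming the new factors, for the new
entries of \<open>Y\<^sup>*X\<close> and for the update of \<open>U\<close>, \<open>O(k\<^sup>3)\<close> for the small system, and \<open>O(N\<^sup>2 r)\<close> for the field.
Summation over the stages gives the three terms.  The final update of the scheme has the shape of one more
stage, with the weights \<open>b\<close> as its coefficients (\<open>rkmk_step_eq_stage\<close>).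

A straight-line program cannot branch, hence cannot pivot: each divisor must be nonzero for all admissible
data.  The small system is solved by Gauss--Jordan elimination on its normal equations, whose matrix is
definite and so has nonzero pivots (\<open>gauss_jordan_pivot\<close>).  The inverse Laplacian costs \<open>O(N\<^sup>2)\<close>, because it
acts on each diagonal by a symmetric tridiagonal matrix.  Off the main diagonal the pivots stay away from zero
by diagonal dominance (\<open>lap_pivot_nonzero\<close>); on the main diagonal the matrix is singular, and two successive
summations solve the system, as for a one-dimensional Poisson equation.

The tridiagonal shape has to be derived from the definition by eigenvectors.  Up to scaling and a weight, the
entries of \<open>T\<^sub>l\<^sub>m\<close> given by Racah's formula are the coefficients of a polynomial \<open>(1 + z)\<^bsup>N-1-l\<^esup> h(z)\<close>, and
a three-term recurrence for them follows by induction on the exponent (\<open>hahn_recurrence\<close>).  It says that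
\<open>T\<^sub>l\<^sub>m\<close> is an eigenvector of the Casimir operator of the \<open>N\<close>-dimensional representation of \<open>su(2)\<close>.  The
eigenvalues on one diagonal are distinct, so the \<open>T\<^sub>l\<^sub>m\<close> form a basis and the discrete Laplacian is this
Casimir operator (\<open>discrete_laplacian_eq_casimir\<close>).

Costs are counted in a calculus on functions of the input data, without register names (\<open>computes\<close>);
registers are assigned once, in \<open>computes_program\<close>.
\<close>

section \<open>Straight-line computations without registers\<close>

text \<open>\<open>W\<close> is a set of problem instances and a value is a function of the instance.  Since one program has to serve
all instances, an operation is meaningful only for values of this kind; divisors must not vanish anywhere on
\<open>W\<close>.  Values matter only on \<open>W\<close>.\<close>

inductive op_result :: "'w set \<Rightarrow> ('w \<Rightarrow> complex) set \<Rightarrow> ('w \<Rightarrow> complex) \<Rightarrow> bool" for W F where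
  op_add: "x \<in> F \<Longrightarrow> y \<in> F \<Longrightarrow> (\<And>w. w \<in> W \<Longrightarrow> f w = x w + y w) \<Longrightarrow> op_result W F f"
| op_sub: "x \<in> F \<Longrightarrow> y \<in> F \<Longrightarrow> (\<And>w. w \<in> W \<Longrightarrow> f w = x w - y w) \<Longrightarrow> op_result W F f"
| op_mul: "x \<in> F \<Longrightarrow> y \<in> F \<Longrightarrow> (\<And>w. w \<in> W \<Longrightarrow> f w = x w * y w) \<Longrightarrow> op_result W F f"
| op_div: "x \<in> F \<Longrightarrow> y \<in> F \<Longrightarrow> (\<And>w. w \<in> W \<Longrightarrow> y w \<noteq> 0 \<and> f w = x w / y w) \<Longrightarrow> op_result W F f"
| op_cnj: "x \<in> F \<Longrightarrow> (\<And>w. w \<in> W \<Longrightarrow> f w = cnj (x w)) \<Longrightarrow> op_result W F f"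

definition held :: "'w set \<Rightarrow> ('w \<Rightarrow> complex) set \<Rightarrow> ('w \<Rightarrow> complex) \<Rightarrow> bool" where
  "held W F g \<longleftrightarrow> (\<exists>f\<in>F. \<forall>w\<in>W. f w = g w)"

text \<open>\<open>computes W F k G\<close>: at most \<open>k\<close> operations lead from the values \<open>F\<close> to values that include \<open>G\<close>.
The sets may be infinite, which allows \<open>F\<close> to contain all inputs and constants.\<close>

inductive computes :: "'w set \<Rightarrow> ('w \<Rightarrow> complex) set \<Rightarrow> nat \<Rightarrow> ('w \<Rightarrow> complex) set \<Rightarrow> bool" for W where
  computes_held: "(\<And>g. g \<in> G \<Longrightarrow> held W F g) \<Longrightarrow> computes W F k G"
| computes_step: "op_result W F f \<Longrightarrow> computes W (insert f F) k G \<Longrightarrow> computes W F (Suc k) G"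

lemma held_mem: "g \<in> F \<Longrightarrow> held W F g"
  unfolding held_def by blast

lemma held_trans: "held W F g \<Longrightarrow> (\<And>f. f \<in> F \<Longrightarrow> held W F' f) \<Longrightarrow> held W F' g"
  unfolding held_def by metis

lemma op_result_mono:
  assumes "op_result W F f" "\<And>f. f \<in> F \<Longrightarrow> held W F' f"
  shows "op_result W F' f"
  using assms(1)
proof cases
  case (op_add x y)
  obtain x' y' where "x' \<in> F'" "y' \<in> F'" "\<forall>w\<in>W. x' w = x w" "\<forall>w\<in>W. y' w = y w"
    using assms(2)[OF op_add(1)] assms(2)[OF op_add(2)] unfolding held_def by blast
  then show ?thesis using op_add(3) by (intro op_result.op_add[of x' F' y']) auto
next
  case (op_sub x y)
  obtain x' y' where "x' \<in> F'" "y' \<in> F'" "\<forall>w\<in>W. x' w = x w" "\<forall>w\<in>W. y' w = y w"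
    using assms(2)[OF op_sub(1)] assms(2)[OF op_sub(2)] unfolding held_def by blast
  then show ?thesis using op_sub(3) by (intro op_result.op_sub[of x' F' y']) auto
next
  case (op_mul x y)
  obtain x' y' where "x' \<in> F'" "y' \<in> F'" "\<forall>w\<in>W. x' w = x w" "\<forall>w\<in>W. y' w = y w"
    using assms(2)[OF op_mul(1)] assms(2)[OF op_mul(2)] unfolding held_def by blast
  then show ?thesis using op_mul(3) by (intro op_result.op_mul[of x' F' y']) auto
next
  case (op_div x y)
  obtain x' y' where "x' \<in> F'" "y' \<in> F'" "\<forall>w\<in>W. x' w = x w" "\<forall>w\<in>W. y' w = y w"
    using assms(2)[OF op_div(1)] assms(2)[OF op_div(2)] unfolding held_def by blast
  then show ?thesis using op_div(3) by (intro op_result.op_div[of x' F' y']) auto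
next
  case (op_cnj x)
  obtain x' where "x' \<in> F'" "\<forall>w\<in>W. x' w = x w"
    using assms(2)[OF op_cnj(1)] unfolding held_def by blast
  then show ?thesis using op_cnj(2) by (intro op_result.op_cnj[of x' F']) auto
qed

lemma computes_mono:
  assumes "computes W F k G" "\<And>f. f \<in> F \<Longrightarrow> held W F' f" "k \<le> k'" "H \<subseteq> G"
  shows "computes W F' k' H"
  using assms
proof (induction arbitrary: F' k' H rule: computes.induct)
  case (computes_held G F k)
  show ?case
    by (rule computes.computes_held, rule held_trans[OF computes_held.hyps])
      (use computes_held.prems in auto)
next
  case (computes_step F f k G)
  obtain k'' where k'': "k' = Suc k''" "k \<le> k''"
    using computes_step.prems(2) by (cases k') auto
  have "computes W (insert f F') k'' H"
    using computes_step.prems k''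
    by (intro computes_step.IH) (auto simp: held_def)
  then show ?case
    unfolding k'' using op_result_mono[OF computes_step.hyps(1) computes_step.prems(1)]
    by (blast intro: computes.computes_step)
qed

lemma computes_weaken: "computes W F k G \<Longrightarrow> k \<le> k' \<Longrightarrow> computes W F k' G"
  by (erule computes_mono) (auto intro: held_mem)

lemma computes_subset: "computes W F k G \<Longrightarrow> H \<subseteq> G \<Longrightarrow> computes W F k H"
  by (erule computes_mono) (auto intro: held_mem)

lemma computes_more_held: "computes W F k G \<Longrightarrow> F \<subseteq> F' \<Longrightarrow> computes W F' k G"
  by (erule computes_mono) (auto intro: held_mem)

lemma computes_keep: "computes W F k H \<Longrightarrow> (\<And>g. g \<in> G \<Longrightarrow> held W F g) \<Longrightarrow> computes W F k (G \<union> H)"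
proof (induction rule: computes.induct)
  case (computes_held H F k)
  then show ?case by (intro computes.computes_held) auto
next
  case (computes_step F f k H)
  then show ?case by (intro computes.computes_step[OF computes_step.hyps(1)]) (auto simp: held_def)
qed

lemma computes_trans:
  assumes "computes W F k G" "computes W (F \<union> G) k' H"
  shows "computes W F (k + k') (G \<union> H)"
  using assms
proof (induction rule: computes.induct)
  case (computes_held G F k)
  have "computes W F k' H"
    using computes_held by (intro computes_mono[OF computes_held.prems]) (auto intro: held_mem)
  then have "computes W F k' (G \<union> H)"
    by (rule computes_keep) (rule computes_held)
  then show ?case by (rule computes_weaken) simp
next
  case (computes_step F f k G)
  have "computes W (insert f F) (k + k') (G \<union> H)"
    using computes_step.prems by (intro computes_step.IH) (auto elim: computes_more_held)
  then show ?case using computes.computes_step[OF computes_step.hyps(1)] by simp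
qed

lemma computes_seq:
  assumes "\<And>i. i < n \<Longrightarrow> computes W (F \<union> (\<Union>j<i. G j)) k (G i)"
  shows "computes W F (n * k) (\<Union>j<n. G j)"
  using assms
proof (induction n)
  case 0
  then show ?case by (auto intro: computes_held)
next
  case (Suc n)
  have "computes W F (n * k + k) ((\<Union>j<n. G j) \<union> G n)"
    using Suc by (intro computes_trans) auto
  then show ?case by (simp add: lessThan_Suc Un_commute add.commute)
qed

lemma computes_family:
  assumes "\<And>i. i < n \<Longrightarrow> computes W F k (G i)"
  shows "computes W F (n * k) (\<Union>i<n. G i)"
  by (rule computes_seq, rule computes_more_held[OF assms]) auto

lemma computes_then:
  assumes "computes W F k G" "computes W (F \<union> G) k' H"
  shows "computes W F (k + k') H"
  by (rule computes_subset[OF computes_trans[OF assms]]) auto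

subsection \<open>Costs of expressions\<close>

definition constants :: "('w \<Rightarrow> complex) set" where
  "constants = {(\<lambda>w. of_int z) | z. True}"

lemma computes_mem: "f \<in> F \<Longrightarrow> computes W F 0 {f}"
  by (rule computes_held) (auto intro: held_mem)

lemma computes_cong:
  "computes W F k {f} \<Longrightarrow> (\<And>w. w \<in> W \<Longrightarrow> f w = g w) \<Longrightarrow> computes W F k {g}"
  using computes_then[of W F k "{f}" 0 "{g}"] computes_held[of "{g}" W "F \<union> {f}" 0]
  by (simp add: held_def)

lemma computes_binary:
  assumes "computes W F k {f}" "computes W F k' {g}" "op_result W {f, g} h"
  shows "computes W F (k + k' + 1) {h}"
proof -
  have "computes W F (k + k') ({f} \<union> {g})"
    by (rule computes_trans[OF assms(1)], rule computes_more_held[OF assms(2)]) auto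
  moreover have "computes W (F \<union> ({f} \<union> {g})) 1 {h}"
    unfolding One_nat_def
  proof (rule computes_step)
    show "op_result W (F \<union> ({f} \<union> {g})) h"
      by (rule op_result_mono[OF assms(3)]) (auto intro: held_mem)
    show "computes W (insert h (F \<union> ({f} \<union> {g}))) 0 {h}"
      by (rule computes_held) (auto intro: held_mem)
  qed
  ultimately show ?thesis by (rule computes_then)
qed

lemma computes_add:
  "computes W F k {f} \<Longrightarrow> computes W F k' {g} \<Longrightarrow> computes W F (k + k' + 1) {\<lambda>w. f w + g w}"
  by (erule computes_binary, assumption, rule op_add) auto

lemma computes_diff:
  "computes W F k {f} \<Longrightarrow> computes W F k' {g} \<Longrightarrow> computes W F (k + k' + 1) {\<lambda>w. f w - g w}"
  by (erule computes_binary, assumption, rule op_sub) auto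

lemma computes_mult:
  "computes W F k {f} \<Longrightarrow> computes W F k' {g} \<Longrightarrow> computes W F (k + k' + 1) {\<lambda>w. f w * g w}"
  by (erule computes_binary, assumption, rule op_mul) auto

lemma computes_divide:
  "computes W F k {f} \<Longrightarrow> computes W F k' {g} \<Longrightarrow> (\<And>w. w \<in> W \<Longrightarrow> g w \<noteq> 0) \<Longrightarrow>
   computes W F (k + k' + 1) {\<lambda>w. f w / g w}"
  by (erule computes_binary, assumption, rule op_div[of f _ g]) auto

lemma computes_cnj: "computes W F k {f} \<Longrightarrow> computes W F (k + 1) {\<lambda>w. cnj (f w)}"
proof (erule computes_then)
  have "op_result W (F \<union> {f}) (\<lambda>w. cnj (f w))"
    by (rule op_cnj[of f]) auto
  then show "computes W (F \<union> {f}) 1 {\<lambda>w. cnj (f w)}"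
    unfolding One_nat_def by (rule computes_step) (auto intro!: computes_held held_mem)
qed

lemma computes_of_int: "constants \<subseteq> F \<Longrightarrow> computes W F 0 {\<lambda>w. of_int z}"
  by (rule computes_mem) (auto simp: constants_def)

lemma computes_0: "constants \<subseteq> F \<Longrightarrow> computes W F 0 {\<lambda>w. 0}"
  and computes_1: "constants \<subseteq> F \<Longrightarrow> computes W F 0 {\<lambda>w. 1}"
  and computes_numeral: "constants \<subseteq> F \<Longrightarrow> computes W F 0 {\<lambda>w. numeral n}"
  and computes_of_nat: "constants \<subseteq> F \<Longrightarrow> computes W F 0 {\<lambda>w. of_nat k}"
  using computes_of_int[of F W 0] computes_of_int[of F W 1] computes_of_int[of F W "numeral n"]
    computes_of_int[of F W "int k"] by auto

lemma computes_uminus: "constants \<subseteq> F \<Longrightarrow> computes W F k {f} \<Longrightarrow> computes W F (k + 1) {\<lambda>w. - f w}"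
  using computes_diff[OF computes_0, of F W k f] by simp

lemma computes_sum:
  assumes "constants \<subseteq> F" "\<And>p. p < n \<Longrightarrow> computes W F k {f p}"
  shows "computes W F (n * (k + 1)) {\<lambda>w. \<Sum>p<n. f p w}"
  using assms(2)
proof (induction n)
  case 0
  then show ?case using computes_0[OF assms(1)] by simp
next
  case (Suc n)
  have "computes W F (n * (k + 1) + k + 1) {\<lambda>w. (\<Sum>p<n. f p w) + f n w}"
    by (rule computes_add) (use Suc in auto)
  then show ?case by (simp add: algebra_simps)
qed

definition entries :: "nat \<Rightarrow> nat \<Rightarrow> ('w \<Rightarrow> nat \<Rightarrow> nat \<Rightarrow> complex) \<Rightarrow> ('w \<Rightarrow> complex) set" where
  "entries n m A = {(\<lambda>w. A w i j) | i j. i < n \<and> j < m}"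

lemma computes_entry: "entries n m A \<subseteq> F \<Longrightarrow> i < n \<Longrightarrow> j < m \<Longrightarrow> computes W F 0 {\<lambda>w. A w i j}"
  by (rule computes_mem) (auto simp: entries_def)

lemma computes_entries:
  assumes "\<And>i j. i < n \<Longrightarrow> j < m \<Longrightarrow> computes W F k {\<lambda>w. A w i j}"
  shows "computes W F (n * m * k) (entries n m A)"
proof -
  have "computes W F (n * (m * k)) (\<Union>i<n. \<Union>j<m. {\<lambda>w. A w i j})"
    by (intro computes_family assms)
  moreover have "(\<Union>i<n. \<Union>j<m. {\<lambda>w. A w i j}) = entries n m A"
    by (auto simp: entries_def)
  ultimately show ?thesis by (simp add: mult.assoc)
qed

subsection \<open>Realisation by programs\<close>

lemma slp_run_append:
  "slp_run env regs (cs @ ds) = Option.bind (slp_run env regs cs) (\<lambda>rs. slp_run env rs ds)"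
  by (induction cs arbitrary: regs) (auto split: Option.bind_splits)

lemma slp_run_length: "slp_run env regs cs = Some rs \<Longrightarrow> length rs = length regs + length cs"
  by (induction cs arbitrary: regs) (auto split: Option.bind_splits)

text \<open>The operand is the same for all instances, so the output registers do not depend on the data.\<close>

definition leaves :: "'w set \<Rightarrow> ('w \<Rightarrow> 'v \<Rightarrow> complex) \<Rightarrow> 'v instr list \<Rightarrow> ('w \<Rightarrow> complex) \<Rightarrow> 'v operand \<Rightarrow> bool" where
  "leaves W env cs f x \<longleftrightarrow>
     (\<forall>w\<in>W. \<exists>rs. slp_run (env w) [] cs = Some rs \<and> operand_val (env w) rs x = Some (f w))"

lemma operand_val_append: "operand_val env rs x = Some v \<Longrightarrow> operand_val env (rs @ rs') x = Some v"
  by (cases x) (auto split: if_splits simp: nth_append)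

lemma leaves_append_instr:
  assumes run: "\<And>w. w \<in> W \<Longrightarrow> \<exists>rs. slp_run (env w) [] cs = Some rs \<and> instr_val (env w) rs c = Some (f w)"
  shows "leaves W env (cs @ [c]) f (Reg (length cs))"
    and "leaves W env cs g x \<Longrightarrow> leaves W env (cs @ [c]) g x"
proof -
  show "leaves W env (cs @ [c]) f (Reg (length cs))"
    unfolding leaves_def
  proof
    fix w assume "w \<in> W"
    then obtain rs where rs: "slp_run (env w) [] cs = Some rs" "instr_val (env w) rs c = Some (f w)"
      using run by blast
    show "\<exists>rs. slp_run (env w) [] (cs @ [c]) = Some rs \<and>
        operand_val (env w) rs (Reg (length cs)) = Some (f w)"
      using rs slp_run_length[OF rs(1)] by (auto simp: slp_run_append nth_append)
  qed
  assume g: "leaves W env cs g x"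
  show "leaves W env (cs @ [c]) g x"
    unfolding leaves_def
  proof
    fix w assume w: "w \<in> W"
    then obtain rs where rs: "slp_run (env w) [] cs = Some rs" "instr_val (env w) rs c = Some (f w)"
      using run by blast
    then show "\<exists>rs. slp_run (env w) [] (cs @ [c]) = Some rs \<and> operand_val (env w) rs x = Some (g w)"
      using g w by (auto simp: slp_run_append leaves_def intro!: operand_val_append)
  qed
qed

lemma leaves_binary:
  assumes "leaves W env cs x a" "leaves W env cs y b"
    and "\<And>w rs. w \<in> W \<Longrightarrow> operand_val (env w) rs a = Some (x w) \<Longrightarrow>
           operand_val (env w) rs b = Some (y w) \<Longrightarrow> instr_val (env w) rs c = Some (f w)"
  shows "\<forall>w\<in>W. \<exists>rs. slp_run (env w) [] cs = Some rs \<and> instr_val (env w) rs c = Some (f w)"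
proof
  fix w assume w: "w \<in> W"
  from assms(1) w obtain rs where rs: "slp_run (env w) [] cs = Some rs" "operand_val (env w) rs a = Some (x w)"
    unfolding leaves_def by blast
  moreover from assms(2) w rs(1) have "operand_val (env w) rs b = Some (y w)"
    unfolding leaves_def by auto
  ultimately show "\<exists>rs. slp_run (env w) [] cs = Some rs \<and> instr_val (env w) rs c = Some (f w)"
    using assms(3)[OF w] by blast
qed

lemma op_result_instr:
  assumes "op_result W F f" and F: "\<And>g. g \<in> F \<Longrightarrow> \<exists>x. leaves W env cs g x"
  shows "\<exists>c. \<forall>w\<in>W. \<exists>rs. slp_run (env w) [] cs = Some rs \<and> instr_val (env w) rs c = Some (f w)"
  using assms(1)
proof cases
  case (op_add x y)
  from F[OF op_add(1)] obtain a where a: "leaves W env cs x a" ..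
  from F[OF op_add(2)] obtain b where b: "leaves W env cs y b" ..
  show ?thesis
    by (rule exI[of _ "Add a b"], rule leaves_binary[OF a b]) (simp add: binop_def op_add(3))
next
  case (op_sub x y)
  from F[OF op_sub(1)] obtain a where a: "leaves W env cs x a" ..
  from F[OF op_sub(2)] obtain b where b: "leaves W env cs y b" ..
  show ?thesis
    by (rule exI[of _ "Sub a b"], rule leaves_binary[OF a b]) (simp add: binop_def op_sub(3))
next
  case (op_mul x y)
  from F[OF op_mul(1)] obtain a where a: "leaves W env cs x a" ..
  from F[OF op_mul(2)] obtain b where b: "leaves W env cs y b" ..
  show ?thesis
    by (rule exI[of _ "Mul a b"], rule leaves_binary[OF a b]) (simp add: binop_def op_mul(3))
next
  case (op_div x y)
  from F[OF op_div(1)] obtain a where a: "leaves W env cs x a" ..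
  from F[OF op_div(2)] obtain b where b: "leaves W env cs y b" ..
  show ?thesis
    by (rule exI[of _ "Div a b"], rule leaves_binary[OF a b]) (simp add: binop_def op_div(3))
next
  case (op_cnj x)
  from F[OF op_cnj(1)] obtain a where a: "leaves W env cs x a" ..
  show ?thesis
    by (rule exI[of _ "Conj a"], rule leaves_binary[OF a a]) (simp add: op_cnj(2))
qed

lemma computes_extend_program:
  assumes "computes W F k G" "\<And>f. f \<in> F \<Longrightarrow> \<exists>x. leaves W env cs f x"
  shows "\<exists>ds. length ds \<le> k \<and> (\<forall>g\<in>G. \<exists>x. leaves W env (cs @ ds) g x)"
  using assms
proof (induction arbitrary: cs rule: computes.induct)
  case (computes_held G F k)
  show ?case
  proof (rule exI[of _ "[]"], intro conjI ballI)
    fix g assume "g \<in> G"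
    then obtain f where f: "f \<in> F" "\<forall>w\<in>W. f w = g w" using computes_held.hyps unfolding held_def by blast
    then show "\<exists>x. leaves W env (cs @ []) g x"
      using computes_held.prems[OF f(1)] unfolding leaves_def by auto
  qed simp
next
  case (computes_step F f k G)
  obtain c where c: "\<And>w. w \<in> W \<Longrightarrow> \<exists>rs. slp_run (env w) [] cs = Some rs \<and> instr_val (env w) rs c = Some (f w)"
    using op_result_instr[OF computes_step.hyps(1) computes_step.prems] by auto
  have "\<exists>x. leaves W env (cs @ [c]) g x" if "g \<in> insert f F" for g
  proof (cases "g = f")
    case True
    then show ?thesis using leaves_append_instr(1)[where f = f, OF c] by auto
  next
    case False
    with that have "g \<in> F" by simp
    from computes_step.prems[OF this] obtain x where "leaves W env cs g x" ..
    from leaves_append_instr(2)[where f = f, OF c this] show ?thesis by auto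
  qed
  from computes_step.IH[OF this] obtain ds where "length ds \<le> k" "\<forall>g\<in>G. \<exists>x. leaves W env ((cs @ [c]) @ ds) g x"
    by auto
  then show ?case by (intro exI[of _ "c # ds"]) auto
qed

text \<open>A derivation of \<open>computes\<close> lists the operations in the order in which they are executed.  Each step appends
one instruction whose register holds the new value, and registers filled earlier keep their contents.\<close>

theorem computes_program:
  fixes env :: "'w \<Rightarrow> 'v \<Rightarrow> complex"
  assumes "computes W (range (\<lambda>v w. env w v) \<union> constants) k (entries n m Y)" "0 < n" "0 < m"
  shows "\<exists>cs out. length cs \<le> k \<and>
    (\<forall>w\<in>W. \<forall>M\<in>carrier_mat n m. (\<forall>i<n. \<forall>j<m. M $$ (i, j) = Y w i j) \<longrightarrow> slp_computes cs out (env w) M)"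
proof -
  have "\<exists>x. leaves W env [] f x" if f: "f \<in> range (\<lambda>v w. env w v) \<union> constants" for f
  proof (cases "f \<in> constants")
    case True
    then obtain z where "f = (\<lambda>w. of_int z)" by (auto simp: constants_def)
    then show ?thesis by (intro exI[of _ "Const z"]) (auto simp: leaves_def)
  next
    case False
    then obtain v where "f = (\<lambda>w. env w v)" using f False by auto
    then show ?thesis by (intro exI[of _ "Input v"]) (auto simp: leaves_def)
  qed
  from computes_extend_program[OF assms(1) this] obtain cs where cs: "length cs \<le> k"
    "\<forall>g\<in>entries n m Y. \<exists>x. leaves W env cs g x" by auto
  define out where "out i j = (SOME x. leaves W env cs (\<lambda>w. Y w i j) x)" for i j
  have out: "leaves W env cs (\<lambda>w. Y w i j) (out i j)" if "i < n" "j < m" for i j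
  proof -
    have "(\<lambda>w. Y w i j) \<in> entries n m Y" using that unfolding entries_def by blast
    from cs(2)[THEN bspec, OF this] show ?thesis unfolding out_def by (rule someI_ex)
  qed
  show ?thesis
  proof (intro exI[of _ cs] exI[of _ out] conjI ballI impI cs(1))
    fix w M assume w: "w \<in> W" and M: "M \<in> carrier_mat n m" "\<forall>i<n. \<forall>j<m. M $$ (i, j) = Y w i j"
    show "slp_computes cs out (env w) M"
    proof -
      obtain rs where rs: "slp_run (env w) [] cs = Some rs"
        using out[OF assms(2,3)] w by (auto simp: leaves_def)
      have "operand_val (env w) rs (out i j) = Some (M $$ (i, j))" if "i < n" "j < m" for i j
        using out[OF that] w rs M that unfolding leaves_def by auto
      then show ?thesis using rs M(1) unfolding slp_computes_def by auto
    qed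
  qed
qed

section \<open>The discrete Laplacian as a tridiagonal operator\<close>

subsection \<open>The coefficients of the matrices T\<close>

text \<open>Binomial coefficients, extended by zero to negative lower index.\<close>

definition binz :: "nat \<Rightarrow> int \<Rightarrow> real" where
  "binz n k = (if 0 \<le> k then real (n choose nat k) else 0)"

text \<open>The coefficient of \<open>z\<^sup>i\<close> in \<open>(1 + z)\<^sup>M \<Sum>\<^sub>t (-1)\<^sup>t (l choose t) (l choose t - m) z\<^sup>t\<close>.  As a function of \<open>i\<close>,
and for \<open>M = N - 1 - l\<close>, this is a discrete Hahn polynomial times a weight; it is the part of a Wigner
3j-symbol that is not a product of factorials.\<close>

definition hahn :: "nat \<Rightarrow> nat \<Rightarrow> int \<Rightarrow> int \<Rightarrow> real" where
  "hahn M l m i = (\<Sum>t\<le>l. (-1) ^ t * real (l choose t) * binz l (int t - m) * binz M (i - int t))"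

lemma binz_Suc: "binz (Suc n) k = binz n k + binz n (k - 1)"
proof -
  consider "k < 0" | "k = 0" | "0 < k" by linarith
  then show ?thesis
  proof cases
    case 3
    then have "nat k = Suc (nat (k - 1))" by simp
    then show ?thesis using 3 by (simp add: binz_def)
  qed (auto simp: binz_def)
qed

lemma binz_absorb: "(of_int k + 1) * binz n (k + 1) = (real n - of_int k) * binz n k"
proof -
  consider "k < - 1" | "k = - 1" | "0 \<le> k" by linarith
  then show ?thesis
  proof cases
    case 3
    define j where "j = nat k"
    have k: "k = int j" using 3 j_def by simp
    have "real (Suc j * (n choose Suc j)) = real ((n - j) * (n choose j))"
      using binomial_absorb_comp[of n j] by (metis binomial_absorption)
    moreover have "real (n - j) * real (n choose j) = (real n - real j) * real (n choose j)"
      by (cases "j \<le> n") (auto simp: of_nat_diff binomial_eq_0)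
    ultimately show ?thesis unfolding k by (simp add: binz_def nat_add_distrib algebra_simps)
  qed (auto simp: binz_def)
qed

lemma binz_0: "binz 0 k = (if k = 0 then 1 else 0)"
  by (auto simp: binz_def)

lemma hahn_Suc: "hahn (Suc M) l m i = hahn M l m i + hahn M l m (i - 1)"
  unfolding hahn_def binz_Suc by (simp add: algebra_simps sum.distrib)

lemma hahn_0: "hahn 0 l m i = (-1) ^ nat i * binz l i * binz l (i - m)"
proof (cases "0 \<le> i \<and> i \<le> int l")
  case True
  have "hahn 0 l m i = (\<Sum>t\<le>l. if t = nat i then (-1) ^ t * real (l choose t) * binz l (int t - m) else 0)"
    unfolding hahn_def binz_0 using True by (intro sum.cong) auto
  also have "\<dots> = (-1) ^ nat i * binz l i * binz l (i - m)"
    using True by (subst sum.delta) (auto simp: binz_def)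
  finally show ?thesis .
next
  case False
  then have "hahn 0 l m i = 0"
    unfolding hahn_def binz_0 by (intro sum.neutral) auto
  moreover have "binz l i = 0" using False by (auto simp: binz_def)
  ultimately show ?thesis by simp
qed

lemma hahn_0_ratio:
  "(of_int i + 1) * (of_int i + 1 - of_int m) * hahn 0 l m (i + 1)
    = - ((real l - of_int i) * (real l + of_int m - of_int i) * hahn 0 l m i)"
proof (cases "0 \<le> i")
  case True
  have "hahn 0 l m (i + 1) = - ((-1) ^ nat i * (binz l (i + 1) * binz l (i + 1 - m)))"
    using True unfolding hahn_0 by (simp add: nat_add_distrib)
  then have "(of_int i + 1) * (of_int i + 1 - of_int m) * hahn 0 l m (i + 1)
     = - ((-1) ^ nat i * ((of_int i + 1) * (of_int i + 1 - of_int m) * (binz l (i + 1) * binz l (i + 1 - m))))"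
    by simp
  also have "(of_int i + 1) * (of_int i + 1 - of_int m) * (binz l (i + 1) * binz l (i + 1 - m))
     = ((of_int i + 1) * binz l (i + 1)) * ((of_int (i - m) + 1) * binz l (i - m + 1))"
    by (simp add: algebra_simps)
  also have "\<dots> = ((real l - of_int i) * binz l i) * ((real l - of_int (i - m)) * binz l (i - m))"
    unfolding binz_absorb ..
  finally show ?thesis unfolding hahn_0 by (simp add: algebra_simps)
next
  case False
  then show ?thesis unfolding hahn_0 by (cases "i = - 1") (auto simp: binz_def)
qed

text \<open>Raising \<open>M\<close> by one adds the shifted sequence to the sequence itself.  The recurrence at \<open>M + 1\<close> is then the
sum of those at \<open>M\<close> for \<open>i\<close> and \<open>i - 1\<close>, because the change of the polynomial coefficients cancels.  At
\<open>M = 0\<close> only one term of the defining sum is left, and neighbouring terms have the ratio \<open>hahn_0_ratio\<close>.\<close>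

lemma hahn_recurrence:
  fixes M l :: nat and m i :: int
  defines "n \<equiv> real M + real l + 1"
  shows "(of_int i + 1) * (of_int i + 1 - of_int m) * hahn M l m (i + 1)
       + (n - of_int i) * (n - of_int i + of_int m) * hahn M l m (i - 1)
       = ((n\<^sup>2 - 1) / 2 - (2 * of_int i - n + 1) * (2 * (of_int i - of_int m) - n + 1) / 2
           - real l * (real l + 1)) * hahn M l m i"
  unfolding n_def
proof (induction M arbitrary: i)
  case 0
  define x y z where "x = (of_int i :: real)" "y = (of_int m :: real)" "z = real l"
  have 1: "(x + 1) * (x + 1 - y) * hahn 0 l m (i + 1) = - ((z - x) * (z + y - x) * hahn 0 l m i)"
    using hahn_0_ratio[of i m l] unfolding x_y_z_def .
  have 2: "(z - x + 1) * (z + y - x + 1) * hahn 0 l m (i - 1) = - (x * (x - y) * hahn 0 l m i)"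
    using hahn_0_ratio[of "i - 1" m l] unfolding x_y_z_def by (simp add: algebra_simps)
  have 3: "(z + 1 - x) * (z + 1 - x + y) * hahn 0 l m (i - 1) = - (x * (x - y) * hahn 0 l m i)"
    unfolding 2[symmetric] by (simp add: algebra_simps)
  show ?case
    unfolding x_y_z_def[symmetric] using 1 3 by (simp add: field_simps power2_eq_square)
next
  case (Suc M)
  define x y z k where "x = (of_int i :: real)" "y = (of_int m :: real)" "z = real l" "k = real M"
  define u0 u1 u2 u3 where u: "u0 = hahn M l m (i + 1)" "u1 = hahn M l m i" "u2 = hahn M l m (i - 1)"
    "u3 = hahn M l m (i - 2)"
  have 1: "(x + 1) * (x + 1 - y) * u0 + (k + z + 1 - x) * (k + z + 1 - x + y) * u2
      = (((k + z + 1)\<^sup>2 - 1) / 2 - (2 * x - (k + z + 1) + 1) * (2 * (x - y) - (k + z + 1) + 1) / 2 - z * (z + 1)) * u1"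
    using Suc[of i] unfolding x_y_z_k_def u by simp
  have 2: "x * (x - y) * u1 + (k + z + 1 - (x - 1)) * (k + z + 1 - (x - 1) + y) * u3
      = (((k + z + 1)\<^sup>2 - 1) / 2 - (2 * (x - 1) - (k + z + 1) + 1) * (2 * (x - 1 - y) - (k + z + 1) + 1) / 2 - z * (z + 1)) * u2"
    using Suc[of "i - 1"] unfolding x_y_z_k_def u by simp
  have "((x + 1) * (x + 1 - y) * (u0 + u1) + (k + 1 + z + 1 - x) * (k + 1 + z + 1 - x + y) * (u2 + u3))
      - (((k + 1 + z + 1)\<^sup>2 - 1) / 2 - (2 * x - (k + 1 + z + 1) + 1) * (2 * (x - y) - (k + 1 + z + 1) + 1) / 2 - z * (z + 1)) * (u1 + u2)
    = (((x + 1) * (x + 1 - y) * u0 + (k + z + 1 - x) * (k + z + 1 - x + y) * u2)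
      - (((k + z + 1)\<^sup>2 - 1) / 2 - (2 * x - (k + z + 1) + 1) * (2 * (x - y) - (k + z + 1) + 1) / 2 - z * (z + 1)) * u1)
    + ((x * (x - y) * u1 + (k + z + 1 - (x - 1)) * (k + z + 1 - (x - 1) + y) * u3)
      - (((k + z + 1)\<^sup>2 - 1) / 2 - (2 * (x - 1) - (k + z + 1) + 1) * (2 * (x - 1 - y) - (k + z + 1) + 1) / 2 - z * (z + 1)) * u2)"
    by (simp add: power2_eq_square field_simps)
  then have "(x + 1) * (x + 1 - y) * (u0 + u1) + (k + 1 + z + 1 - x) * (k + 1 + z + 1 - x + y) * (u2 + u3)
      = (((k + 1 + z + 1)\<^sup>2 - 1) / 2 - (2 * x - (k + 1 + z + 1) + 1) * (2 * (x - y) - (k + 1 + z + 1) + 1) / 2 - z * (z + 1)) * (u1 + u2)"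
    unfolding 1 2 by simp
  then show ?case
    unfolding x_y_z_k_def u hahn_Suc by (simp add: add_ac)
qed

text \<open>At \<open>i = max 0 m\<close>, the first index of the support, exactly one term of the sum is nonzero.\<close>

lemma hahn_nonzero:
  assumes "\<bar>m\<bar> \<le> int l"
  shows "hahn M l m (max 0 m) \<noteq> 0"
proof -
  define t0 where "t0 = nat m"
  have t0: "int t0 = max 0 m" "t0 \<le> l" using assms by (auto simp: t0_def)
  have "hahn M l m (max 0 m) = (\<Sum>t\<le>l. if t = t0 then (-1) ^ t * real (l choose t) * binz l (int t - m) else 0)"
    unfolding hahn_def
  proof (rule sum.cong[OF refl])
    fix t assume "t \<in> {..l}"
    consider "t = t0" | "t < t0" | "t0 < t" by linarith
    then show "(- 1) ^ t * real (l choose t) * binz l (int t - m) * binz M (max 0 m - int t)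
      = (if t = t0 then (- 1) ^ t * real (l choose t) * binz l (int t - m) else 0)"
    proof cases
      case 1
      then show ?thesis unfolding t0(1)[symmetric] by (simp add: binz_def)
    next
      case 2
      then have "int t - m < 0" using t0 by auto
      then show ?thesis using 2 by (simp add: binz_def)
    next
      case 3
      then show ?thesis unfolding t0(1)[symmetric] by (simp add: binz_def)
    qed
  qed
  also have "\<dots> = (-1) ^ t0 * real (l choose t0) * binz l (int t0 - m)"
    using t0 by (subst sum.delta) auto
  also have "\<dots> \<noteq> 0"
    using t0 assms by (auto simp: binz_def not_less)
  finally show ?thesis .
qed

subsection \<open>Racah's formula\<close>

lemma ifact_of_int: "ifact (of_int z) = fact (nat z)"
  by (simp add: ifact_def)

lemma inverse_factorials:
  assumes "0 \<le> k" "k \<le> int n"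
  shows "1 / (fact (nat k) * fact (nat (int n - k))) = binz n k / fact n"
proof -
  have k: "nat k \<le> n" "nat (int n - k) = n - nat k" using assms by auto
  show ?thesis using assms k(1) unfolding k(2) by (simp add: binz_def binomial_fact field_simps)
qed

text \<open>The six factorials in a term of Racah's sum pair up to three binomial coefficients; the range of summation
is where these are all nonzero.\<close>

lemma racah_sum:
  fixes N l i j :: nat and m :: int
  assumes "l < N"
  defines "A \<equiv> {t::nat. 0 \<le> int N - 1 - int l + int t - int i \<and> 0 \<le> int t - m \<and> 0 \<le> int l - int t \<and>
      0 \<le> int i - int t \<and> 0 \<le> int l + m - int t}"
  shows "(\<Sum>t\<in>A. (-1) ^ t / (fact t * fact (nat (int N - 1 - int l + int t - int i)) * fact (nat (int t - m))
      * fact (nat (int l - int t)) * fact (nat (int i - int t)) * fact (nat (int l + m - int t))))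
    = hahn (N - 1 - l) l m i / (fact l * fact l * fact (N - 1 - l))"
proof -
  let ?M = "N - 1 - l"
  have "(\<Sum>t\<in>A. (-1) ^ t / (fact t * fact (nat (int N - 1 - int l + int t - int i)) * fact (nat (int t - m))
      * fact (nat (int l - int t)) * fact (nat (int i - int t)) * fact (nat (int l + m - int t))))
    = (\<Sum>t\<in>A. (-1) ^ t * real (l choose t) * binz l (int t - m) * binz ?M (int i - int t)
         / (fact l * fact l * fact ?M))"
  proof (rule sum.cong[OF refl])
    fix t assume "t \<in> A"
    then have t: "0 \<le> int N - 1 - int l + int t - int i" "0 \<le> int t - m" "0 \<le> int l - int t"
      "0 \<le> int i - int t" "0 \<le> int l + m - int t" by (auto simp: A_def)
    have M: "int ?M = int N - 1 - int l" using assms by linarith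
    have 1: "1 / (fact t * fact (nat (int l - int t))) = real (l choose t) / fact l"
      using inverse_factorials[of "int t" l] t by (simp add: binz_def)
    have 2: "1 / (fact (nat (int t - m)) * fact (nat (int l + m - int t))) = binz l (int t - m) / fact l"
      using inverse_factorials[of "int t - m" l] t by (simp add: algebra_simps)
    have 3: "1 / (fact (nat (int i - int t)) * fact (nat (int N - 1 - int l + int t - int i)))
        = binz ?M (int i - int t) / fact ?M"
      using inverse_factorials[of "int i - int t" ?M] t unfolding M by (simp add: algebra_simps)
    have "(-1::real) ^ t / (fact t * fact (nat (int N - 1 - int l + int t - int i)) * fact (nat (int t - m))
      * fact (nat (int l - int t)) * fact (nat (int i - int t)) * fact (nat (int l + m - int t)))
      = (-1::real) ^ t * (1 / (fact t * fact (nat (int l - int t))))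
        * (1 / (fact (nat (int t - m)) * fact (nat (int l + m - int t))))
        * (1 / (fact (nat (int i - int t)) * fact (nat (int N - 1 - int l + int t - int i))))"
      by (simp add: divide_inverse mult_ac)
    also have "\<dots> = (-1) ^ t * real (l choose t) * binz l (int t - m) * binz ?M (int i - int t)
         / (fact l * fact l * fact ?M)"
      unfolding 1 2 3 by simp
    finally show "(-1::real) ^ t / (fact t * fact (nat (int N - 1 - int l + int t - int i)) * fact (nat (int t - m))
      * fact (nat (int l - int t)) * fact (nat (int i - int t)) * fact (nat (int l + m - int t)))
      = (-1) ^ t * real (l choose t) * binz l (int t - m) * binz ?M (int i - int t)
         / (fact l * fact l * fact ?M)" .
  qed
  also have "\<dots> = (\<Sum>t\<le>l. (-1) ^ t * real (l choose t) * binz l (int t - m) * binz ?M (int i - int t)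
         / (fact l * fact l * fact ?M))"
  proof (rule sum.mono_neutral_left)
    show "A \<subseteq> {..l}" by (auto simp: A_def)
    show "\<forall>t\<in>{..l} - A. (-1) ^ t * real (l choose t) * binz l (int t - m) * binz ?M (int i - int t)
         / (fact l * fact l * fact ?M) = 0"
    proof
      fix t assume t: "t \<in> {..l} - A"
      then consider "int N - 1 - int l + int t - int i < 0" | "int t - m < 0" | "int i - int t < 0" | "int l + m - int t < 0"
        by (auto simp: A_def)
      then have "binz l (int t - m) * binz ?M (int i - int t) = 0"
        using assms(1) by cases (auto simp: binz_def)
      then show "(-1) ^ t * real (l choose t) * binz l (int t - m) * binz ?M (int i - int t)
         / (fact l * fact l * fact ?M) = 0" by auto
    qed
  qed simp
  also have "\<dots> = hahn ?M l m i / (fact l * fact l * fact ?M)"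
    unfolding hahn_def by (simp add: sum_divide_distrib)
  finally show ?thesis .
qed

definition T_scale :: "nat \<Rightarrow> nat \<Rightarrow> int \<Rightarrow> real" where
  "T_scale N l m = sqrt (real N / (4 * pi)) * sqrt (2 * real l + 1) * (-1) powi (m + int l)
     * sqrt (fact l * fact (N - 1 - l) * fact l / fact (N + l)) * sqrt (fact (nat (int l - m)) * fact (nat (int l + m)))
     / (fact l * fact l * fact (N - 1 - l))"

definition T_weight :: "nat \<Rightarrow> nat \<Rightarrow> nat \<Rightarrow> real" where
  "T_weight N i j = sqrt (fact i * fact (N - 1 - i) * (fact j * fact (N - 1 - j)))"

lemma wigner3j_entry:
  fixes N l i j :: nat and m :: int
  assumes "l < N" "i < N" "j < N" "\<bar>m\<bar> \<le> int l" "int i - int j = m"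
  defines "s \<equiv> (real N - 1) / 2"
  shows "wigner3j s (real l) s (- (real i - s)) (of_int m) (real j - s)
    = (-1) powi (int N - 1 - int l - int j)
      * sqrt (fact l * fact (N - 1 - l) * fact l / fact (N + l)) * sqrt (fact (nat (int l - m)) * fact (nat (int l + m)))
      * T_weight N i j * (hahn (N - 1 - l) l m (int i) / (fact l * fact l * fact (N - 1 - l)))"
proof -
  have m: "real i = of_int m + real j" using assms(5) by linarith
  have a: "s + real l - s = of_int (int l)" "s - real l + s = of_int (int N - 1 - int l)"
    "- s + real l + s = of_int (int l)" "s + real l + s + 1 = of_int (int N + int l)"
    "s - - (real i - s) = of_int (int i)" "s + - (real i - s) = of_int (int N - 1 - int i)"
    "real l - of_int m = of_int (int l - m)" "real l + of_int m = of_int (int l + m)"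
    "s - (real j - s) = of_int (int N - 1 - int j)" "s + (real j - s) = of_int (int j)"
    "s - real l - (real j - s) = of_int (int N - 1 - int l - int j)"
    by (auto simp: s_def field_simps)
  have b: "s - real l + real t + - (real i - s) = of_int (int N - 1 - int l + int t - int i)"
    "s - s + real t - of_int m = of_int (int t - m)"
    "s + real l - s - real t = of_int (int l - int t)"
    "s - real t - - (real i - s) = of_int (int i - int t)"
    "real l - real t + of_int m = of_int (int l + m - int t)"
    "of_int (int l) - real t = of_int (int l - int t)" for t
    by (auto simp: s_def field_simps)
  have c: "- (real i - s) + of_int m + (real j - s) = 0" "\<bar>- (real i - s)\<bar> \<le> s" "\<bar>of_int m\<bar> \<le> real l"
    "\<bar>real j - s\<bar> \<le> s" "\<bar>s - real l\<bar> \<le> s" "s \<le> s + real l"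
    using assms m by (auto simp: s_def abs_le_iff field_simps)
  have d: "nat (int N - 1 - int l) = N - 1 - l" "nat (int N + int l) = N + l" "nat (int N - 1 - int i) = N - 1 - i"
    "nat (int N - 1 - int j) = N - 1 - j" by auto
  have "wigner3j s (real l) s (- (real i - s)) (of_int m) (real j - s) =
    (-1) powi (int N - 1 - int l - int j)
      * sqrt (fact l * fact (N - 1 - l) * fact l / fact (N + l))
      * sqrt (fact i * fact (N - 1 - i) * fact (nat (int l - m)) * fact (nat (int l + m)) * fact (N - 1 - j) * fact j)
      * (hahn (N - 1 - l) l m (int i) / (fact l * fact l * fact (N - 1 - l)))"
    unfolding wigner3j_def
    apply (subst if_P)
    subgoal using c by blast
    unfolding b a ifact_of_int floor_of_int of_int_0_le_iff
    unfolding racah_sum[OF assms(1)] d nat_int by simp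
  also have "sqrt (fact i * fact (N - 1 - i) * fact (nat (int l - m)) * fact (nat (int l + m)) * fact (N - 1 - j) * fact j)
    = sqrt (fact (nat (int l - m)) * fact (nat (int l + m))) * T_weight N i j"
    unfolding T_weight_def real_sqrt_mult[symmetric] by (simp add: mult_ac)
  finally show ?thesis by (simp add: mult_ac)
qed

text \<open>The signs \<open>(-1)\<^bsup>N-1-i\<^esup>\<close> and \<open>(-1)\<^bsup>N-1-l-j\<^esup>\<close> multiply to \<open>(-1)\<^bsup>m+l\<^esup>\<close>, as \<open>i + j = 2j + m\<close>.
Hence \<open>T_scale\<close> is constant on the diagonal, and \<open>T_weight\<close> is the only other factor besides the Hahn sum.\<close>

lemma T_mat_entry:
  assumes "l < N" "i < N" "j < N" "\<bar>m\<bar> \<le> int l"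
  shows "T_mat N l m $$ (i, j) = (if int i - int j = m
    then of_real (T_scale N l m * (T_weight N i j * hahn (N - 1 - l) l m (int i))) else 0)"
proof -
  define s where "s = (real N - 1) / 2"
  have f: "s - (real i - s) = of_int (int N - 1 - int i)" by (simp add: s_def field_simps)
  have T: "T_mat N l m $$ (i, j) = of_real (sqrt (real N / (4 * pi)) * (-1) powi (int N - 1 - int i) * sqrt (2 * real l + 1)
          * wigner3j s (real l) s (- (real i - s)) (of_int m) (real j - s))"
    using assms unfolding T_mat_def
    by (simp only: index_mat split Let_def s_def[symmetric] f floor_of_int)
  show ?thesis
  proof (cases "int i - int j = m")
    case True
    have "(-1::real) powi (m + int l) = (-1) powi (int N - 1 - int i) * (-1) powi (int N - 1 - int l - int j)"
      using True by (subst power_int_add[symmetric]) (auto simp: power_int_minus_left)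
    then show ?thesis
      unfolding T T_scale_def wigner3j_entry[OF assms True, folded s_def] using True
      by (simp add: mult_ac)
  next
    case False
    then have "real i \<noteq> of_int m + real j" by linarith
    then have "wigner3j s (real l) s (- (real i - s)) (of_int m) (real j - s) = 0"
      unfolding wigner3j_def by auto
    then show ?thesis using False unfolding T by simp
  qed
qed

lemma T_scale_nonzero: "l < N \<Longrightarrow> T_scale N l m \<noteq> 0"
  by (auto simp: T_scale_def power_int_minus_left)

subsection \<open>The Casimir operator\<close>

text \<open>The entry \<open>(i + 1, i)\<close> of the raising operator in the spin \<open>(N - 1)/2\<close> representation.\<close>

definition ladder :: "nat \<Rightarrow> nat \<Rightarrow> real" where
  "ladder N i = sqrt ((real i + 1) * (real N - 1 - real i))"

definition lap_weight :: "nat \<Rightarrow> nat \<Rightarrow> nat \<Rightarrow> real" where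
  "lap_weight N i j = (real N - 1) * (1 + real i + real j) - 2 * real i * real j"

text \<open>\<open>X \<mapsto> - \<Sum>\<^sub>k [J\<^sub>k, [J\<^sub>k, X]]\<close> for the spin \<open>(N - 1)/2\<close> matrices \<open>J\<^sub>k\<close>, written out entrywise.\<close>

definition casimir :: "nat \<Rightarrow> complex mat \<Rightarrow> complex mat" where
  "casimir N X = mat N N (\<lambda>(i, j).
     (if Suc i < N \<and> Suc j < N then of_real (ladder N i * ladder N j) * X $$ (Suc i, Suc j) else 0)
     - of_real (lap_weight N i j) * X $$ (i, j)
     + (if 0 < i \<and> 0 < j then of_real (ladder N (i - 1) * ladder N (j - 1)) * X $$ (i - 1, j - 1) else 0))"

lemma casimir_carrier [simp]: "casimir N X \<in> carrier_mat N N"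
  by (simp add: casimir_def)

lemma casimir_linear: "is_linear_on_mats N (casimir N)"
proof -
  have "casimir N (X + Y) = casimir N X + casimir N Y"
    if "X \<in> carrier_mat N N" "Y \<in> carrier_mat N N" for X Y
    using that by (intro eq_matI) (auto simp: casimir_def algebra_simps)
  moreover have "casimir N (c \<cdot>\<^sub>m X) = c \<cdot>\<^sub>m casimir N X" if "X \<in> carrier_mat N N" for c X
    using that by (intro eq_matI) (auto simp: casimir_def algebra_simps)
  ultimately show ?thesis unfolding is_linear_on_mats_def by simp
qed

text \<open>Linear combinations are written entrywise because matrices of unspecified size have no zero to sum from.\<close>

lemma linear_on_mats_sum:
  assumes L: "is_linear_on_mats N L" and "finite K" and B: "\<And>k. k \<in> K \<Longrightarrow> B k \<in> carrier_mat N N"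
  shows "L (mat N N (\<lambda>pq. \<Sum>k\<in>K. c k * B k $$ pq)) = mat N N (\<lambda>pq. \<Sum>k\<in>K. c k * L (B k) $$ pq)"
  using assms(2,3)
proof (induction K rule: finite_induct)
  case empty
  have "L (0 \<cdot>\<^sub>m 0\<^sub>m N N) = 0 \<cdot>\<^sub>m L (0\<^sub>m N N)"
    using L zero_carrier_mat[of N N] unfolding is_linear_on_mats_def by blast
  moreover have L0: "L (0\<^sub>m N N) \<in> carrier_mat N N"
    using L zero_carrier_mat[of N N] unfolding is_linear_on_mats_def by blast
  moreover have "0 \<cdot>\<^sub>m 0\<^sub>m N N = mat N N (\<lambda>pq. 0 :: complex)" "0 \<cdot>\<^sub>m L (0\<^sub>m N N) = mat N N (\<lambda>pq. 0)"
    using carrier_matD[OF L0] by (auto intro!: eq_matI)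
  ultimately show ?case by simp
next
  case (insert k K)
  let ?S = "mat N N (\<lambda>pq. \<Sum>k\<in>K. c k * B k $$ pq)"
  have Bk: "B k \<in> carrier_mat N N" "L (B k) \<in> carrier_mat N N"
    using insert.prems L unfolding is_linear_on_mats_def by auto
  have "mat N N (\<lambda>pq. \<Sum>k\<in>insert k K. c k * B k $$ pq) = c k \<cdot>\<^sub>m B k + ?S"
    using insert.hyps Bk by (intro eq_matI) auto
  then have "L (mat N N (\<lambda>pq. \<Sum>k\<in>insert k K. c k * B k $$ pq)) = c k \<cdot>\<^sub>m L (B k) + L ?S"
    using L Bk unfolding is_linear_on_mats_def by simp
  also have "L ?S = mat N N (\<lambda>pq. \<Sum>k\<in>K. c k * L (B k) $$ pq)"
    using insert by simp
  also have "c k \<cdot>\<^sub>m L (B k) + \<dots> = mat N N (\<lambda>pq. \<Sum>k\<in>insert k K. c k * L (B k) $$ pq)"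
    using insert.hyps Bk by (intro eq_matI) auto
  finally show ?case .
qed

lemma hahn_outside:
  assumes "i < 0 \<or> i < m \<or> int M + int l < i \<or> int M + int l < i - m"
  shows "hahn M l m i = 0"
  unfolding hahn_def
proof (rule sum.neutral, rule ballI)
  fix t assume t: "t \<in> {..l}"
  have "binz l (int t - m) = 0 \<or> binz M (i - int t) = 0"
  proof (rule ccontr)
    assume "\<not> ?thesis"
    then have "0 \<le> int t - m" "int t - m \<le> int l" "0 \<le> i - int t" "i - int t \<le> int M"
      by (auto simp: binz_def not_less split: if_splits)
    then show False using assms t by auto
  qed
  then show "(- 1) ^ t * real (l choose t) * binz l (int t - m) * binz M (i - int t) = 0" by auto
qed

text \<open>The ladder entries shift the factorial weight, which turns the square roots in \<open>casimir\<close> into the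
polynomial coefficients of \<open>hahn_recurrence\<close>.\<close>

lemma T_weight_Suc:
  assumes "Suc i < N" "Suc j < N"
  shows "ladder N i * ladder N j * T_weight N (Suc i) (Suc j) = (real i + 1) * (real j + 1) * T_weight N i j"
    and "ladder N i * ladder N j * T_weight N i j = (real N - 1 - real i) * (real N - 1 - real j) * T_weight N (Suc i) (Suc j)"
proof -
  have f: "fact (N - 1 - k) = (real N - 1 - real k) * fact (N - 1 - Suc k)" if "Suc k < N" for k
  proof -
    have "N - 1 - k = Suc (N - 1 - Suc k)" using that by simp
    then show ?thesis using that by (simp add: of_nat_diff)
  qed
  have p: "0 \<le> real N - 1 - real i" "0 \<le> real N - 1 - real j" using assms by auto
  define x y where "x = real N - 1 - real i" "y = real N - 1 - real j"
  define a b where "a = (fact (N - 1 - Suc i) :: real)" "b = (fact (N - 1 - Suc j) :: real)"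
  have xy: "0 \<le> x" "0 \<le> y" using p by (auto simp: x_y_def)
  have W: "T_weight N i j = sqrt (fact i * (x * a) * (fact j * (y * b)))"
    unfolding T_weight_def f[OF assms(1)] f[OF assms(2)] x_y_def a_b_def ..
  have W': "T_weight N (Suc i) (Suc j) = sqrt ((real i + 1) * fact i * a * ((real j + 1) * fact j * b))"
    unfolding T_weight_def a_b_def by (simp add: add.commute mult.commute)
  have "ladder N i * ladder N j * T_weight N (Suc i) (Suc j)
     = sqrt (((real i + 1) * (real j + 1))\<^sup>2 * (fact i * (x * a) * (fact j * (y * b))))"
    unfolding W' ladder_def x_y_def[symmetric] real_sqrt_mult[symmetric]
    by (simp add: power2_eq_square algebra_simps)
  also have "\<dots> = (real i + 1) * (real j + 1) * T_weight N i j"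
    unfolding W by (subst real_sqrt_mult) simp
  finally show "ladder N i * ladder N j * T_weight N (Suc i) (Suc j) = (real i + 1) * (real j + 1) * T_weight N i j" .
  have "ladder N i * ladder N j * T_weight N i j
     = sqrt ((x * y)\<^sup>2 * ((real i + 1) * fact i * a * ((real j + 1) * fact j * b)))"
    unfolding W ladder_def x_y_def[symmetric] real_sqrt_mult[symmetric]
    by (simp add: power2_eq_square algebra_simps)
  also have "\<dots> = x * y * T_weight N (Suc i) (Suc j)"
    unfolding W' using xy by (subst real_sqrt_mult) simp
  finally show "ladder N i * ladder N j * T_weight N i j = (real N - 1 - real i) * (real N - 1 - real j) * T_weight N (Suc i) (Suc j)"
    unfolding x_y_def .
qed

lemma T_mat_carrier [simp]: "T_mat N l m \<in> carrier_mat N N"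
  by (simp add: T_mat_def Let_def)

lemma casimir_T_mat:
  assumes "l < N" "\<bar>m\<bar> \<le> int l"
  shows "casimir N (T_mat N l m) = (- (of_nat l * (of_nat l + 1))) \<cdot>\<^sub>m T_mat N l m"
proof (rule eq_matI)
  fix i j assume "i < dim_row ((- (of_nat l * (of_nat l + 1))) \<cdot>\<^sub>m T_mat N l m)"
    "j < dim_col ((- (of_nat l * (of_nat l + 1))) \<cdot>\<^sub>m T_mat N l m)"
  then have ij: "i < N" "j < N" by (simp_all add: carrier_matD[OF T_mat_carrier])
  let ?M = "N - 1 - l"
  note T = T_mat_entry[OF assms(1) _ _ assms(2)]
  show "casimir N (T_mat N l m) $$ (i, j) = ((- (of_nat l * (of_nat l + 1))) \<cdot>\<^sub>m T_mat N l m) $$ (i, j)"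
  proof (cases "int i - int j = m")
    case False
    then show ?thesis using ij by (auto simp: casimir_def T carrier_matD[OF T_mat_carrier])
  next
    case m: True
    have m': "real_of_int m = real i - real j" using m by linarith
    define u where "u k = hahn ?M l m k" for k
    have up: "(if Suc i < N \<and> Suc j < N then ladder N i * ladder N j * (T_weight N (Suc i) (Suc j) * u (int (Suc i))) else 0)
       = (real i + 1) * (real j + 1) * (T_weight N i j * u (int i + 1))"
    proof (cases "Suc i < N \<and> Suc j < N")
      case True
      then have "ladder N i * ladder N j * (T_weight N (Suc i) (Suc j) * u (int (Suc i)))
        = ladder N i * ladder N j * T_weight N (Suc i) (Suc j) * u (int i + 1)" by (simp add: add.commute)
      then show ?thesis using True T_weight_Suc(1)[of i N j] by simp
    next
      case False
      then have "u (int i + 1) = 0" unfolding u_def using ij assms m by (intro hahn_outside) auto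
      then show ?thesis using False by auto
    qed
    have down: "(if 0 < i \<and> 0 < j then ladder N (i - 1) * ladder N (j - 1) * (T_weight N (i - 1) (j - 1) * u (int (i - 1))) else 0)
       = (real N - real i) * (real N - real j) * (T_weight N i j * u (int i - 1))"
    proof (cases "0 < i \<and> 0 < j")
      case True
      then obtain i' j' where s: "i = Suc i'" "j = Suc j'" by (metis gr0_conv_Suc)
      have "ladder N i' * ladder N j' * (T_weight N i' j' * u (int i'))
        = ladder N i' * ladder N j' * T_weight N i' j' * u (int i')" by simp
      also have "\<dots> = (real N - real i) * (real N - real j) * (T_weight N i j * u (int i - 1))"
        using ij T_weight_Suc(2)[of i' N j'] unfolding s by (simp add: diff_diff_eq)
      finally show ?thesis using True by (simp add: s)
    next
      case False
      then have "u (int i - 1) = 0" unfolding u_def using ij assms m by (intro hahn_outside) auto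
      then show ?thesis using False by auto
    qed
    have rec: "(real i + 1) * (real j + 1) * u (int i + 1) + (real N - real i) * (real N - real j) * u (int i - 1)
       = (lap_weight N i j - real l * (real l + 1)) * u (int i)"
    proof -
      have n: "real ?M + real l + 1 = real N" using assms by (simp add: of_nat_diff)
      have "(real i + 1) * (real j + 1) * u (int i + 1) + (real N - real i) * (real N - real j) * u (int i - 1)
       = (((real N)\<^sup>2 - 1) / 2 - (2 * real i - real N + 1) * (2 * real j - real N + 1) / 2 - real l * (real l + 1)) * u (int i)"
        using hahn_recurrence[of "int i" m ?M l] unfolding n m' u_def by (simp add: add.commute)
      also have "((real N)\<^sup>2 - 1) / 2 - (2 * real i - real N + 1) * (2 * real j - real N + 1) / 2 = lap_weight N i j"
        unfolding lap_weight_def by (simp add: field_simps power2_eq_square)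
      finally show ?thesis .
    qed
    have T': "T_mat N l m $$ (a, b) = of_real (T_scale N l m * (T_weight N a b * u (int a)))"
      if "a < N" "b < N" "int a - int b = m" for a b
      using that by (simp add: T u_def)
    have "casimir N (T_mat N l m) $$ (i, j) = of_real (T_scale N l m *
       ((if Suc i < N \<and> Suc j < N then ladder N i * ladder N j * (T_weight N (Suc i) (Suc j) * u (int (Suc i))) else 0)
       - lap_weight N i j * (T_weight N i j * u (int i))
       + (if 0 < i \<and> 0 < j then ladder N (i - 1) * ladder N (j - 1) * (T_weight N (i - 1) (j - 1) * u (int (i - 1))) else 0)))"
      using ij m by (auto simp: casimir_def T' of_nat_diff algebra_simps)
    also have "\<dots> = of_real (T_scale N l m * (T_weight N i j * ((real i + 1) * (real j + 1) * u (int i + 1)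
        + (real N - real i) * (real N - real j) * u (int i - 1) - lap_weight N i j * u (int i))))"
      unfolding up down by (simp add: algebra_simps)
    also have "\<dots> = - (of_nat l * (of_nat l + 1)) * of_real (T_scale N l m * (T_weight N i j * u (int i)))"
      unfolding rec by (simp add: algebra_simps)
    finally show ?thesis using ij m by (simp add: T' carrier_matD[OF T_mat_carrier])
  qed
qed (simp_all add: carrier_matD[OF T_mat_carrier] casimir_def)

subsection \<open>The T matrices span\<close>

text \<open>Applying the Casimir operator repeatedly to a vanishing combination multiplies the coefficient of \<open>T\<^sub>l\<^sub>m\<close> by
the values of an arbitrary polynomial at its eigenvalue.  A polynomial that vanishes at all eigenvalues but
one isolates a single coefficient.\<close>

lemma T_mat_independent:
  assumes zero: "\<And>i j. i < N \<Longrightarrow> j < N \<Longrightarrow> (\<Sum>l\<in>{nat \<bar>m\<bar>..<N}. v l * T_mat N l m $$ (i, j)) = 0"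
    and l0: "nat \<bar>m\<bar> \<le> l0" "l0 < N"
  shows "v l0 = 0"
proof -
  let ?I = "{nat \<bar>m\<bar>..<N}"
  define ev where "ev l = - (of_nat l * (of_nat l + 1) :: complex)" for l
  have "\<forall>i<N. \<forall>j<N. (\<Sum>l\<in>?I. v l * poly p (ev l) * T_mat N l m $$ (i, j)) = 0" for p
  proof (induction p)
    case (pCons a p)
    let ?A = "mat N N (\<lambda>pq. \<Sum>l\<in>?I. (v l * poly p (ev l)) * T_mat N l m $$ pq)"
    have "?A = 0\<^sub>m N N" using pCons.IH by (intro eq_matI) auto
    then have "casimir N ?A = casimir N (0\<^sub>m N N)" by simp
    also have "\<dots> = 0\<^sub>m N N" by (intro eq_matI) (auto simp: casimir_def)
    finally have z: "mat N N (\<lambda>pq. \<Sum>l\<in>?I. (v l * poly p (ev l)) * casimir N (T_mat N l m) $$ pq) = 0\<^sub>m N N"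
      by (subst (asm) linear_on_mats_sum[OF casimir_linear]) auto
    then have c: "(\<Sum>l\<in>?I. (v l * poly p (ev l)) * casimir N (T_mat N l m) $$ (i, j)) = 0" if "i < N" "j < N" for i j
    proof -
      have "mat N N (\<lambda>pq. \<Sum>l\<in>?I. (v l * poly p (ev l)) * casimir N (T_mat N l m) $$ pq) $$ (i, j)
        = (0\<^sub>m N N :: complex mat) $$ (i, j)" by (simp only: z)
      then show ?thesis using that by (simp only: index_mat index_zero_mat)
    qed
    show ?case
    proof (intro allI impI)
      fix i j assume ij: "i < N" "j < N"
      have "(\<Sum>l\<in>?I. v l * poly (pCons a p) (ev l) * T_mat N l m $$ (i, j))
        = (\<Sum>l\<in>?I. a * (v l * T_mat N l m $$ (i, j)) + (v l * poly p (ev l)) * casimir N (T_mat N l m) $$ (i, j))"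
        using ij by (intro sum.cong refl, subst casimir_T_mat)
          (auto simp: ev_def carrier_matD[OF T_mat_carrier] algebra_simps)
      also have "\<dots> = 0" using ij by (simp add: sum.distrib zero c flip: sum_distrib_left)
      finally show "(\<Sum>l\<in>?I. v l * poly (pCons a p) (ev l) * T_mat N l m $$ (i, j)) = 0" .
    qed
  qed simp
  then have filt: "(\<Sum>l\<in>?I. v l * poly p (ev l) * T_mat N l m $$ (i, j)) = 0" if "i < N" "j < N" for p i j
    using that by blast
  have ev_inj: "ev l \<noteq> ev l0" if "l \<noteq> l0" for l
  proof
    assume "ev l = ev l0"
    then have "of_nat (l * (l + 1)) = (of_nat (l0 * (l0 + 1)) :: complex)" by (simp add: ev_def algebra_simps)
    then have eq_prod: "l * (l + 1) = l0 * (l0 + 1)" using of_nat_eq_iff by blast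
    have "x * (x + 1) < y * (y + 1)" if "x < y" for x y :: nat
      using that by (intro mult_strict_mono) auto
    from this[of l l0] this[of l0 l] eq_prod show False using that by (cases "l < l0") auto
  qed
  \<comment> \<open>the polynomial that isolates the coefficient of \<open>T\<^sub>l\<^sub>0\<^sub>m\<close>\<close>
  define p where "p = (\<Prod>l\<in>?I - {l0}. [:- ev l, 1:])"
  have p: "poly p (ev l) = 0" if "l \<in> ?I - {l0}" for l
    unfolding p_def poly_prod using that by (intro prod_zero) auto
  have p0: "poly p (ev l0) \<noteq> 0"
  proof -
    have "ev l0 = ev l \<Longrightarrow> l = l0" for l using ev_inj[of l] by auto
    then show ?thesis unfolding p_def poly_prod by (subst prod_zero_iff) auto
  qed
  have m: "\<bar>m\<bar> \<le> int l0" using l0 by auto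
  \<comment> \<open>the first entry on the diagonal, where \<open>hahn_nonzero\<close> applies\<close>
  define i j where "i = nat m" "j = nat (- m)"
  have ij: "i < N" "j < N" "int i - int j = m" "int i = max 0 m" using m l0 by (auto simp: i_j_def)
  have "T_mat N l0 m $$ (i, j) \<noteq> 0"
    using hahn_nonzero[OF m, of "N - 1 - l0"] T_scale_nonzero[OF l0(2), of m] ij
    by (simp add: T_mat_entry[OF l0(2) ij(1,2) m] T_weight_def)
  moreover have "v l0 * poly p (ev l0) * T_mat N l0 m $$ (i, j) = 0"
  proof -
    have "(\<Sum>l\<in>?I - {l0}. v l * poly p (ev l) * T_mat N l m $$ (i, j)) = 0"
      by (rule sum.neutral, rule ballI) (simp only: p mult_zero_left mult_zero_right)
    then show ?thesis using filt[OF ij(1,2), of p] l0 by (simp add: sum.remove[of ?I l0])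
  qed
  ultimately show ?thesis using p0 by simp
qed

definition unit_mat_at :: "nat \<Rightarrow> nat \<times> nat \<Rightarrow> complex mat" where
  "unit_mat_at N ab = mat N N (\<lambda>pq. if pq = ab then 1 else 0)"

text \<open>On the diagonal through \<open>(i0, j0)\<close> there are as many matrices \<open>T\<^sub>l\<^sub>m\<close> as entries, namely \<open>N - \<bar>m\<bar>\<close>.  The
square matrix of these entries is injective by \<open>T_mat_independent\<close>, hence invertible, and a column of its
inverse contains the required coefficients.\<close>

lemma unit_mat_span:
  assumes "i0 < N" "j0 < N"
  defines "m \<equiv> int i0 - int j0"
  obtains w where "unit_mat_at N (i0, j0) = mat N N (\<lambda>pq. \<Sum>l\<in>{nat \<bar>m\<bar>..<N}. w l * T_mat N l m $$ pq)"
proof -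
  \<comment> \<open>position \<open>a\<close> on the diagonal is the entry \<open>(a + pos, a + neg)\<close>\<close>
  define k pos neg where "k = nat \<bar>m\<bar>" "pos = nat m" "neg = nat (- m)"
  define n where "n = N - k"
  have pn: "int pos - int neg = m" "pos + neg = k" by (auto simp: k_pos_neg_def)
  have kN: "k < N" using assms by (auto simp: k_pos_neg_def)
  have pos_less: "a + pos < N" "a + neg < N" if "a < n" for a using that pn by (auto simp: n_def)
  define P where "P = mat n n (\<lambda>(a, c). T_mat N (k + c) m $$ (a + pos, a + neg))"
  have P: "P \<in> carrier_mat n n" by (simp add: P_def)
  have shift: "(\<Sum>l\<in>{k..<N}. f l) = (\<Sum>c<n. f (k + c))" for f :: "nat \<Rightarrow> complex"
    by (rule sum.reindex_bij_witness[of _ "\<lambda>c. k + c" "\<lambda>l. l - k"]) (auto simp: n_def)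
  have on_diag: "i = j0' + pos \<and> j = j0' + neg \<and> j0' < n" if "i < N" "j < N" "int i - int j = m" "j0' = i - pos" for i j j0'
    using that by (auto simp: k_pos_neg_def n_def)
  have off_diag: "T_mat N l m $$ (i, j) = 0" if "i < N" "j < N" "int i - int j \<noteq> m" "k \<le> l" "l < N" for i j l
    using that by (subst T_mat_entry) (auto simp: k_pos_neg_def)
  have "det P \<noteq> 0"
  proof
    assume "det P = 0"
    then obtain v where v: "v \<in> carrier_vec n" "v \<noteq> 0\<^sub>v n" "P *\<^sub>v v = 0\<^sub>v n"
      using det_0_iff_vec_prod_zero[OF P] by auto
    define v' where "v' l = v $ (l - k)" for l
    have z: "(\<Sum>l\<in>{k..<N}. v' l * T_mat N l m $$ (i, j)) = 0" if ij: "i < N" "j < N" for i j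
    proof (cases "int i - int j = m")
      case True
      define a where "a = i - pos"
      have a: "i = a + pos" "j = a + neg" "a < n" using on_diag[OF ij True a_def] by auto
      have "0 = (P *\<^sub>v v) $ a" unfolding v(3) using a by simp
      also have "\<dots> = (\<Sum>c<n. P $$ (a, c) * v $ c)"
        using a P v(1) by (simp add: scalar_prod_def atLeast0LessThan)
      also have "\<dots> = (\<Sum>l\<in>{k..<N}. v' l * T_mat N l m $$ (i, j))"
        unfolding shift v'_def using a by (intro sum.cong) (auto simp: P_def mult.commute)
      finally show ?thesis by simp
    next
      case False
      then show ?thesis using ij off_diag by (intro sum.neutral) auto
    qed
    have v'0: "v' l = 0" if "k \<le> l" "l < N" for l
      by (rule T_mat_independent[OF z[unfolded k_pos_neg_def(1)] that[unfolded k_pos_neg_def(1)]])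
    then have "v $ c = 0" if "c < n" for c
      using v'0[of "k + c"] that unfolding v'_def n_def by simp
    then have "v = 0\<^sub>v n" using v(1) by (intro eq_vecI) auto
    with v(2) show False by simp
  qed
  from det_non_zero_imp_unit[OF P this, of "()"] obtain Q where Q: "Q \<in> carrier_mat n n" "P * Q = 1\<^sub>m n"
    unfolding Units_def by (auto simp: ring_mat_def)
  define a0 where "a0 = i0 - pos"
  have a0: "i0 = a0 + pos" "j0 = a0 + neg" "a0 < n"
    using on_diag[OF assms(1,2) _ a0_def] by (auto simp: m_def)
  define w where "w l = Q $$ (l - k, a0)" for l
  have "unit_mat_at N (i0, j0) = mat N N (\<lambda>pq. \<Sum>l\<in>{k..<N}. w l * T_mat N l m $$ pq)"
  proof (rule eq_matI)
    fix i j assume "i < dim_row (mat N N (\<lambda>pq. \<Sum>l\<in>{k..<N}. w l * T_mat N l m $$ pq))"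
      "j < dim_col (mat N N (\<lambda>pq. \<Sum>l\<in>{k..<N}. w l * T_mat N l m $$ pq))"
    then have ij: "i < N" "j < N" by auto
    have "(\<Sum>l\<in>{k..<N}. w l * T_mat N l m $$ (i, j)) = (if (i, j) = (i0, j0) then 1 else 0)"
    proof (cases "int i - int j = m")
      case True
      define a where "a = i - pos"
      have a: "i = a + pos" "j = a + neg" "a < n" using on_diag[OF ij True a_def] by auto
      have "(\<Sum>l\<in>{k..<N}. w l * T_mat N l m $$ (i, j)) = (\<Sum>c<n. P $$ (a, c) * Q $$ (c, a0))"
        unfolding shift w_def using a by (intro sum.cong) (auto simp: P_def mult.commute)
      also have "\<dots> = (P * Q) $$ (a, a0)"
        using a a0 P Q(1) by (simp add: scalar_prod_def atLeast0LessThan)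
      also have "\<dots> = (if (i, j) = (i0, j0) then 1 else 0)"
        unfolding Q(2) using a a0 by auto
      finally show ?thesis .
    next
      case False
      then have "(i, j) \<noteq> (i0, j0)" by (auto simp: m_def)
      then show ?thesis using False ij off_diag by (auto intro!: sum.neutral)
    qed
    then show "unit_mat_at N (i0, j0) $$ (i, j) = mat N N (\<lambda>pq. \<Sum>l\<in>{k..<N}. w l * T_mat N l m $$ pq) $$ (i, j)"
      using ij by (simp add: unit_mat_at_def)
  qed (auto simp: unit_mat_at_def)
  then show ?thesis using that unfolding k_pos_neg_def by blast
qed

text \<open>The Casimir operator satisfies the condition by which the Laplacian is chosen.  Any other choice agrees with
it on the matrices \<open>T\<^sub>l\<^sub>m\<close>, which span.\<close>

theorem discrete_laplacian_eq_casimir: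
  assumes "X \<in> carrier_mat N N"
  shows "discrete_laplacian N X = casimir N X"
proof -
  have "is_linear_on_mats N (discrete_laplacian N) \<and> (\<forall>l<N. \<forall>m. \<bar>m\<bar> \<le> int l \<longrightarrow>
      discrete_laplacian N (T_mat N l m) = (- (of_nat l * (of_nat l + 1))) \<cdot>\<^sub>m T_mat N l m)"
    unfolding discrete_laplacian_def
    by (rule someI[of _ "casimir N"]) (use casimir_linear casimir_T_mat in blast)
  then have L: "is_linear_on_mats N (discrete_laplacian N)"
    and eig: "\<And>l m. l < N \<Longrightarrow> \<bar>m\<bar> \<le> int l \<Longrightarrow> discrete_laplacian N (T_mat N l m) = casimir N (T_mat N l m)"
    by (simp_all add: casimir_T_mat)
  have unit: "discrete_laplacian N (unit_mat_at N ab) = casimir N (unit_mat_at N ab)"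
    if ab_less: "ab \<in> {..<N} \<times> {..<N}" for ab
  proof -
    obtain i j where ab: "ab = (i, j)" "i < N" "j < N" using ab_less by auto
    obtain w where w: "unit_mat_at N ab = mat N N (\<lambda>pq. \<Sum>l\<in>{nat \<bar>int i - int j\<bar>..<N}. w l * T_mat N l (int i - int j) $$ pq)"
      using unit_mat_span[OF ab(2,3)] unfolding ab(1) by blast
    let ?T = "\<lambda>l. T_mat N l (int i - int j)" and ?I = "{nat \<bar>int i - int j\<bar>..<N}"
    have "discrete_laplacian N (unit_mat_at N ab) = mat N N (\<lambda>pq. \<Sum>l\<in>?I. w l * discrete_laplacian N (?T l) $$ pq)"
      unfolding w by (rule linear_on_mats_sum[OF L]) simp_all
    also have "\<dots> = mat N N (\<lambda>pq. \<Sum>l\<in>?I. w l * casimir N (?T l) $$ pq)"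
      by (rule cong_mat) (auto intro!: sum.cong simp: eig)
    also have "\<dots> = casimir N (unit_mat_at N ab)"
      unfolding w by (rule linear_on_mats_sum[OF casimir_linear, symmetric]) simp_all
    finally show ?thesis .
  qed
  have X: "X = mat N N (\<lambda>pq. \<Sum>ab\<in>{..<N} \<times> {..<N}. X $$ ab * unit_mat_at N ab $$ pq)"
  proof (rule eq_matI)
    fix i j assume ij: "i < dim_row (mat N N (\<lambda>pq. \<Sum>ab\<in>{..<N} \<times> {..<N}. X $$ ab * unit_mat_at N ab $$ pq))"
      "j < dim_col (mat N N (\<lambda>pq. \<Sum>ab\<in>{..<N} \<times> {..<N}. X $$ ab * unit_mat_at N ab $$ pq))"
    then have "(\<Sum>ab\<in>{..<N} \<times> {..<N}. X $$ ab * unit_mat_at N ab $$ (i, j))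
      = (\<Sum>ab\<in>{..<N} \<times> {..<N}. if ab = (i, j) then X $$ ab else 0)"
      by (intro sum.cong) (auto simp: unit_mat_at_def)
    also have "\<dots> = X $$ (i, j)" using ij by (subst sum.delta) auto
    finally show "X $$ (i, j) = mat N N (\<lambda>pq. \<Sum>ab\<in>{..<N} \<times> {..<N}. X $$ ab * unit_mat_at N ab $$ pq) $$ (i, j)"
      using ij by simp
  qed (use assms in auto)
  have c: "unit_mat_at N ab \<in> carrier_mat N N" for ab by (simp add: unit_mat_at_def)
  let ?K = "{..<N} \<times> {..<N}"
  have "discrete_laplacian N X = discrete_laplacian N (mat N N (\<lambda>pq. \<Sum>ab\<in>?K. X $$ ab * unit_mat_at N ab $$ pq))"
    by (rule arg_cong[OF X])
  also have "\<dots> = mat N N (\<lambda>pq. \<Sum>ab\<in>?K. X $$ ab * discrete_laplacian N (unit_mat_at N ab) $$ pq)"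
    by (rule linear_on_mats_sum[OF L]) (simp_all add: c)
  also have "\<dots> = mat N N (\<lambda>pq. \<Sum>ab\<in>?K. X $$ ab * casimir N (unit_mat_at N ab) $$ pq)"
    by (rule cong_mat) (auto intro!: sum.cong simp: unit)
  also have "\<dots> = casimir N (mat N N (\<lambda>pq. \<Sum>ab\<in>?K. X $$ ab * unit_mat_at N ab $$ pq))"
    by (rule linear_on_mats_sum[OF casimir_linear, symmetric]) (simp_all add: c)
  also have "\<dots> = casimir N X"
    by (rule arg_cong[OF X[symmetric]])
  finally show ?thesis .
qed

lemma laplacian_diag_entries:
  assumes "i + m < N"
  shows "laplacian_diag N m i i = - of_real (lap_weight N (i + m) i)"
    and "Suc (i + m) < N \<Longrightarrow> laplacian_diag N m i (Suc i) = of_real (ladder N (i + m) * ladder N i)"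
  using assms unfolding laplacian_diag_def
  by (subst discrete_laplacian_eq_casimir; auto simp: casimir_def)+

subsection \<open>Tridiagonal systems\<close>

fun tri_pivot :: "(nat \<Rightarrow> 'a::field) \<Rightarrow> (nat \<Rightarrow> 'a) \<Rightarrow> nat \<Rightarrow> 'a" where
  "tri_pivot d e 0 = d 0"
| "tri_pivot d e (Suc q) = d (Suc q) - e q * e q / tri_pivot d e q"

fun tri_forward :: "(nat \<Rightarrow> 'a::field) \<Rightarrow> (nat \<Rightarrow> 'a) \<Rightarrow> (nat \<Rightarrow> 'a) \<Rightarrow> nat \<Rightarrow> 'a" where
  "tri_forward d e x 0 = x 0 / tri_pivot d e 0"
| "tri_forward d e x (Suc q) = (x (Suc q) - e q * tri_forward d e x q) / tri_pivot d e (Suc q)"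

fun tri_back :: "(nat \<Rightarrow> 'a::field) \<Rightarrow> (nat \<Rightarrow> 'a) \<Rightarrow> (nat \<Rightarrow> 'a) \<Rightarrow> nat \<Rightarrow> nat \<Rightarrow> 'a" where
  "tri_back d e x n 0 = tri_forward d e x (n - 1)"
| "tri_back d e x n (Suc k) =
     tri_forward d e x (n - 2 - k) - e (n - 2 - k) / tri_pivot d e (n - 2 - k) * tri_back d e x n k"

text \<open>Gaussian elimination without row exchanges for a symmetric tridiagonal matrix with diagonal \<open>d\<close> and
off-diagonal \<open>e\<close>.  The argument of \<open>tri_back\<close> counts from the last row.\<close>

definition tri_solve :: "(nat \<Rightarrow> 'a::field) \<Rightarrow> (nat \<Rightarrow> 'a) \<Rightarrow> (nat \<Rightarrow> 'a) \<Rightarrow> nat \<Rightarrow> nat \<Rightarrow> 'a" where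
  "tri_solve d e x n q = tri_back d e x n (n - 1 - q)"

definition tri_apply :: "(nat \<Rightarrow> 'a::field) \<Rightarrow> (nat \<Rightarrow> 'a) \<Rightarrow> nat \<Rightarrow> (nat \<Rightarrow> 'a) \<Rightarrow> nat \<Rightarrow> 'a" where
  "tri_apply d e n y q = (if Suc q < n then e q * y (Suc q) else 0) + d q * y q
     + (if 0 < q then e (q - 1) * y (q - 1) else 0)"

lemma tri_solve_last: "Suc q = n \<Longrightarrow> tri_solve d e x n q = tri_forward d e x q"
  by (auto simp: tri_solve_def)

lemma tri_solve_step:
  assumes "Suc q < n"
  shows "tri_solve d e x n q = tri_forward d e x q - e q / tri_pivot d e q * tri_solve d e x n (Suc q)"
proof -
  have "n - 1 - q = Suc (n - 1 - Suc q)" "n - 2 - (n - 1 - Suc q) = q" using assms by auto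
  then show ?thesis unfolding tri_solve_def by (simp only: tri_back.simps)
qed

lemma tri_forward_eq:
  assumes "tri_pivot d e q \<noteq> 0"
  shows "tri_pivot d e q * tri_forward d e x q = x q - (if 0 < q then e (q - 1) * tri_forward d e x (q - 1) else 0)"
  using assms by (cases q) auto

lemma tri_pivot_eq: "tri_pivot d e q = d q - (if 0 < q then e (q - 1) * e (q - 1) / tri_pivot d e (q - 1) else 0)"
  by (cases q) auto

lemma tri_apply_solve:
  assumes piv: "\<And>q. q < n \<Longrightarrow> tri_pivot d e q \<noteq> 0" and q: "q < n"
  shows "tri_apply d e n (tri_solve d e x n) q = x q"
proof -
  let ?y = "tri_solve d e x n" and ?g = "tri_forward d e x" and ?p = "tri_pivot d e"
  have up: "(if Suc q < n then e q * ?y (Suc q) else 0) = ?p q * (?g q - ?y q)"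
  proof (cases "Suc q < n")
    case True
    then show ?thesis using tri_solve_step[OF True, of d e x] piv[OF q] by simp
  next
    case False
    then show ?thesis using tri_solve_last[of q n d e x] q by simp
  qed
  have down: "(if 0 < q then e (q - 1) * ?y (q - 1) else 0)
      = (if 0 < q then e (q - 1) * ?g (q - 1) else 0) - (if 0 < q then e (q - 1) * e (q - 1) / ?p (q - 1) else 0) * ?y q"
  proof (cases q)
    case (Suc k)
    then show ?thesis using tri_solve_step[of k n d e x] q by (simp add: right_diff_distrib)
  qed simp
  have "tri_apply d e n ?y q = ?p q * ?g q - ?p q * ?y q
      + (d q - (if 0 < q then e (q - 1) * e (q - 1) / ?p (q - 1) else 0)) * ?y q
      + (if 0 < q then e (q - 1) * ?g (q - 1) else 0)"
    unfolding tri_apply_def up down by (simp add: algebra_simps)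
  also have "\<dots> = x q"
    unfolding tri_pivot_eq[of d e q, symmetric] tri_forward_eq[OF piv[OF q]] by simp
  finally show ?thesis .
qed

lemma tri_solve_unique:
  assumes piv: "\<And>q. q < n \<Longrightarrow> tri_pivot d e q \<noteq> 0"
    and row: "\<And>q. q < n \<Longrightarrow> tri_apply d e n y q = x q" and q: "q < n"
  shows "y q = tri_solve d e x n q"
proof -
  let ?g = "tri_forward d e x" and ?p = "tri_pivot d e"
  have fwd: "y q = ?g q - (if Suc q < n then e q / ?p q * y (Suc q) else 0)" if "q < n" for q
    using that
  proof (induction q)
    case 0
    then show ?case using row[of 0] piv[of 0] by (auto simp: tri_apply_def field_simps)
  next
    case (Suc q)
    have p: "?p q \<noteq> 0" "?p (Suc q) \<noteq> 0"
      using piv[of q] piv[OF Suc.prems] Suc.prems by (simp_all del: tri_pivot.simps)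
    have yq: "y q = ?g q - e q / ?p q * y (Suc q)" using Suc by simp
    have "x (Suc q) = (if Suc (Suc q) < n then e (Suc q) * y (Suc (Suc q)) else 0) + d (Suc q) * y (Suc q) + e q * y q"
      using row[OF Suc.prems] by (simp add: tri_apply_def)
    then have "x (Suc q) - e q * ?g q = (if Suc (Suc q) < n then e (Suc q) * y (Suc (Suc q)) else 0) + ?p (Suc q) * y (Suc q)"
      unfolding yq by (simp add: algebra_simps)
    moreover have "?g (Suc q) = (x (Suc q) - e q * ?g q) / ?p (Suc q)" by simp
    ultimately have "?g (Suc q) = ((if Suc (Suc q) < n then e (Suc q) * y (Suc (Suc q)) else 0) + ?p (Suc q) * y (Suc q)) / ?p (Suc q)"
      by (simp only:)
    then show ?case using p(2) by (simp add: add_divide_distrib del: tri_forward.simps tri_pivot.simps)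
  qed
  have "y (n - 1 - k) = tri_solve d e x n (n - 1 - k)" if "k < n" for k
    using that
  proof (induction k)
    case 0
    then show ?case using fwd[of "n - 1"] tri_solve_last[of "n - 1" n d e x] by simp
  next
    case (Suc k)
    have s: "Suc (n - 1 - Suc k) = n - 1 - k" using Suc.prems by simp
    show ?case
      using fwd[of "n - 1 - Suc k"] tri_solve_step[of "n - 1 - Suc k" n d e x] Suc unfolding s by simp
  qed
  from this[of "n - 1 - q"] show ?thesis using q by simp
qed

subsection \<open>Inverting the Laplacian diagonal by diagonal\<close>

abbreviation lap_main :: "nat \<Rightarrow> nat \<Rightarrow> nat \<Rightarrow> complex" where
  "lap_main N m q \<equiv> laplacian_diag N m q q"

abbreviation lap_off :: "nat \<Rightarrow> nat \<Rightarrow> nat \<Rightarrow> complex" where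
  "lap_off N m q \<equiv> laplacian_diag N m q (Suc q)"

lemma lap_weight_commute: "lap_weight N i j = lap_weight N j i"
  by (simp add: lap_weight_def)

lemma casimir_on_diagonal:
  assumes "q + m < N"
  shows "casimir N Y $$ (q + m, q) = tri_apply (lap_main N m) (lap_off N m) (N - m) (\<lambda>q. Y $$ (q + m, q)) q"
    and "casimir N Y $$ (q, q + m) = tri_apply (lap_main N m) (lap_off N m) (N - m) (\<lambda>q. Y $$ (q, q + m)) q"
proof -
  show "casimir N Y $$ (q + m, q) = tri_apply (lap_main N m) (lap_off N m) (N - m) (\<lambda>q. Y $$ (q + m, q)) q"
    using assms by (cases q) (auto simp: casimir_def tri_apply_def laplacian_diag_entries less_diff_conv)
  show "casimir N Y $$ (q, q + m) = tri_apply (lap_main N m) (lap_off N m) (N - m) (\<lambda>q. Y $$ (q, q + m)) q"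
    using assms
    by (cases q) (auto simp: casimir_def tri_apply_def laplacian_diag_entries less_diff_conv
        lap_weight_commute mult_ac)
qed

text \<open>With \<open>b\<^sub>i\<close> for \<open>ladder N i\<close> and \<open>A\<^sub>q = (b\<^sub>q\<^sub>+\<^sub>m\<^sup>2 + b\<^sub>q\<^sup>2)/2\<close>, the diagonal of \<open>- \<Delta>\<^sup>m\<close> is
\<open>m\<^sup>2 + A\<^sub>q + A\<^sub>q\<^sub>-\<^sub>1\<close> and the off-diagonal \<open>b\<^sub>q\<^sub>+\<^sub>m b\<^sub>q\<close> is at most \<open>A\<^sub>q\<close>.  By induction every pivot of
\<open>- \<Delta>\<^sup>m\<close> is at least \<open>m\<^sup>2 + A\<^sub>q\<close>: if the previous one is at least \<open>A\<^sub>q\<^sub>-\<^sub>1\<close>, elimination subtracts at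
most \<open>A\<^sub>q\<^sub>-\<^sub>1\<close>.\<close>

lemma lap_pivot_nonzero:
  assumes m: "1 \<le> m" and q: "q + m < N"
  shows "tri_pivot (lap_main N m) (lap_off N m) q \<noteq> 0"
proof -
  define A where "A i j = ((ladder N i)\<^sup>2 + (ladder N j)\<^sup>2) / 2" for i j
  have sq: "(ladder N i)\<^sup>2 = (real i + 1) * (real N - 1 - real i)" if "i < N" for i
    unfolding ladder_def using that by (intro real_sqrt_pow2) auto
  have A0: "0 \<le> A i j" for i j unfolding A_def by auto
  have m1: "1 \<le> (real m)\<^sup>2" using m by (simp add: one_le_power)
  have "\<exists>p. tri_pivot (lap_main N m) (lap_off N m) q = of_real (- p) \<and> 1 + A (q + m) q \<le> p"
    using q
  proof (induction q)
    case 0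
    have "lap_weight N m 0 = (real m)\<^sup>2 + A m 0 + real m * (real N - real m) / 2"
    proof -
      have "A m 0 = ((real m + 1) * (real N - 1 - real m) + (real N - 1)) / 2"
        unfolding A_def using 0 by (simp add: sq)
      then show ?thesis by (simp add: lap_weight_def field_simps power2_eq_square)
    qed
    moreover have "0 \<le> real m * (real N - real m)" using 0 by auto
    ultimately have "1 + A m 0 \<le> lap_weight N m 0" using m1 by linarith
    then show ?case using 0 by (intro exI[of _ "lap_weight N m 0"]) (auto simp: laplacian_diag_entries(1))
  next
    case (Suc q)
    obtain p where p: "tri_pivot (lap_main N m) (lap_off N m) q = of_real (- p)" "1 + A (q + m) q \<le> p"
      using Suc by auto
    define e where "e = ladder N (q + m) * ladder N q"
    have p0: "0 < p" using p(2) A0[of "q + m" q] by linarith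
    have "0 \<le> (((ladder N (q + m))\<^sup>2 - (ladder N q)\<^sup>2) / 2)\<^sup>2" by simp
    also have "\<dots> = (A (q + m) q)\<^sup>2 - e\<^sup>2" unfolding A_def e_def by (simp add: field_simps power2_eq_square)
    finally have "e * e \<le> A (q + m) q * A (q + m) q" by (simp add: power2_eq_square)
    also have "\<dots> \<le> A (q + m) q * p" using p(2) A0 by (intro mult_left_mono) auto
    finally have e: "e * e / p \<le> A (q + m) q" using p0 by (simp add: divide_le_eq)
    have "lap_weight N (Suc q + m) (Suc q) = (real m)\<^sup>2 + A (Suc q + m) (Suc q) + A (q + m) q"
    proof -
      have "A (Suc q + m) (Suc q) = ((real q + real m + 2) * (real N - 2 - real q - real m) + (real q + 2) * (real N - 2 - real q)) / 2"
        unfolding A_def using Suc.prems sq[of "Suc q + m"] sq[of "Suc q"] by (simp add: add_ac diff_diff_eq)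
      moreover have "A (q + m) q = ((real q + real m + 1) * (real N - 1 - real q - real m) + (real q + 1) * (real N - 1 - real q)) / 2"
        unfolding A_def using Suc.prems sq[of "q + m"] sq[of q] by (simp add: add_ac diff_diff_eq)
      ultimately show ?thesis by (simp add: lap_weight_def field_simps power2_eq_square)
    qed
    then have "1 + A (Suc q + m) (Suc q) \<le> lap_weight N (Suc q + m) (Suc q) - e * e / p"
      using e m1 by linarith
    moreover have "tri_pivot (lap_main N m) (lap_off N m) (Suc q) = of_real (- (lap_weight N (Suc q + m) (Suc q) - e * e / p))"
      using Suc.prems p p0 by (simp add: laplacian_diag_entries e_def)
    ultimately show ?case by blast
  qed
  then obtain p where p: "tri_pivot (lap_main N m) (lap_off N m) q = of_real (- p)" "1 + A (q + m) q \<le> p" by blast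
  then have "p \<noteq> 0" using A0[of "q + m" q] by auto
  then show ?thesis unfolding p(1) by simp
qed

text \<open>The solution with \<open>y 0 = 0\<close> of \<open>c\<^sub>q (y\<^sub>q\<^sub>+\<^sub>1 - y\<^sub>q) - c\<^sub>q\<^sub>-\<^sub>1 (y\<^sub>q - y\<^sub>q\<^sub>-\<^sub>1) = x\<^sub>q\<close>, \<open>c\<^sub>q = (q + 1)(N - 1 - q)\<close>,
for \<open>x\<close> with sum zero; \<open>casimir_on_main_diagonal\<close> shows that the Laplacian acts in this way.\<close>

definition poisson :: "nat \<Rightarrow> (nat \<Rightarrow> complex) \<Rightarrow> nat \<Rightarrow> complex" where
  "poisson N x q = (\<Sum>p<q. (\<Sum>s<Suc p. x s) / of_nat ((p + 1) * (N - 1 - p)))"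

lemma poisson_coeff_nonzero: "Suc p < N \<Longrightarrow> (of_nat ((p + 1) * (N - 1 - p)) :: complex) \<noteq> 0"
  by (simp only: of_nat_eq_0_iff mult_eq_0_iff) auto

lemma casimir_on_main_diagonal:
  assumes "q < N"
  shows "casimir N Y $$ (q, q) =
    (if Suc q < N then of_nat ((q + 1) * (N - 1 - q)) * (Y $$ (Suc q, Suc q) - Y $$ (q, q)) else 0)
    - (if 0 < q then of_nat (q * (N - q)) * (Y $$ (q, q) - Y $$ (q - 1, q - 1)) else 0)"
proof -
  have sq: "complex_of_real (ladder N i * ladder N i) = of_nat ((i + 1) * (N - 1 - i))" if "i < N" for i
  proof -
    have "ladder N i * ladder N i = (real i + 1) * (real N - 1 - real i)"
      unfolding ladder_def using that by (intro real_sqrt_mult_self[THEN trans] abs_of_nonneg) auto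
    also have "\<dots> = real ((i + 1) * (N - 1 - i))"
    proof -
      have "real (N - 1 - i) = real N - 1 - real i" using that by linarith
      then show ?thesis unfolding of_nat_mult by simp
    qed
    finally show ?thesis by (metis of_real_of_nat_eq)
  qed
  have w: "complex_of_real (lap_weight N q q) = of_nat ((q + 1) * (N - 1 - q)) + of_nat (q * (N - q))"
  proof -
    have "lap_weight N q q = real ((q + 1) * (N - 1 - q)) + real (q * (N - q))"
    proof -
      have "real (N - 1 - q) = real N - 1 - real q" "real (N - q) = real N - real q" using assms by linarith+
      then show ?thesis unfolding of_nat_mult lap_weight_def by (simp add: algebra_simps)
    qed
    then show ?thesis by (metis of_real_add of_real_of_nat_eq)
  qed
  define c0 c1 :: complex where "c0 = of_nat (q * (N - q))" "c1 = of_nat ((q + 1) * (N - 1 - q))"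
  have L1: "complex_of_real (ladder N q * ladder N q) = c1" using sq[OF assms] unfolding c0_c1_def .
  have L0: "complex_of_real (ladder N (q - 1) * ladder N (q - 1)) = c0" if "0 < q"
  proof -
    have "q - 1 < N" "q - 1 + 1 = q" "N - 1 - (q - 1) = N - q" using that assms by auto
    then show ?thesis using sq[of "q - 1"] unfolding c0_c1_def by (simp only:)
  qed
  have c1: "c1 = 0" if "\<not> Suc q < N" using that by (auto simp: c0_c1_def)
  have c0: "c0 = 0" if "\<not> 0 < q" using that by (auto simp: c0_c1_def)
  have "casimir N Y $$ (q, q) =
    (if Suc q < N then complex_of_real (ladder N q * ladder N q) * Y $$ (Suc q, Suc q) else 0)
    - complex_of_real (lap_weight N q q) * Y $$ (q, q)
    + (if 0 < q then complex_of_real (ladder N (q - 1) * ladder N (q - 1)) * Y $$ (q - 1, q - 1) else 0)"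
    using assms by (simp add: casimir_def)
  also have "\<dots> = (if Suc q < N then c1 * (Y $$ (Suc q, Suc q) - Y $$ (q, q)) else 0)
    - (if 0 < q then c0 * (Y $$ (q, q) - Y $$ (q - 1, q - 1)) else 0)"
    unfolding w[folded c0_c1_def] L1 using L0 c1 c0
    by (cases "0 < q"; cases "Suc q < N") (simp_all add: algebra_simps del: of_real_mult)
  finally show ?thesis unfolding c0_c1_def .
qed

definition trace_free :: "nat \<Rightarrow> (nat \<Rightarrow> nat \<Rightarrow> complex) \<Rightarrow> nat \<Rightarrow> complex" where
  "trace_free N X q = X q q - (\<Sum>p<N. X p p) / of_nat N"

text \<open>The diagonals are solved independently.  On the main diagonal the solution is determined up to a constant,
which is fixed by subtracting the mean so that the trace vanishes.\<close>

definition lap_solve :: "nat \<Rightarrow> (nat \<Rightarrow> nat \<Rightarrow> complex) \<Rightarrow> nat \<Rightarrow> nat \<Rightarrow> complex" where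
  "lap_solve N X i j =
    (if i = j then poisson N (trace_free N X) i - (\<Sum>q<N. poisson N (trace_free N X) q) / of_nat N
     else if j < i then
       tri_solve (lap_main N (i - j)) (lap_off N (i - j)) (\<lambda>q. X (q + (i - j)) q) (N - (i - j)) j
     else
       tri_solve (lap_main N (j - i)) (lap_off N (j - i)) (\<lambda>q. X q (q + (j - i))) (N - (j - i)) i)"

definition trace_free_mat :: "nat \<Rightarrow> (nat \<Rightarrow> nat \<Rightarrow> complex) \<Rightarrow> complex mat" where
  "trace_free_mat N X = mat N N (\<lambda>(i, j). if i = j then trace_free N X i else X i j)"

lemma casimir_unique:
  assumes Y: "Y \<in> carrier_mat N N" "mat_trace Y = 0" and N: "0 < N"
    and eq: "casimir N Y = trace_free_mat N X" and ij: "i < N" "j < N"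
  shows "Y $$ (i, j) = lap_solve N X i j"
proof -
  consider "j < i" | "i < j" | "i = j" by linarith
  then show ?thesis
  proof cases
    case 1
    define m where "m = i - j"
    have m: "i = j + m" "1 \<le> m" using 1 by (auto simp: m_def)
    have "(\<lambda>q. Y $$ (q + m, q)) j = tri_solve (lap_main N m) (lap_off N m) (\<lambda>q. X (q + m) q) (N - m) j"
    proof (rule tri_solve_unique)
      fix q assume "q < N - m"
      then show "tri_apply (lap_main N m) (lap_off N m) (N - m) (\<lambda>q. Y $$ (q + m, q)) q = X (q + m) q"
        using m by (subst casimir_on_diagonal[symmetric]) (auto simp: eq trace_free_mat_def)
    qed (use lap_pivot_nonzero m ij in auto)
    then show ?thesis using m by (simp add: lap_solve_def)
  next
    case 2
    define m where "m = j - i"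
    have m: "j = i + m" "1 \<le> m" using 2 by (auto simp: m_def)
    have "(\<lambda>q. Y $$ (q, q + m)) i = tri_solve (lap_main N m) (lap_off N m) (\<lambda>q. X q (q + m)) (N - m) i"
    proof (rule tri_solve_unique)
      fix q assume "q < N - m"
      then show "tri_apply (lap_main N m) (lap_off N m) (N - m) (\<lambda>q. Y $$ (q, q + m)) q = X q (q + m)"
        using m by (subst casimir_on_diagonal[symmetric]) (auto simp: eq trace_free_mat_def)
    qed (use lap_pivot_nonzero m ij in auto)
    then show ?thesis using m by (simp add: lap_solve_def)
  next
    case 3
    define y x where "y q = Y $$ (q, q)" "x = trace_free N X" for q
    define c where "c p = (of_nat ((p + 1) * (N - 1 - p)) :: complex)" for p
    have row: "(if Suc q < N then c q * (y (Suc q) - y q) else 0) - (if 0 < q then c (q - 1) * (y q - y (q - 1)) else 0) = x q"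
      if "q < N" for q
    proof -
      have "c (q - 1) = of_nat (q * (N - q))" if "0 < q"
        using that \<open>q < N\<close> by (auto simp: c_def simp del: of_nat_mult)
      then show ?thesis
        using casimir_on_main_diagonal[OF that, of Y] that
        by (auto simp: eq trace_free_mat_def y_x_def c_def simp del: of_nat_mult)
    qed
    have flux: "c q * (y (Suc q) - y q) = (\<Sum>s<Suc q. x s)" if "Suc q < N" for q
      using that
    proof (induction q)
      case 0
      then show ?case using row[of 0] by simp
    next
      case (Suc q)
      then show ?case using row[of "Suc q"] by (simp add: algebra_simps)
    qed
    have yq: "y q = y 0 + poisson N x q" if "q < N" for q
      using that
    proof (induction q)
      case 0
      then show ?case by (simp add: poisson_def)
    next
      case (Suc q)
      have "c q \<noteq> 0" unfolding c_def by (rule poisson_coeff_nonzero[OF Suc.prems])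
      then have "y (Suc q) - y q = (\<Sum>s<Suc q. x s) / c q"
        using flux[OF Suc.prems] by (simp add: field_simps)
      then show ?case using Suc by (simp add: poisson_def c_def algebra_simps)
    qed
    have "0 = (\<Sum>q<N. y q)" using Y by (simp add: mat_trace_def y_x_def)
    also have "\<dots> = of_nat N * y 0 + (\<Sum>q<N. poisson N x q)"
    proof -
      have "(\<Sum>q<N. y q) = (\<Sum>q<N. y 0 + poisson N x q)"
        by (rule sum.cong[OF refl]) (rule yq, simp)
      then show ?thesis by (simp add: sum.distrib)
    qed
    finally have "y 0 = - (\<Sum>q<N. poisson N x q) / of_nat N"
      using N by (simp add: field_simps eq_neg_iff_add_eq_0)
    then show ?thesis using yq[OF ij(1)] 3 by (simp add: lap_solve_def y_x_def)
  qed
qed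

lemma casimir_lap_solve:
  fixes X :: "nat \<Rightarrow> nat \<Rightarrow> complex"
  assumes N: "0 < N"
  defines "Y \<equiv> mat N N (\<lambda>(i, j). lap_solve N X i j)"
  shows "casimir N Y = trace_free_mat N X" "mat_trace Y = 0"
proof -
  define x where "x = trace_free N X"
  have x0: "(\<Sum>s<N. x s) = 0"
    using N by (simp add: x_def trace_free_def sum_subtractf)
  have yq: "Y $$ (q, q) = poisson N x q - (\<Sum>q<N. poisson N x q) / of_nat N" if "q < N" for q
    using that by (simp add: Y_def lap_solve_def x_def)
  show "mat_trace Y = 0"
    using N yq by (simp add: mat_trace_def sum_subtractf Y_def lap_solve_def x_def)
  show "casimir N Y = trace_free_mat N X"
  proof (rule eq_matI)
    fix i j assume "i < dim_row (trace_free_mat N X)" "j < dim_col (trace_free_mat N X)"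
    then have ij: "i < N" "j < N" by (auto simp: trace_free_mat_def)
    consider "j < i" | "i < j" | "i = j" by linarith
    then show "casimir N Y $$ (i, j) = trace_free_mat N X $$ (i, j)"
    proof cases
      case 1
      define m where "m = i - j"
      have m: "i = j + m" "1 \<le> m" "j + m < N" using 1 ij by (auto simp: m_def)
      have "casimir N Y $$ (j + m, j) = tri_apply (lap_main N m) (lap_off N m) (N - m)
          (tri_solve (lap_main N m) (lap_off N m) (\<lambda>q. X (q + m) q) (N - m)) j"
        unfolding casimir_on_diagonal(1)[OF m(3)] tri_apply_def using m by (auto simp: Y_def lap_solve_def)
      also have "\<dots> = X (j + m) j"
        by (rule tri_apply_solve) (use lap_pivot_nonzero m in auto)
      finally show ?thesis using 1 ij m(1) by (simp add: trace_free_mat_def)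
    next
      case 2
      define m where "m = j - i"
      have m: "j = i + m" "1 \<le> m" "i + m < N" using 2 ij by (auto simp: m_def)
      have "casimir N Y $$ (i, i + m) = tri_apply (lap_main N m) (lap_off N m) (N - m)
          (tri_solve (lap_main N m) (lap_off N m) (\<lambda>q. X q (q + m)) (N - m)) i"
        unfolding casimir_on_diagonal(2)[OF m(3)] tri_apply_def using m by (auto simp: Y_def lap_solve_def)
      also have "\<dots> = X i (i + m)"
        by (rule tri_apply_solve) (use lap_pivot_nonzero m in auto)
      finally show ?thesis using 2 ij m(1) by (simp add: trace_free_mat_def)
    next
      case 3
      have flux: "of_nat ((q + 1) * (N - 1 - q)) * (Y $$ (Suc q, Suc q) - Y $$ (q, q)) = (\<Sum>s<Suc q. x s)"
        if "Suc q < N" for q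
      proof -
        note c = poisson_coeff_nonzero[OF that]
        have "Y $$ (Suc q, Suc q) - Y $$ (q, q) = (\<Sum>s<Suc q. x s) / of_nat ((q + 1) * (N - 1 - q))"
          using that yq by (simp add: poisson_def)
        then show ?thesis by (simp only: times_divide_eq_right nonzero_mult_div_cancel_left[OF c])
      qed
      have up: "(if Suc i < N then of_nat ((i + 1) * (N - 1 - i)) * (Y $$ (Suc i, Suc i) - Y $$ (i, i)) else 0) = (\<Sum>s<Suc i. x s)"
      proof (cases "Suc i < N")
        case True
        then show ?thesis using flux[OF True] by (simp only: if_True)
      next
        case False
        then have "Suc i = N" using ij by simp
        then show ?thesis using x0 by simp
      qed
      have down: "(if 0 < i then of_nat (i * (N - i)) * (Y $$ (i, i) - Y $$ (i - 1, i - 1)) else 0) = (\<Sum>s<i. x s)"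
      proof (cases i)
        case (Suc k)
        have "N - 1 - k = N - Suc k" "k + 1 = Suc k" by auto
        then show ?thesis using flux[of k] ij Suc by (simp del: of_nat_mult sum.lessThan_Suc)
      qed simp
      show ?thesis
        unfolding 3[symmetric] casimir_on_main_diagonal[OF ij(1)] up down
        using ij by (simp add: trace_free_mat_def x_def)
    qed
  qed (auto simp: trace_free_mat_def casimir_def)
qed

theorem laplacian_inv_eq:
  assumes X: "X \<in> carrier_mat N N" and N: "0 < N"
  shows "laplacian_inv N X = mat N N (\<lambda>(i, j). lap_solve N (\<lambda>i j. X $$ (i, j)) i j)"
proof -
  let ?D = "{Y \<in> carrier_mat N N. mat_trace Y = 0}" and ?X = "\<lambda>i j. X $$ (i, j)"
  let ?Y = "mat N N (\<lambda>(i, j). lap_solve N ?X i j)"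
  have rhs: "X - (mat_trace X / of_nat N) \<cdot>\<^sub>m 1\<^sub>m N = trace_free_mat N ?X"
    using X by (intro eq_matI) (auto simp: trace_free_mat_def trace_free_def mat_trace_def)
  have "inj_on (discrete_laplacian N) ?D"
  proof (rule inj_onI)
    fix A B assume AB: "A \<in> ?D" "B \<in> ?D" "discrete_laplacian N A = discrete_laplacian N B"
    then have cAB: "casimir N A = casimir N B" by (simp add: discrete_laplacian_eq_casimir)
    define C where "C = A - B"
    have C: "C \<in> carrier_mat N N" "mat_trace C = 0"
      using AB by (auto simp: C_def mat_trace_def sum_subtractf)
    have zero: "trace_free_mat N (\<lambda>i j. 0) = 0\<^sub>m N N" by (auto simp: trace_free_mat_def trace_free_def)
    have CA: "casimir N C $$ (i, j) = casimir N A $$ (i, j) - casimir N B $$ (i, j)" if "i < N" "j < N" for i j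
      using that AB by (auto simp: C_def casimir_def algebra_simps)
    have "casimir N C = trace_free_mat N (\<lambda>i j. 0)"
      unfolding zero
    proof (rule eq_matI)
      fix i j assume "i < dim_row (0\<^sub>m N N :: complex mat)" "j < dim_col (0\<^sub>m N N :: complex mat)"
      then have ij: "i < N" "j < N" by auto
      show "casimir N C $$ (i, j) = 0\<^sub>m N N $$ (i, j)" unfolding CA[OF ij] cAB using ij by simp
    qed (simp_all add: casimir_def)
    note Csol = casimir_unique[OF C N this]
    have zsol: "lap_solve N (\<lambda>i j. 0) i j = 0" if "i < N" "j < N" for i j
    proof -
      have "0\<^sub>m N N $$ (i, j) = lap_solve N (\<lambda>i j. 0) i j"
        by (rule casimir_unique[OF _ _ N _ that]) (auto simp: mat_trace_def zero casimir_def)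
      then show ?thesis using that by (simp only: index_zero_mat)
    qed
    have Cz: "C $$ (i, j) = 0" if "i < N" "j < N" for i j
      unfolding Csol[OF that] by (rule zsol[OF that])
    show "A = B"
    proof (rule eq_matI)
      fix i j assume "i < dim_row B" "j < dim_col B"
      then have ij: "i < N" "j < N" using AB by auto
      moreover have "A \<in> carrier_mat N N" "B \<in> carrier_mat N N" using AB by auto
      ultimately show "A $$ (i, j) = B $$ (i, j)" using Cz[OF ij] by (simp add: C_def)
    qed (use AB in auto)
  qed
  then show ?thesis
    unfolding laplacian_inv_def rhs
    by (rule the_inv_into_f_eq)
      (use casimir_lap_solve[OF N, of ?X] in \<open>auto simp: discrete_laplacian_eq_casimir\<close>)
qed

lemma laplacian_inv_carrier:
  "X \<in> carrier_mat N N \<Longrightarrow> 0 < N \<Longrightarrow> laplacian_inv N X \<in> carrier_mat N N"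
  by (simp add: laplacian_inv_eq)

lemma adjoint_entry: "i < dim_col A \<Longrightarrow> j < dim_row A \<Longrightarrow> mat_adjoint A $$ (i, j) = cnj (A $$ (j, i))"
  for A :: "complex mat"
  by (simp add: mat_adjoint_def mat_of_rows_def)

text \<open>The Casimir operator commutes with taking adjoints, so \<open>- Y\<^sup>*\<close> solves the same problem as the solution \<open>Y\<close>;
\<open>casimir_unique\<close> identifies the two.\<close>

lemma laplacian_inv_skew:
  assumes X: "X \<in> carrier_mat N N" and N: "0 < N" and skew: "\<And>i j. i < N \<Longrightarrow> j < N \<Longrightarrow> X $$ (j, i) = - cnj (X $$ (i, j))"
    and ij: "i < N" "j < N"
  shows "laplacian_inv N X $$ (j, i) = - cnj (laplacian_inv N X $$ (i, j))"
proof -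
  let ?X = "\<lambda>i j. X $$ (i, j)"
  define Y where "Y = laplacian_inv N X"
  have Y: "Y = mat N N (\<lambda>(i, j). lap_solve N ?X i j)" unfolding Y_def by (rule laplacian_inv_eq[OF X N])
  have Yc: "casimir N Y = trace_free_mat N ?X" "mat_trace Y = 0"
    unfolding Y by (rule casimir_lap_solve[OF N])+
  define Z where "Z = mat N N (\<lambda>(i, j). - cnj (Y $$ (j, i)))"
  have tr: "cnj (\<Sum>p<N. X $$ (p, p)) = - (\<Sum>p<N. X $$ (p, p))"
  proof -
    have "cnj (X $$ (p, p)) = - X $$ (p, p)" if "p < N" for p
      using arg_cong[OF skew[OF that that], of uminus] by simp
    then show ?thesis by (simp add: sum_negf[symmetric])
  qed
  have tf: "- cnj (trace_free_mat N ?X $$ (b, a)) = trace_free_mat N ?X $$ (a, b)" if "a < N" "b < N" for a b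
  proof (cases "a = b")
    case True
    have "- cnj (X $$ (a, a)) = X $$ (a, a)" by (rule skew[symmetric]) (rule that)+
    then show ?thesis using True that tr by (simp add: trace_free_mat_def trace_free_def)
  next
    case False
    then show ?thesis using that skew[of b a] by (simp add: trace_free_mat_def)
  qed
  have "casimir N Z = trace_free_mat N ?X"
  proof (rule eq_matI)
    fix a b assume "a < dim_row (trace_free_mat N ?X)" "b < dim_col (trace_free_mat N ?X)"
    then have ab: "a < N" "b < N" by (auto simp: trace_free_mat_def)
    have "casimir N Z $$ (a, b) = - cnj (casimir N Y $$ (b, a))"
      using ab by (auto simp: casimir_def Z_def lap_weight_commute mult_ac)
    then show "casimir N Z $$ (a, b) = trace_free_mat N ?X $$ (a, b)"
      unfolding Yc(1) tf[OF ab] .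
  qed (auto simp: casimir_def trace_free_mat_def)
  moreover have "mat_trace Z = 0"
  proof -
    have "mat_trace Z = - cnj (mat_trace Y)" by (simp add: mat_trace_def Z_def Y sum_negf)
    then show ?thesis using Yc(2) by simp
  qed
  ultimately have "Z $$ (j, i) = lap_solve N ?X j i"
    using casimir_unique[of Z N ?X j i] N ij by (simp add: Z_def)
  then show ?thesis using ij unfolding Y_def[symmetric] by (simp add: Y Z_def)
qed

section \<open>The Cayley transform\<close>

subsection \<open>Adjoints\<close>

lemma adjoint_carrier [simp]: "A \<in> carrier_mat n m \<Longrightarrow> mat_adjoint A \<in> carrier_mat m n"
  for A :: "complex mat"
  by (simp add: mat_adjoint_def mat_of_rows_def)

lemma adjoint_dims [simp]: "dim_row (mat_adjoint A) = dim_col A" "dim_col (mat_adjoint A) = dim_row A"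
  for A :: "complex mat"
  by (simp_all add: mat_adjoint_def mat_of_rows_def)

lemma adjoint_at: "A \<in> carrier_mat n m \<Longrightarrow> i < m \<Longrightarrow> j < n \<Longrightarrow> mat_adjoint A $$ (i, j) = cnj (A $$ (j, i))"
  for A :: "complex mat"
  by (rule adjoint_entry) auto

lemma adjoint_eqI:
  fixes A B :: "complex mat"
  assumes "A \<in> carrier_mat n m" "B \<in> carrier_mat m n"
    "\<And>i j. i < m \<Longrightarrow> j < n \<Longrightarrow> B $$ (i, j) = cnj (A $$ (j, i))"
  shows "mat_adjoint A = B"
  using assms adjoint_carrier[OF assms(1)] by (intro eq_matI) (auto simp: adjoint_at[OF assms(1)])

lemma adjoint_adjoint [simp]: "A \<in> carrier_mat n m \<Longrightarrow> mat_adjoint (mat_adjoint A) = A"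
  for A :: "complex mat"
  by (rule adjoint_eqI[of _ m n]) (auto simp: adjoint_at)

lemma mult_mat_at:
  assumes "A \<in> carrier_mat n k" "B \<in> carrier_mat k m" "i < n" "j < m"
  shows "(A * B) $$ (i, j) = (\<Sum>l<k. A $$ (i, l) * B $$ (l, j))"
  using assms by (simp add: scalar_prod_def atLeast0LessThan)

lemma adjoint_mult:
  fixes A B :: "complex mat"
  assumes "A \<in> carrier_mat n k" "B \<in> carrier_mat k m"
  shows "mat_adjoint (A * B) = mat_adjoint B * mat_adjoint A"
proof (rule adjoint_eqI[of _ n m])
  fix i j assume ij: "i < m" "j < n"
  have "(mat_adjoint B * mat_adjoint A) $$ (i, j) = (\<Sum>l<k. mat_adjoint B $$ (i, l) * mat_adjoint A $$ (l, j))"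
    by (rule mult_mat_at) (use assms ij in auto)
  also have "\<dots> = (\<Sum>l<k. cnj (A $$ (j, l) * B $$ (l, i)))"
    using assms ij by (intro sum.cong) (auto simp: adjoint_at)
  also have "\<dots> = cnj ((A * B) $$ (j, i))"
    using mult_mat_at[OF assms ij(2,1)] by simp
  finally show "(mat_adjoint B * mat_adjoint A) $$ (i, j) = cnj ((A * B) $$ (j, i))" .
qed (rule mult_carrier_mat[OF assms] mult_carrier_mat[OF adjoint_carrier adjoint_carrier, OF assms(2,1)])+

lemma adjoint_one [simp]: "mat_adjoint (1\<^sub>m n :: complex mat) = 1\<^sub>m n"
  by (rule adjoint_eqI[of _ n n]) auto

lemma u_algD:
  assumes "A \<in> u_alg N"
  shows "A \<in> carrier_mat N N" "mat_adjoint A = - A"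
    "i < N \<Longrightarrow> j < N \<Longrightarrow> cnj (A $$ (i, j)) = - A $$ (j, i)"
proof -
  show A: "A \<in> carrier_mat N N" "mat_adjoint A = - A" using assms by (auto simp: u_alg_def)
  assume "i < N" "j < N"
  then show "cnj (A $$ (i, j)) = - A $$ (j, i)"
    using adjoint_at[OF A(1), of j i] A by simp
qed

lemma u_algI:
  assumes "A \<in> carrier_mat N N" "\<And>i j. i < N \<Longrightarrow> j < N \<Longrightarrow> cnj (A $$ (i, j)) = - A $$ (j, i)"
  shows "A \<in> u_alg N"
  using assms unfolding u_alg_def by (auto intro!: adjoint_eqI[of _ N N])

subsection \<open>The resolvent of a skew-Hermitian matrix\<close>

abbreviation halfminus :: "nat \<Rightarrow> complex mat \<Rightarrow> complex mat" where
  "halfminus N \<Omega> \<equiv> 1\<^sub>m N - (1/2) \<cdot>\<^sub>m \<Omega>"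

abbreviation halfplus :: "nat \<Rightarrow> complex mat \<Rightarrow> complex mat" where
  "halfplus N \<Omega> \<equiv> 1\<^sub>m N + (1/2) \<cdot>\<^sub>m \<Omega>"

lemma half_carrier [simp]:
  assumes "\<Omega> \<in> carrier_mat N N"
  shows "halfminus N \<Omega> \<in> carrier_mat N N" "halfplus N \<Omega> \<in> carrier_mat N N"
  using assms by (auto intro!: carrier_matI)

definition resolvent :: "nat \<Rightarrow> complex mat \<Rightarrow> complex mat" where
  "resolvent N \<Omega> = the (mat_inverse (halfminus N \<Omega>))"

text \<open>If \<open>v = \<Omega> v / 2\<close>, then \<open>2 |v|\<^sup>2 = v\<^sup>* \<Omega> v\<close> is both real and imaginary.\<close>

lemma skew_fixed_vector:
  fixes v :: "nat \<Rightarrow> complex"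
  assumes \<Omega>: "\<Omega> \<in> u_alg N" and v: "\<And>i. i < N \<Longrightarrow> v i = 1/2 * (\<Sum>j<N. \<Omega> $$ (i, j) * v j)" and i: "i < N"
  shows "v i = 0"
proof -
  define S where "S = (\<Sum>i<N. \<Sum>j<N. \<Omega> $$ (i, j) * v j * cnj (v i))"
  have "cnj S = (\<Sum>i<N. \<Sum>j<N. - (\<Omega> $$ (j, i) * v i * cnj (v j)))"
    unfolding S_def cnj_sum by (intro sum.cong refl) (auto simp: u_algD(3)[OF \<Omega>])
  also have "\<dots> = - S" unfolding S_def sum_negf by (subst sum.swap) simp
  \<comment> \<open>relabelling the indices after conjugation changes only the sign\<close>
  finally have S1: "cnj S = - S" .
  have S2: "S = 2 * (\<Sum>i<N. v i * cnj (v i))"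
  proof -
    have "(\<Sum>j<N. \<Omega> $$ (i, j) * v j * cnj (v i)) = 2 * (v i * cnj (v i))" if "i < N" for i
    proof -
      have "2 * v i = (\<Sum>j<N. \<Omega> $$ (i, j) * v j)" using v[OF that] by (simp add: mult.commute)
      then have "2 * v i * cnj (v i) = (\<Sum>j<N. \<Omega> $$ (i, j) * v j) * cnj (v i)" by simp
      then show ?thesis by (simp add: sum_distrib_right mult.assoc)
    qed
    then show ?thesis unfolding S_def by (simp add: sum_distrib_left)
  qed
  have S3: "S = of_real (2 * (\<Sum>i<N. (cmod (v i))\<^sup>2))"
    unfolding S2 by (simp add: complex_mult_cnj cmod_power2)
  have "Re S = 0" using S1 S3 by (simp add: complex_eq_iff)
  then have "(\<Sum>i<N. (cmod (v i))\<^sup>2) = 0" using S3 by simp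
  then show ?thesis using i by (simp add: sum_nonneg_eq_0_iff)
qed

lemma resolvent:
  assumes \<Omega>: "\<Omega> \<in> u_alg N"
  shows "resolvent N \<Omega> \<in> carrier_mat N N" "halfminus N \<Omega> * resolvent N \<Omega> = 1\<^sub>m N"
    "resolvent N \<Omega> * halfminus N \<Omega> = 1\<^sub>m N"
proof -
  note c = u_algD(1)[OF \<Omega>]
  have P: "halfminus N \<Omega> \<in> carrier_mat N N" using c by simp
  have "det (halfminus N \<Omega>) \<noteq> 0"
  proof
    assume "det (halfminus N \<Omega>) = 0"
    then obtain v where v: "v \<in> carrier_vec N" "v \<noteq> 0\<^sub>v N" "halfminus N \<Omega> *\<^sub>v v = 0\<^sub>v N"
      using det_0_iff_vec_prod_zero[OF P] by auto
    have "v $ i = 0" if i: "i < N" for i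
    proof (rule skew_fixed_vector[OF \<Omega> _ i])
      fix i assume i: "i < N"
      have "(halfminus N \<Omega> *\<^sub>v v) $ i = (\<Sum>j<N. ((if i = j then 1 else 0) - 1/2 * \<Omega> $$ (i, j)) * v $ j)"
        using i c v(1) by (simp add: scalar_prod_def atLeast0LessThan)
      also have "\<dots> = (\<Sum>j<N. (if i = j then v $ j else 0) - 1/2 * (\<Omega> $$ (i, j) * v $ j))"
        by (intro sum.cong) (auto simp: algebra_simps)
      also have "\<dots> = v $ i - 1/2 * (\<Sum>j<N. \<Omega> $$ (i, j) * v $ j)"
        using i by (simp add: sum_subtractf sum_distrib_left)
      finally show "v $ i = 1/2 * (\<Sum>j<N. \<Omega> $$ (i, j) * v $ j)" using v(3) i by simp
    qed
    then have "v = 0\<^sub>v N" using v(1) by (intro eq_vecI) auto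
    with v(2) show False by simp
  qed
  then have "halfminus N \<Omega> \<in> Units (ring_mat TYPE(complex) N ())"
    by (rule det_non_zero_imp_unit[OF P])
  then obtain B where "mat_inverse (halfminus N \<Omega>) = Some B"
    using mat_inverse(1)[OF P, of "()"] by (cases "mat_inverse (halfminus N \<Omega>)") auto
  then show "resolvent N \<Omega> \<in> carrier_mat N N" "halfminus N \<Omega> * resolvent N \<Omega> = 1\<^sub>m N"
    "resolvent N \<Omega> * halfminus N \<Omega> = 1\<^sub>m N"
    using mat_inverse(2)[OF P] by (auto simp: resolvent_def)
qed

lemma halfminus_adjoint:
  assumes "\<Omega> \<in> u_alg N"
  shows "mat_adjoint (halfminus N \<Omega>) = halfplus N \<Omega>" "mat_adjoint (halfplus N \<Omega>) = halfminus N \<Omega>"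
  using u_algD[OF assms] by (auto intro!: adjoint_eqI[of _ N N])

lemma mult_assoc_sq:
  fixes A B C :: "complex mat"
  assumes "A \<in> carrier_mat N N" "B \<in> carrier_mat N N" "C \<in> carrier_mat N N"
  shows "A * B * C = A * (B * C)"
  using assms by (rule assoc_mult_mat)

text \<open>The adjoint inverts \<open>I + \<Omega>/2\<close>, which commutes with \<open>I - \<Omega>/2\<close>; therefore the resolvent is normal.\<close>

lemma resolvent_adjoint:
  assumes \<Omega>: "\<Omega> \<in> u_alg N"
  defines "R \<equiv> resolvent N \<Omega>"
  shows "mat_adjoint R * halfplus N \<Omega> = 1\<^sub>m N" "halfplus N \<Omega> * mat_adjoint R = 1\<^sub>m N"
    "R * mat_adjoint R = mat_adjoint R * R"
proof -
  note c = u_algD(1)[OF \<Omega>] and r = resolvent[OF \<Omega>, folded R_def]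
  have P: "halfminus N \<Omega> \<in> carrier_mat N N" "halfplus N \<Omega> \<in> carrier_mat N N" "mat_adjoint R \<in> carrier_mat N N"
    using c r by auto
  show 1: "mat_adjoint R * halfplus N \<Omega> = 1\<^sub>m N"
    using arg_cong[OF r(2), of mat_adjoint] adjoint_mult[OF P(1) r(1)] halfminus_adjoint[OF \<Omega>] by simp
  show 2: "halfplus N \<Omega> * mat_adjoint R = 1\<^sub>m N"
    using arg_cong[OF r(3), of mat_adjoint] adjoint_mult[OF r(1) P(1)] halfminus_adjoint[OF \<Omega>] by simp
  \<comment> \<open>both products are \<open>I - \<Omega>\<^sup>2/4\<close>\<close>
  have comm: "halfminus N \<Omega> * halfplus N \<Omega> = halfplus N \<Omega> * halfminus N \<Omega>"
    using c by (simp add: minus_mult_distrib_mat[of _ N N _ _ N] mult_minus_distrib_mat[of _ N N _ N]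
        mult_add_distrib_mat[of _ N N _ N] add_mult_distrib_mat[of _ N N _ _ N], intro eq_matI)
      (auto simp: algebra_simps)
  have e: "mat_adjoint R * R * (halfminus N \<Omega> * halfplus N \<Omega>) = 1\<^sub>m N"
  proof -
    have "mat_adjoint R * R * (halfminus N \<Omega> * halfplus N \<Omega>) = mat_adjoint R * (R * halfminus N \<Omega> * halfplus N \<Omega>)"
      using P r(1) by (simp add: mult_assoc_sq[of _ N])
    also have "\<dots> = 1\<^sub>m N" unfolding r(3) left_mult_one_mat[OF P(2)] by (rule 1)
    finally show ?thesis .
  qed
  have f: "halfminus N \<Omega> * halfplus N \<Omega> * (R * mat_adjoint R) = 1\<^sub>m N"
  proof -
    have "halfplus N \<Omega> * halfminus N \<Omega> * (R * mat_adjoint R) = halfplus N \<Omega> * (halfminus N \<Omega> * R * mat_adjoint R)"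
      using P r(1) by (simp add: mult_assoc_sq[of _ N])
    also have "\<dots> = 1\<^sub>m N" using P r 2 by simp
    finally show ?thesis unfolding comm .
  qed
  have "mat_adjoint R * R = mat_adjoint R * R * (halfminus N \<Omega> * halfplus N \<Omega> * (R * mat_adjoint R))"
    unfolding f using P r(1) by simp
  also have "\<dots> = mat_adjoint R * R * (halfminus N \<Omega> * halfplus N \<Omega>) * (R * mat_adjoint R)"
    using P r(1) by (simp add: mult_assoc_sq[of _ N])
  also have "\<dots> = R * mat_adjoint R"
    unfolding e using P r(1) by simp
  finally show "R * mat_adjoint R = mat_adjoint R * R" by simp
qed

lemma cay_eq:
  assumes \<Omega>: "\<Omega> \<in> u_alg N"
  shows "cay N \<Omega> = resolvent N \<Omega> * halfplus N \<Omega>" "cay N \<Omega> \<in> carrier_mat N N"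
    "cay N \<Omega> = 2 \<cdot>\<^sub>m resolvent N \<Omega> - 1\<^sub>m N"
proof -
  note c = u_algD(1)[OF \<Omega>] and r = resolvent[OF \<Omega>]
  show 1: "cay N \<Omega> = resolvent N \<Omega> * halfplus N \<Omega>"
    by (simp add: cay_def resolvent_def)
  then show "cay N \<Omega> \<in> carrier_mat N N" using c r by simp
  have "halfplus N \<Omega> = 2 \<cdot>\<^sub>m 1\<^sub>m N - halfminus N \<Omega>"
    using c by (intro eq_matI) auto
  then have "cay N \<Omega> = resolvent N \<Omega> * (2 \<cdot>\<^sub>m 1\<^sub>m N - halfminus N \<Omega>)" unfolding 1 by simp
  also have "\<dots> = resolvent N \<Omega> * (2 \<cdot>\<^sub>m 1\<^sub>m N) - resolvent N \<Omega> * halfminus N \<Omega>"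
    using c r(1) by (intro mult_minus_distrib_mat[of _ N N _ N]) auto
  also have "resolvent N \<Omega> * (2 \<cdot>\<^sub>m 1\<^sub>m N) = 2 \<cdot>\<^sub>m (resolvent N \<Omega> * 1\<^sub>m N)"
    by (rule mult_smult_distrib[OF r(1) one_carrier_mat])
  finally show "cay N \<Omega> = 2 \<cdot>\<^sub>m resolvent N \<Omega> - 1\<^sub>m N" unfolding r(3) using r(1) by simp
qed

lemma cay_unitary:
  assumes \<Omega>: "\<Omega> \<in> u_alg N"
  shows "mat_adjoint (cay N \<Omega>) * cay N \<Omega> = 1\<^sub>m N" "cay N \<Omega> * mat_adjoint (cay N \<Omega>) = 1\<^sub>m N"
proof -
  let ?R = "resolvent N \<Omega>" and ?P = "halfminus N \<Omega>" and ?Q = "halfplus N \<Omega>"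
  note c = u_algD(1)[OF \<Omega>] and r = resolvent[OF \<Omega>] and a = resolvent_adjoint[OF \<Omega>]
  have C: "?P \<in> carrier_mat N N" "?Q \<in> carrier_mat N N" "mat_adjoint ?R \<in> carrier_mat N N" "?R \<in> carrier_mat N N"
    using c r by auto
  have adj: "mat_adjoint (cay N \<Omega>) = ?P * mat_adjoint ?R"
    unfolding cay_eq(1)[OF \<Omega>] using adjoint_mult[OF C(4) C(2)] halfminus_adjoint[OF \<Omega>] by simp
  have "mat_adjoint (cay N \<Omega>) * cay N \<Omega> = ?P * ((mat_adjoint ?R * ?R) * ?Q)"
    unfolding adj unfolding cay_eq(1)[OF \<Omega>] using C by (simp add: mult_assoc_sq[of _ N])
  also have "\<dots> = ?P * ((?R * mat_adjoint ?R) * ?Q)" unfolding a(3) ..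
  also have "\<dots> = (?P * ?R) * (mat_adjoint ?R * ?Q)"
    using C mult_carrier_mat[OF C(3,2)] by (simp add: mult_assoc_sq[of _ N])
  also have "\<dots> = 1\<^sub>m N" unfolding r(2) a(1) by simp
  finally show 1: "mat_adjoint (cay N \<Omega>) * cay N \<Omega> = 1\<^sub>m N" .
  show "cay N \<Omega> * mat_adjoint (cay N \<Omega>) = 1\<^sub>m N"
    by (rule mat_mult_left_right_inverse[OF _ _ 1]) (use cay_eq(2)[OF \<Omega>] in auto)
qed

text \<open>The resolvent is \<open>(I + cay \<Omega>)/2\<close>, and the entries of a unitary matrix have modulus at most one.  This
uniform bound makes the resolvent continuous along every curve of skew-Hermitian matrices, without any
analysis of matrix inversion.\<close>

lemma resolvent_bounded:
  assumes \<Omega>: "\<Omega> \<in> u_alg N" and ij: "i < N" "j < N"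
  shows "cmod (resolvent N \<Omega> $$ (i, j)) \<le> 1"
proof -
  let ?C = "cay N \<Omega>"
  note c = cay_eq(2)[OF \<Omega>] and r = resolvent(1)[OF \<Omega>]
  have "1 = (mat_adjoint ?C * ?C) $$ (j, j)" unfolding cay_unitary[OF \<Omega>] using ij by simp
  also have "\<dots> = (\<Sum>l<N. mat_adjoint ?C $$ (j, l) * ?C $$ (l, j))"
    by (rule mult_mat_at) (use c ij in auto)
  also have "\<dots> = (\<Sum>l<N. of_real ((cmod (?C $$ (l, j)))\<^sup>2))"
    using ij by (intro sum.cong)
      (auto simp: adjoint_at[OF c] mult.commute[of "cnj _"] complex_mult_cnj cmod_power2)
  finally have "(1::complex) = of_real (\<Sum>l<N. (cmod (?C $$ (l, j)))\<^sup>2)" by simp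
  then have "(\<Sum>l<N. (cmod (?C $$ (l, j)))\<^sup>2) = 1" by (metis of_real_eq_1_iff)
  moreover have "(cmod (?C $$ (i, j)))\<^sup>2 \<le> (\<Sum>l<N. (cmod (?C $$ (l, j)))\<^sup>2)"
    by (rule member_le_sum) (use ij in auto)
  ultimately have "cmod (?C $$ (i, j)) \<le> 1"
    using power2_le_imp_le[of "cmod (?C $$ (i, j))" 1] by simp
  moreover have "2 * resolvent N \<Omega> $$ (i, j) = ?C $$ (i, j) + (if i = j then 1 else 0)"
    unfolding cay_eq(3)[OF \<Omega>] using r ij by simp
  then have "2 * cmod (resolvent N \<Omega> $$ (i, j)) = cmod (?C $$ (i, j) + (if i = j then 1 else 0))"
    by (metis norm_mult norm_numeral)
  moreover have "cmod (?C $$ (i, j) + (if i = j then 1 else 0)) \<le> cmod (?C $$ (i, j)) + 1"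
    by (rule order_trans[OF norm_triangle_ineq]) auto
  ultimately show ?thesis by linarith
qed

lemma resolvent_difference:
  assumes A: "A \<in> u_alg N" and B: "B \<in> u_alg N" and ij: "i < N" "j < N"
  shows "resolvent N A $$ (i, j) - resolvent N B $$ (i, j)
    = 1/2 * (\<Sum>k<N. \<Sum>l<N. resolvent N A $$ (i, k) * (A $$ (k, l) - B $$ (k, l)) * resolvent N B $$ (l, j))"
proof -
  let ?R = "resolvent N A" and ?S = "resolvent N B"
  note r = resolvent[OF A] and s = resolvent[OF B]
  note a = u_algD(1)[OF A] and b = u_algD(1)[OF B]
  have d: "(1/2) \<cdot>\<^sub>m (A - B) = halfminus N B - halfminus N A"
    using a b by (intro eq_matI) (auto simp: algebra_simps)
  have c: "halfminus N B \<in> carrier_mat N N" "halfminus N A \<in> carrier_mat N N" "(1/2) \<cdot>\<^sub>m (A - B) \<in> carrier_mat N N"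
    using a b by auto
  have "?R * ((1/2) \<cdot>\<^sub>m (A - B)) * ?S = ?R * halfminus N B * ?S - ?R * halfminus N A * ?S"
    unfolding d using c r(1) s(1)
    by (simp add: mult_minus_distrib_mat[of _ N N _ N] minus_mult_distrib_mat[of _ N N _ _ N])
  also have "\<dots> = ?R - ?S"
    unfolding r(3) using c r(1) s by (simp add: mult_assoc_sq[of _ N])
  finally have "(?R - ?S) $$ (i, j) = (?R * ((1/2) \<cdot>\<^sub>m (A - B)) * ?S) $$ (i, j)" by simp
  also have "\<dots> = (\<Sum>l<N. (\<Sum>k<N. ?R $$ (i, k) * ((1/2) \<cdot>\<^sub>m (A - B)) $$ (k, l)) * ?S $$ (l, j))"
    using c r(1) s(1) ij by (subst mult_mat_at[of _ N N _ N]) (auto simp: mult_mat_at[of _ N N _ N] simp del: index_mult_mat)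
  also have "\<dots> = (\<Sum>l<N. \<Sum>k<N. 1/2 * (?R $$ (i, k) * (A $$ (k, l) - B $$ (k, l)) * ?S $$ (l, j)))"
    unfolding sum_distrib_right using a b by (intro sum.cong refl) auto
  also have "\<dots> = (\<Sum>k<N. \<Sum>l<N. 1/2 * (?R $$ (i, k) * (A $$ (k, l) - B $$ (k, l)) * ?S $$ (l, j)))"
    by (rule sum.swap)
  finally show ?thesis using r(1) s(1) ij by (simp add: sum_distrib_left)
qed

subsection \<open>The trivialised tangent\<close>

text \<open>A product rule in which one factor is only continuous, at a zero of the other.\<close>

lemma has_vector_derivative_mult_vanishing:
  fixes f a :: "real \<Rightarrow> complex"
  assumes f: "(f \<longlongrightarrow> f0) (at 0)" and a: "(a has_vector_derivative b) (at 0)" and a0: "a 0 = 0"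
  shows "((\<lambda>t. f t * a t) has_vector_derivative f0 * b) (at 0)"
proof -
  have "(\<lambda>h. norm (a (0 + h) - a 0 - h *\<^sub>R b) / norm h) \<midarrow>0\<rightarrow> 0"
    using a unfolding has_vector_derivative_def has_derivative_at by blast
  then have q: "((\<lambda>h. norm (a h - h *\<^sub>R b) / norm h) \<longlongrightarrow> 0) (at 0)"
    using a0 by simp
  have "((\<lambda>h. norm (f h) * (norm (a h - h *\<^sub>R b) / norm h) + norm (f h - f0) * norm b) \<longlongrightarrow>
      norm f0 * 0 + norm (f0 - f0) * norm b) (at 0)"
    by (intro tendsto_intros f q)
  then have lim: "((\<lambda>h. norm (f h) * (norm (a h - h *\<^sub>R b) / norm h) + norm (f h - f0) * norm b) \<longlongrightarrow> 0) (at 0)"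
    by simp
  have "norm (f h * a h - h *\<^sub>R (f0 * b)) / norm h
      \<le> norm (f h) * (norm (a h - h *\<^sub>R b) / norm h) + norm (f h - f0) * norm b" for h
  proof (cases "h = 0")
    case False
    have "f h * a h - h *\<^sub>R (f0 * b) = f h * (a h - h *\<^sub>R b) + h *\<^sub>R ((f h - f0) * b)"
      by (simp add: algebra_simps scaleR_conv_of_real)
    then have "norm (f h * a h - h *\<^sub>R (f0 * b)) \<le> norm (f h) * norm (a h - h *\<^sub>R b) + norm h * (norm (f h - f0) * norm b)"
      by (metis norm_triangle_ineq norm_mult norm_scaleR real_norm_def)
    then have "norm (f h * a h - h *\<^sub>R (f0 * b)) / norm h
      \<le> (norm (f h) * norm (a h - h *\<^sub>R b) + norm h * (norm (f h - f0) * norm b)) / norm h"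
      by (rule divide_right_mono) simp
    then show ?thesis using False by (simp add: add_divide_distrib)
  qed simp
  then have "((\<lambda>h. norm (f h * a h - h *\<^sub>R (f0 * b)) / norm h) \<longlongrightarrow> 0) (at 0)"
    by (intro tendsto_sandwich[OF _ _ tendsto_const lim] always_eventually allI) auto
  then show ?thesis
    unfolding has_vector_derivative_def has_derivative_at using a0 bounded_linear_scaleR_left by simp
qed

lemma triple_mult_at:
  assumes "A \<in> carrier_mat N N" "B \<in> carrier_mat N N" "C \<in> carrier_mat N N" "i < N" "j < N"
  shows "(A * B * C) $$ (i, j) = (\<Sum>k<N. \<Sum>l<N. A $$ (i, k) * B $$ (k, l) * C $$ (l, j))"
proof -
  have "(A * B * C) $$ (i, j) = (\<Sum>l<N. (A * B) $$ (i, l) * C $$ (l, j))"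
    by (rule mult_mat_at) (use assms in auto)
  also have "\<dots> = (\<Sum>l<N. \<Sum>k<N. A $$ (i, k) * B $$ (k, l) * C $$ (l, j))"
    using assms by (intro sum.cong refl) (auto simp: mult_mat_at[of A N N] sum_distrib_right simp del: index_mult_mat)
  also have "\<dots> = (\<Sum>k<N. \<Sum>l<N. A $$ (i, k) * B $$ (k, l) * C $$ (l, j))"
    by (rule sum.swap)
  finally show ?thesis .
qed

text \<open>By the resolvent identity \<open>cay A - cay \<Omega> = R\<^sub>A (A - \<Omega>) R\<^sub>\<Omega>\<close>; the factor \<open>A - \<Omega>\<close> vanishes at time zero and
\<open>R\<^sub>A\<close> tends to \<open>R\<^sub>\<Omega>\<close>.\<close>

lemma cay_derivative:
  assumes A: "\<And>t. A t \<in> u_alg N" "A 0 = \<Omega>" and d: "has_mat_derivative_at_0 N A B" and B: "B \<in> carrier_mat N N"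
  shows "has_mat_derivative_at_0 N (\<lambda>t. cay N (A t)) (resolvent N \<Omega> * B * resolvent N \<Omega>)"
proof -
  let ?R = "resolvent N \<Omega>"
  have \<Omega>: "\<Omega> \<in> u_alg N" using A(1)[of 0] A(2) by simp
  note r = resolvent(1)[OF \<Omega>]
  define a where "a k l t = A t $$ (k, l) - \<Omega> $$ (k, l)" for k l t
  have a0: "a k l 0 = 0" for k l by (simp add: a_def A(2))
  have da: "(a k l has_vector_derivative B $$ (k, l)) (at 0)" if "k < N" "l < N" for k l
  proof -
    have "((\<lambda>t. A t $$ (k, l) - \<Omega> $$ (k, l)) has_vector_derivative B $$ (k, l) - 0) (at 0)"
      by (intro has_vector_derivative_diff has_vector_derivative_const)
        (use d that in \<open>auto simp: has_mat_derivative_at_0_def\<close>)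
    then show ?thesis by (simp add: a_def[abs_def])
  qed
  have a_lim: "(a k l \<longlongrightarrow> 0) (at 0)" if "k < N" "l < N" for k l
    using has_vector_derivative_continuous[OF da[OF that]] a0[of k l] by (simp add: continuous_at)
  have R_lim: "((\<lambda>t. resolvent N (A t) $$ (i, k)) \<longlongrightarrow> ?R $$ (i, k)) (at 0)" if ik: "i < N" "k < N" for i k
  proof -
    have "((\<lambda>t. resolvent N (A t) $$ (i, p) * a p l t * ?R $$ (l, k)) \<longlongrightarrow> 0) (at 0)" if pl: "p < N" "l < N" for p l
    proof (rule tendsto_0_le[OF a_lim[OF pl]])
      have "norm (resolvent N (A t) $$ (i, p) * a p l t * ?R $$ (l, k)) \<le> norm (a p l t) * norm (?R $$ (l, k))" for t
        using mult_right_mono[OF resolvent_bounded[OF A(1)[of t] ik(1) pl(1)], of "norm (a p l t) * norm (?R $$ (l, k))"]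
        by (simp add: norm_mult mult.assoc)
      then show "\<forall>\<^sub>F t in at 0. norm (resolvent N (A t) $$ (i, p) * a p l t * ?R $$ (l, k)) \<le> norm (a p l t) * norm (?R $$ (l, k))"
        by simp
    qed
    then have "((\<lambda>t. 1/2 * (\<Sum>p<N. \<Sum>l<N. resolvent N (A t) $$ (i, p) * a p l t * ?R $$ (l, k))) \<longlongrightarrow> 1/2 * 0) (at 0)"
      by (intro tendsto_mult tendsto_const tendsto_null_sum) auto
    then have "((\<lambda>t. resolvent N (A t) $$ (i, k) - ?R $$ (i, k)) \<longlongrightarrow> 0) (at 0)"
      unfolding resolvent_difference[OF A(1) \<Omega> ik] a_def by simp
    then show ?thesis by (rule LIM_zero_cancel)
  qed
  show ?thesis
    unfolding has_mat_derivative_at_0_def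
  proof (intro allI impI)
    fix i j assume ij: "i < N" "j < N"
    have eq: "cay N (A t) $$ (i, j) = cay N \<Omega> $$ (i, j)
        + (\<Sum>k<N. \<Sum>l<N. (resolvent N (A t) $$ (i, k) * ?R $$ (l, j)) * a k l t)" for t
    proof -
      have "cay N (A t) $$ (i, j) - cay N \<Omega> $$ (i, j) = 2 * (resolvent N (A t) $$ (i, j) - ?R $$ (i, j))"
        unfolding cay_eq(3)[OF A(1)] cay_eq(3)[OF \<Omega>] using r resolvent(1)[OF A(1), of t] ij by (simp add: algebra_simps)
      also have "\<dots> = (\<Sum>k<N. \<Sum>l<N. (resolvent N (A t) $$ (i, k) * ?R $$ (l, j)) * a k l t)"
        unfolding resolvent_difference[OF A(1) \<Omega> ij] a_def by (simp add: mult_ac)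
      finally show ?thesis by (simp add: algebra_simps)
    qed
    have "((\<lambda>t. cay N \<Omega> $$ (i, j) + (\<Sum>k<N. \<Sum>l<N. (resolvent N (A t) $$ (i, k) * ?R $$ (l, j)) * a k l t))
        has_vector_derivative 0 + (\<Sum>k<N. \<Sum>l<N. (?R $$ (i, k) * ?R $$ (l, j)) * B $$ (k, l))) (at 0)"
      by (intro has_vector_derivative_add has_vector_derivative_const has_vector_derivative_sum
          has_vector_derivative_mult_vanishing tendsto_mult tendsto_const R_lim da a0) (use ij in auto)
    moreover have "(\<Sum>k<N. \<Sum>l<N. (?R $$ (i, k) * ?R $$ (l, j)) * B $$ (k, l)) = (?R * B * ?R) $$ (i, j)"
      unfolding triple_mult_at[OF r B r ij] by (simp add: mult_ac)
    ultimately show "((\<lambda>t. cay N (A t) $$ (i, j)) has_vector_derivative (?R * B * ?R) $$ (i, j)) (at 0)"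
      unfolding eq by simp
  qed
qed

text \<open>Multiplying \<open>R B R\<^sup>*\<close> by \<open>cay \<Omega> = R (I + \<Omega>/2)\<close> gives the derivative \<open>R B R\<close> of \<open>cay_derivative\<close>.  The line
\<open>\<Omega> + t B\<close> shows that no other matrix has this property, as \<open>cay \<Omega>\<close> is invertible.\<close>

lemma right_triv_tangent_cay:
  assumes \<Omega>: "\<Omega> \<in> u_alg N" and B: "B \<in> u_alg N"
  defines "R \<equiv> resolvent N \<Omega>"
  shows "right_triv_tangent N (cay N) \<Omega> B = R * B * mat_adjoint R"
  unfolding right_triv_tangent_def
proof (rule the_equality)
  note c = u_algD(1)[OF \<Omega>] and b = u_algD(1)[OF B] and r = resolvent[OF \<Omega>, folded R_def]
    and ra = resolvent_adjoint[OF \<Omega>, folded R_def]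
  have C: "halfplus N \<Omega> \<in> carrier_mat N N" "mat_adjoint R \<in> carrier_mat N N" "halfminus N \<Omega> \<in> carrier_mat N N"
    using c r by auto
  have RB: "R * B \<in> carrier_mat N N" using r(1) b by simp
  have prod: "R * B * mat_adjoint R * cay N \<Omega> = R * B * R"
  proof -
    have "mat_adjoint R * cay N \<Omega> = (mat_adjoint R * R) * halfplus N \<Omega>"
      unfolding cay_eq(1)[OF \<Omega>, folded R_def] by (rule mult_assoc_sq[symmetric, OF C(2) r(1) C(1)])
    also have "\<dots> = R * (mat_adjoint R * halfplus N \<Omega>)"
      unfolding ra(3)[symmetric] by (rule mult_assoc_sq[OF r(1) C(2) C(1)])
    also have "\<dots> = R" unfolding ra(1) using r(1) by simp
    finally have "mat_adjoint R * cay N \<Omega> = R" .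
    then show ?thesis using mult_assoc_sq[OF RB C(2) cay_eq(2)[OF \<Omega>]] by simp
  qed
  show "R * B * mat_adjoint R \<in> carrier_mat N N \<and>
     (\<forall>A. (\<forall>t. A t \<in> u_alg N) \<and> A 0 = \<Omega> \<and> has_mat_derivative_at_0 N A B \<longrightarrow>
          has_mat_derivative_at_0 N (\<lambda>t. cay N (A t)) (R * B * mat_adjoint R * cay N \<Omega>))"
    unfolding prod using cay_derivative[of _ N \<Omega> B, folded R_def] b mult_carrier_mat[OF RB C(2)] by blast
  fix D assume D: "D \<in> carrier_mat N N \<and>
     (\<forall>A. (\<forall>t. A t \<in> u_alg N) \<and> A 0 = \<Omega> \<and> has_mat_derivative_at_0 N A B \<longrightarrow>
          has_mat_derivative_at_0 N (\<lambda>t. cay N (A t)) (D * cay N \<Omega>))"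
  define A where "A t = \<Omega> + complex_of_real t \<cdot>\<^sub>m B" for t
  have A: "A t \<in> u_alg N" for t
    by (rule u_algI) (use c b u_algD(3)[OF \<Omega>] u_algD(3)[OF B] in \<open>auto simp: A_def\<close>)
  have A0: "A 0 = \<Omega>" using c b by (intro eq_matI) (auto simp: A_def)
  have dA: "has_mat_derivative_at_0 N A B"
    unfolding has_mat_derivative_at_0_def
  proof (intro allI impI)
    fix i j assume ij: "i < N" "j < N"
    have "((\<lambda>t. \<Omega> $$ (i, j) + t *\<^sub>R B $$ (i, j)) has_vector_derivative B $$ (i, j)) (at 0)"
      unfolding has_vector_derivative_def by (auto intro!: derivative_eq_intros)
    then show "((\<lambda>t. A t $$ (i, j)) has_vector_derivative B $$ (i, j)) (at 0)"
      using ij c b by (simp add: A_def scaleR_conv_of_real)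
  qed
  have 1: "has_mat_derivative_at_0 N (\<lambda>t. cay N (A t)) (D * cay N \<Omega>)"
    using D A A0 dA by blast
  have 2: "has_mat_derivative_at_0 N (\<lambda>t. cay N (A t)) (R * B * R)"
    unfolding R_def by (rule cay_derivative[OF A A0 dA b])
  have Dc: "D * cay N \<Omega> = R * B * mat_adjoint R * cay N \<Omega>"
  proof (rule eq_matI)
    fix i j assume "i < dim_row (R * B * mat_adjoint R * cay N \<Omega>)" "j < dim_col (R * B * mat_adjoint R * cay N \<Omega>)"
    then have ij: "i < N" "j < N" using r(1) cay_eq(2)[OF \<Omega>] by auto
    have "((\<lambda>t. cay N (A t) $$ (i, j)) has_derivative (\<lambda>h. h *\<^sub>R (D * cay N \<Omega>) $$ (i, j))) (at 0)"
      "((\<lambda>t. cay N (A t) $$ (i, j)) has_derivative (\<lambda>h. h *\<^sub>R (R * B * R) $$ (i, j))) (at 0)"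
      using 1 2 ij unfolding has_mat_derivative_at_0_def has_vector_derivative_def by blast+
    from fun_cong[OF has_derivative_unique[OF this], of 1]
    show "(D * cay N \<Omega>) $$ (i, j) = (R * B * mat_adjoint R * cay N \<Omega>) $$ (i, j)"
      unfolding prod by (simp only: scaleR_one)
  qed (use D r(1) cay_eq(2)[OF \<Omega>] in auto)
  have cancel: "E = E * cay N \<Omega> * mat_adjoint (cay N \<Omega>)" if "E \<in> carrier_mat N N" for E
    using mult_assoc_sq[OF that cay_eq(2)[OF \<Omega>] adjoint_carrier[OF cay_eq(2)[OF \<Omega>]]] cay_unitary(2)[OF \<Omega>] that by simp
  show "D = R * B * mat_adjoint R"
    using cancel[of D] cancel[OF mult_carrier_mat[OF RB C(2)]] D Dc by simp
qed

theorem right_triv_tangent_inv_cay: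
  assumes \<Omega>: "\<Omega> \<in> u_alg N" and A: "A \<in> u_alg N"
  shows "right_triv_tangent_inv N (cay N) \<Omega> A = halfminus N \<Omega> * A * mat_adjoint (halfminus N \<Omega>)"
proof -
  let ?R = "resolvent N \<Omega>" and ?P = "halfminus N \<Omega>" and ?Q = "halfplus N \<Omega>"
  note c = u_algD(1)[OF \<Omega>] and a = u_algD(1)[OF A] and r = resolvent[OF \<Omega>]
    and ra = resolvent_adjoint[OF \<Omega>]
  have C: "?Q \<in> carrier_mat N N" "mat_adjoint ?R \<in> carrier_mat N N" "?P \<in> carrier_mat N N"
    using c r by auto
  have sandwich: "?P * (?R * B * mat_adjoint ?R) * ?Q = B" if B: "B \<in> carrier_mat N N" for B
  proof -
    have "?P * (?R * B * mat_adjoint ?R) * ?Q = (?P * ?R) * B * (mat_adjoint ?R * ?Q)"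
      using C r(1) B mult_carrier_mat[OF r(1) B] mult_carrier_mat[OF C(2,1)] mult_carrier_mat[OF B C(2)]
        mult_carrier_mat[OF B mult_carrier_mat[OF C(2,1)]]
      by (simp add: mult_assoc_sq[of _ N])
    then show ?thesis unfolding r(2) ra(1) using B by simp
  qed
  have sandwich': "?R * (?P * B * ?Q) * mat_adjoint ?R = B" if B: "B \<in> carrier_mat N N" for B
  proof -
    have "?R * (?P * B * ?Q) * mat_adjoint ?R = (?R * ?P) * B * (?Q * mat_adjoint ?R)"
      using C r(1) B mult_carrier_mat[OF C(3) B] mult_carrier_mat[OF C(1,2)] mult_carrier_mat[OF B C(1)]
        mult_carrier_mat[OF B mult_carrier_mat[OF C(1,2)]]
      by (simp add: mult_assoc_sq[of _ N])
    then show ?thesis unfolding r(3) ra(2) using B by simp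
  qed
  have inj: "inj_on (right_triv_tangent N (cay N) \<Omega>) (u_alg N)"
  proof (rule inj_onI)
    fix B B' assume B: "B \<in> u_alg N" "B' \<in> u_alg N" and eq: "right_triv_tangent N (cay N) \<Omega> B = right_triv_tangent N (cay N) \<Omega> B'"
    have "?R * B * mat_adjoint ?R = ?R * B' * mat_adjoint ?R"
      using eq unfolding right_triv_tangent_cay[OF \<Omega> B(1)] right_triv_tangent_cay[OF \<Omega> B(2)] .
    then have "?P * (?R * B * mat_adjoint ?R) * ?Q = ?P * (?R * B' * mat_adjoint ?R) * ?Q" by (simp only:)
    then show "B = B'" unfolding sandwich[OF u_algD(1)[OF B(1)]] sandwich[OF u_algD(1)[OF B(2)]] .
  qed
  have PAQ: "?P * A * ?Q \<in> u_alg N"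
  proof -
    have PA: "?P * A \<in> carrier_mat N N" using C a by simp
    have "mat_adjoint (?P * A * ?Q) = ?P * (- A * ?Q)"
      using adjoint_mult[OF PA C(1)] adjoint_mult[OF C(3) a] halfminus_adjoint[OF \<Omega>] u_algD(2)[OF A] by simp
    also have "\<dots> = - (?P * A * ?Q)"
      using c C a mult_assoc_sq[OF C(3) a C(1)] by simp
    finally show ?thesis using mult_carrier_mat[OF PA C(1)] by (simp add: u_alg_def)
  qed
  have "right_triv_tangent N (cay N) \<Omega> (?P * A * ?Q) = A"
    unfolding right_triv_tangent_cay[OF \<Omega> PAQ] by (rule sandwich'[OF a])
  then have "right_triv_tangent_inv N (cay N) \<Omega> A = ?P * A * ?Q"
    unfolding right_triv_tangent_inv_def by (rule the_inv_into_f_eq[OF inj _ PAQ])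
  then show ?thesis by (simp add: halfminus_adjoint[OF \<Omega>])
qed

lemma cay_stiefel:
  assumes \<Omega>: "\<Omega> \<in> u_alg N" and U: "U \<in> stiefel r N"
  shows "cay N \<Omega> * U \<in> stiefel r N"
proof -
  note c = cay_eq(2)[OF \<Omega>]
  have u: "U \<in> carrier_mat N r" "mat_adjoint U * U = 1\<^sub>m r" using U by (auto simp: stiefel_def)
  have "mat_adjoint (cay N \<Omega> * U) * (cay N \<Omega> * U) = mat_adjoint U * (mat_adjoint (cay N \<Omega>) * (cay N \<Omega> * U))"
    unfolding adjoint_mult[OF c u(1)]
    by (rule assoc_mult_mat[of _ r N _ N _ r]) (use c u in auto)
  also have "mat_adjoint (cay N \<Omega>) * (cay N \<Omega> * U) = mat_adjoint (cay N \<Omega>) * cay N \<Omega> * U"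
    by (rule assoc_mult_mat[symmetric, of _ N N _ N _ r]) (use c u in auto)
  also have "\<dots> = U" unfolding cay_unitary(1)[OF \<Omega>] using u(1) by simp
  finally show ?thesis using u c by (simp add: stiefel_def)
qed

section \<open>Gauss--Jordan elimination without pivoting\<close>

fun gauss_jordan_step :: "(nat \<Rightarrow> nat \<Rightarrow> complex) \<Rightarrow> nat \<Rightarrow> nat \<Rightarrow> nat \<Rightarrow> complex" where
  "gauss_jordan_step A 0 i j = A i j"
| "gauss_jordan_step A (Suc p) i j =
     (if i = p then gauss_jordan_step A p p j / gauss_jordan_step A p p p
      else gauss_jordan_step A p i j
        - gauss_jordan_step A p i p * (gauss_jordan_step A p p j / gauss_jordan_step A p p p))"

text \<open>No nonzero vector satisfies \<open>v\<^sup>T A v = 0\<close>, with the last \<open>v\<close> conjugated.  All leading principal minors of such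
a matrix are nonzero.\<close>

definition definite :: "nat \<Rightarrow> (nat \<Rightarrow> nat \<Rightarrow> complex) \<Rightarrow> bool" where
  "definite k A \<longleftrightarrow> (\<forall>v. (\<Sum>j<k. (\<Sum>s<k. v s * A s j) * cnj (v j)) = 0 \<longrightarrow> (\<forall>s<k. v s = 0))"

text \<open>Before step \<open>p\<close> the first \<open>p\<close> columns are unit vectors, and row \<open>i \<ge> p\<close> is the original row \<open>i\<close> plus a
combination of the original rows above \<open>p\<close>.  If the pivot vanished, the combination \<open>v\<close> that gives row \<open>p\<close>
would satisfy \<open>(v\<^sup>T A)\<^sub>j = 0\<close> for all \<open>j \<le> p\<close>, while \<open>v\<^sub>j = 0\<close> for \<open>j > p\<close>: this contradicts definiteness.\<close>

lemma gauss_jordan_invariant: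
  assumes def: "definite k A" and "p \<le> k"
  shows "(\<forall>q<p. gauss_jordan_step A q q q \<noteq> 0) \<and>
    (\<forall>i\<in>{p..<k}. \<exists>v. v i = 1 \<and> (\<forall>s. p \<le> s \<and> s \<noteq> i \<longrightarrow> v s = 0) \<and>
        (\<forall>j. gauss_jordan_step A p i j = (\<Sum>s<k. v s * A s j))) \<and>
    (\<forall>i<k. \<forall>j<p. gauss_jordan_step A p i j = (if i = j then 1 else 0))"
  using assms(2)
proof (induction p)
  case 0
  have "\<exists>v. v i = 1 \<and> (\<forall>s. 0 \<le> s \<and> s \<noteq> i \<longrightarrow> v s = 0) \<and> (\<forall>j. gauss_jordan_step A 0 i j = (\<Sum>s<k. v s * A s j))"
    if "i < k" for i
  proof (intro exI[of _ "\<lambda>s. if s = i then 1 else 0"] conjI allI impI)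
    show "gauss_jordan_step A 0 i j = (\<Sum>s<k. (if s = i then 1 else 0) * A s j)" for j
      using that by (simp add: if_distrib[of "\<lambda>x. x * _"] cong: if_cong)
  qed auto
  then show ?case by simp
next
  case (Suc p)
  let ?G = "gauss_jordan_step A"
  have p: "p < k" using Suc.prems by simp
  have IH1: "\<forall>q<p. ?G q q q \<noteq> 0"
    and IH2: "\<forall>i\<in>{p..<k}. \<exists>v. v i = 1 \<and> (\<forall>s. p \<le> s \<and> s \<noteq> i \<longrightarrow> v s = 0) \<and> (\<forall>j. ?G p i j = (\<Sum>s<k. v s * A s j))"
    and IH3: "\<forall>i<k. \<forall>j<p. ?G p i j = (if i = j then 1 else 0)"
    using Suc.IH p by auto
  obtain v where v: "v p = 1" "\<And>s. p \<le> s \<Longrightarrow> s \<noteq> p \<Longrightarrow> v s = 0" "\<And>j. ?G p p j = (\<Sum>s<k. v s * A s j)"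
    using IH2[THEN bspec, of p] p by auto
  have piv: "?G p p p \<noteq> 0"
  proof
    assume z: "?G p p p = 0"
    have "(\<Sum>s<k. v s * A s j) * cnj (v j) = 0" for j
    proof -
      consider "j < p" | "j = p" | "p < j" by linarith
      then show ?thesis
      proof cases
        case 1
        then have "?G p p j = 0" using IH3 p by auto
        then show ?thesis unfolding v(3) by simp
      next
        case 2
        then show ?thesis using z unfolding v(3) by simp
      next
        case 3
        then show ?thesis using v(2)[of j] by simp
      qed
    qed
    then have "(\<Sum>j<k. (\<Sum>s<k. v s * A s j) * cnj (v j)) = 0" by (intro sum.neutral) blast
    then have "v p = 0" using def p unfolding definite_def by blast
    then show False using v(1) by simp
  qed
  have rows: "\<exists>u. u i = 1 \<and> (\<forall>s. Suc p \<le> s \<and> s \<noteq> i \<longrightarrow> u s = 0) \<and> (\<forall>j. ?G (Suc p) i j = (\<Sum>s<k. u s * A s j))"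
    if i: "i \<in> {Suc p..<k}" for i
  proof -
    \<comment> \<open>the new row is the old one minus \<open>f\<close> times row \<open>p\<close>, so the combinations are subtracted accordingly\<close>
    obtain u where u: "u i = 1" "\<And>s. p \<le> s \<Longrightarrow> s \<noteq> i \<Longrightarrow> u s = 0" "\<And>j. ?G p i j = (\<Sum>s<k. u s * A s j)"
      using IH2[THEN bspec, of i] i by auto
    define f where "f = ?G p i p / ?G p p p"
    show ?thesis
    proof (intro exI[of _ "\<lambda>s. u s - f * v s"] conjI allI impI)
      show "u i - f * v i = 1" using u(1) v(2)[of i] i by auto
      fix s assume "Suc p \<le> s \<and> s \<noteq> i"
      then show "u s - f * v s = 0" using u(2)[of s] v(2)[of s] by auto
    next
      fix j
      have "?G (Suc p) i j = ?G p i j - f * ?G p p j" using i by (simp add: f_def)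
      also have "\<dots> = (\<Sum>s<k. (u s - f * v s) * A s j)"
        unfolding u(3) v(3) by (simp add: sum_distrib_left sum_subtractf algebra_simps)
      finally show "?G (Suc p) i j = (\<Sum>s<k. (u s - f * v s) * A s j)" .
    qed
  qed
  have cols: "?G (Suc p) i j = (if i = j then 1 else 0)" if "i < k" "j < Suc p" for i j
  proof (cases "j = p")
    case True
    then show ?thesis using piv by simp
  next
    case False
    then have "j < p" using that by simp
    then have "?G p i j = (if i = j then 1 else 0)" "?G p p j = 0" using IH3 that p by auto
    then show ?thesis using False by auto
  qed
  have "\<forall>q<Suc p. ?G q q q \<noteq> 0" using IH1 piv less_Suc_eq by auto
  then show ?case using rows cols by blast
qed

lemma gauss_jordan_pivot: "definite k A \<Longrightarrow> p < k \<Longrightarrow> gauss_jordan_step A p p p \<noteq> 0"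
  using gauss_jordan_invariant[of k A "Suc p"] by auto

text \<open>Row operations preserve each solution, and after \<open>k\<close> steps the system reads \<open>z = b\<close>.  The right-hand side
is column \<open>b\<close> of the augmented matrix.\<close>

lemma gauss_jordan_solves:
  assumes def: "definite k A" and sol: "\<And>i. i < k \<Longrightarrow> (\<Sum>j<k. A i j * z j) = A i b" and i: "i < k"
  shows "gauss_jordan_step A k i b = z i"
proof -
  let ?G = "gauss_jordan_step A"
  have "(\<Sum>j<k. ?G p i j * z j) = ?G p i b" if "p \<le> k" "i < k" for p i
    using that
  proof (induction p arbitrary: i)
    case (Suc p)
    have pp: "(\<Sum>j<k. ?G p p j / ?G p p p * z j) = ?G p p b / ?G p p p"
      using Suc.IH[of p] Suc.prems by (simp add: sum_divide_distrib flip: Suc.IH[of p])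
    show ?case
    proof (cases "i = p")
      case True
      then show ?thesis using pp by simp
    next
      case False
      have "(\<Sum>j<k. ?G (Suc p) i j * z j)
          = (\<Sum>j<k. ?G p i j * z j) - ?G p i p * (\<Sum>j<k. ?G p p j / ?G p p p * z j)"
        using False by (simp add: left_diff_distrib sum_subtractf sum_distrib_left mult.assoc)
      then show ?thesis using False Suc.IH[of i] Suc.prems unfolding pp by simp
    qed
  qed (use sol in auto)
  from this[of k i] have "?G k i b = (\<Sum>j<k. ?G k i j * z j)" using i by simp
  also have "\<dots> = (\<Sum>j<k. if i = j then z j else 0)"
    using gauss_jordan_invariant[OF def order_refl] i by (intro sum.cong) auto
  also have "\<dots> = z i" using i by simp
  finally show ?thesis .
qed

text \<open>\<open>v\<^sup>T M\<^sup>*M v\<close>, with the last \<open>v\<close> conjugated, is the square of the norm of \<open>M\<close> applied to the conjugate of \<open>v\<close>.\<close>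

lemma normal_equations_definite:
  assumes inj: "\<And>u. (\<And>q. q < k \<Longrightarrow> (\<Sum>j<k. M q j * u j) = 0) \<Longrightarrow> (\<forall>j<k. u j = 0)"
  shows "definite k (\<lambda>i j. \<Sum>q<k. cnj (M q i) * M q j)"
  unfolding definite_def
proof (rule allI, rule impI)
  fix v :: "nat \<Rightarrow> complex"
  define y where "y q = (\<Sum>j<k. M q j * cnj (v j))" for q
  assume z: "(\<Sum>j<k. (\<Sum>s<k. v s * (\<Sum>q<k. cnj (M q s) * M q j)) * cnj (v j)) = 0"
  have "(\<Sum>s<k. v s * (\<Sum>q<k. cnj (M q s) * M q j)) = (\<Sum>q<k. cnj (y q) * M q j)" for j
  proof -
    have "(\<Sum>s<k. v s * (\<Sum>q<k. cnj (M q s) * M q j)) = (\<Sum>s<k. \<Sum>q<k. v s * (cnj (M q s) * M q j))"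
      by (simp only: sum_distrib_left)
    also have "\<dots> = (\<Sum>q<k. \<Sum>s<k. v s * (cnj (M q s) * M q j))" by (rule sum.swap)
    also have "\<dots> = (\<Sum>q<k. cnj (y q) * M q j)"
      by (simp add: y_def sum_distrib_right sum_distrib_left mult_ac)
    finally show ?thesis .
  qed
  then have "(\<Sum>j<k. (\<Sum>s<k. v s * (\<Sum>q<k. cnj (M q s) * M q j)) * cnj (v j))
     = (\<Sum>j<k. \<Sum>q<k. cnj (y q) * M q j * cnj (v j))" by (simp only: sum_distrib_right)
  also have "\<dots> = (\<Sum>q<k. \<Sum>j<k. cnj (y q) * M q j * cnj (v j))" by (rule sum.swap)
  also have "\<dots> = (\<Sum>q<k. cnj (y q) * y q)"
    by (simp add: y_def sum_distrib_left mult.assoc)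
  also have "\<dots> = of_real (\<Sum>q<k. (cmod (y q))\<^sup>2)"
    by (simp add: mult.commute[of "cnj _"] complex_mult_cnj cmod_power2)
  finally have "of_real (\<Sum>q<k. (cmod (y q))\<^sup>2) = (0::complex)" using z by simp
  then have "(\<Sum>q<k. (cmod (y q))\<^sup>2) = 0" by (simp only: of_real_eq_0_iff)
  then have "y q = 0" if "q < k" for q using that by (simp add: sum_nonneg_eq_0_iff)
  then have "\<forall>j<k. cnj (v j) = 0" unfolding y_def by (intro inj) auto
  then show "\<forall>s<k. v s = 0" by simp
qed

section \<open>Costs of elimination and of the inverse Laplacian\<close>

text \<open>Three operations suffice for each entry in each step, even if the quotient by the pivot is recomputed.\<close>

lemma gauss_jordan_cost:
  assumes A: "entries k n A \<subseteq> F" and kn: "k \<le> n" and def: "\<And>w. w \<in> W \<Longrightarrow> definite k (A w)"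
  shows "computes W F (k * (k * n * 3)) (entries k n (\<lambda>w. gauss_jordan_step (A w) k))"
proof -
  have "computes W F (p * (k * n * 3)) (entries k n (\<lambda>w. gauss_jordan_step (A w) p))" if "p \<le> k" for p
    using that
  proof (induction p)
    case 0
    show ?case using A by (auto intro!: computes_held held_mem)
  next
    case (Suc p)
    let ?G = "\<lambda>w. gauss_jordan_step (A w)"
    let ?F = "F \<union> entries k n (\<lambda>w. ?G w p)"
    have p: "p < k" "p < n" using Suc.prems kn by auto
    have "computes W ?F (k * n * 3) (entries k n (\<lambda>w. ?G w (Suc p)))"
    proof (rule computes_entries)
      fix i j assume ij: "i < k" "j < n"
      have e: "computes W ?F 0 {\<lambda>w. ?G w p a b}" if "a < k" "b < n" for a b
        by (rule computes_entry[of k n "\<lambda>w. ?G w p"]) (use that in auto)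
      have q: "computes W ?F (0 + 0 + 1) {\<lambda>w. ?G w p p j / ?G w p p p}"
        by (rule computes_divide[OF e[OF p(1) ij(2)] e[OF p]]) (rule gauss_jordan_pivot[OF def p(1)])
      show "computes W ?F 3 {\<lambda>w. ?G w (Suc p) i j}"
      proof (cases "i = p")
        case True
        then show ?thesis using computes_weaken[OF q, of 3] by simp
      next
        case False
        have "computes W ?F (0 + (0 + (0 + 0 + 1) + 1) + 1) {\<lambda>w. ?G w p i j - ?G w p i p * (?G w p p j / ?G w p p p)}"
          by (intro computes_diff computes_mult q e) (use ij p in auto)
        then show ?thesis using False by (simp add: numeral_3_eq_3)
      qed
    qed
    from computes_then[OF Suc.IH this] Suc.prems show ?case
      by (simp add: add.commute del: gauss_jordan_step.simps)
  qed
  then show ?thesis by blast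
qed

lemma tri_solve_cost:
  fixes d e x :: "nat \<Rightarrow> 'w \<Rightarrow> complex"
  assumes d: "\<And>q. q < n \<Longrightarrow> d q \<in> F" and e: "\<And>q. Suc q < n \<Longrightarrow> e q \<in> F" and x: "\<And>q. q < n \<Longrightarrow> x q \<in> F"
    and piv: "\<And>w q. w \<in> W \<Longrightarrow> q < n \<Longrightarrow> tri_pivot (\<lambda>q. d q w) (\<lambda>q. e q w) q \<noteq> 0"
  shows "computes W F (9 * n) (\<Union>q<n. {\<lambda>w. tri_solve (\<lambda>q. d q w) (\<lambda>q. e q w) (\<lambda>q. x q w) n q})"
proof -
  let ?p = "\<lambda>q w. tri_pivot (\<lambda>q. d q w) (\<lambda>q. e q w) q"
  let ?g = "\<lambda>q w. tri_forward (\<lambda>q. d q w) (\<lambda>q. e q w) (\<lambda>q. x q w) q"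
  let ?b = "\<lambda>k w. tri_back (\<lambda>q. d q w) (\<lambda>q. e q w) (\<lambda>q. x q w) n k"
  let ?PG = "\<Union>q<n. {?p q, ?g q}"
  have 1: "computes W F (n * 6) ?PG"
  proof (rule computes_seq)
    fix q assume q: "q < n"
    let ?F = "F \<union> (\<Union>j<q. {?p j, ?g j})"
    have mem: "computes W ?F 0 {f}" if "f \<in> F" for f using that by (intro computes_mem) auto
    have P: "computes W ?F 3 {?p q}"
    proof (cases q)
      case 0
      then show ?thesis using computes_weaken[OF mem[OF d[OF q]], of 3] by simp
    next
      case (Suc j)
      have "?p j \<in> ?F" using Suc by auto
      then have "computes W ?F (0 + (0 + 0 + 1 + 0 + 1) + 1) {\<lambda>w. d (Suc j) w - e j w * e j w / ?p j w}"
        by (intro computes_diff computes_divide computes_mult mem d e computes_mem) (use q Suc piv in auto)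
      then show ?thesis using Suc by (simp add: numeral_3_eq_3)
    qed
    have "computes W (?F \<union> {?p q}) 3 {?g q}"
    proof (cases q)
      case 0
      have "computes W (?F \<union> {?p 0}) (0 + 0 + 1) {\<lambda>w. x 0 w / ?p 0 w}"
        by (intro computes_divide computes_mem) (use q 0 x piv[of _ 0] in auto)
      then show ?thesis using computes_weaken[of W _ "0 + 0 + 1" _ 3] 0 by simp
    next
      case (Suc j)
      have "?g j \<in> ?F" using Suc by auto
      then have "computes W (?F \<union> {?p q}) (0 + (0 + 0 + 1) + 1 + 0 + 1) {\<lambda>w. (x (Suc j) w - e j w * ?g j w) / ?p (Suc j) w}"
        by (intro computes_divide computes_diff computes_mult computes_mem)
          (use q Suc piv[of _ "Suc j"] x e in \<open>auto simp del: tri_pivot.simps\<close>)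
      then show ?thesis using Suc by (simp add: numeral_3_eq_3)
    qed
    from computes_trans[OF P this] show "computes W ?F 6 {?p q, ?g q}"
      by (simp add: insert_commute)
  qed
  have 2: "computes W (F \<union> ?PG) (n * 3) (\<Union>k<n. {?b k})"
  proof (rule computes_seq)
    fix k assume k: "k < n"
    let ?F = "F \<union> ?PG \<union> (\<Union>j<k. {?b j})"
    have gm: "?g q \<in> ?F" "?p q \<in> ?F" if "q < n" for q using that by auto
    show "computes W ?F 3 {?b k}"
    proof (cases k)
      case 0
      then show ?thesis using computes_weaken[OF computes_mem[OF gm(1)[of "n - 1"]], of 3 W] k by simp
    next
      case (Suc j)
      have q: "n - 2 - j < n" "Suc (n - 2 - j) < n" using k Suc by auto
      have "?b j \<in> ?F" using Suc by auto
      then have "computes W ?F (0 + (0 + 0 + 1 + 0 + 1) + 1) {\<lambda>w. ?g (n - 2 - j) w - e (n - 2 - j) w / ?p (n - 2 - j) w * ?b j w}"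
        by (intro computes_diff computes_mult computes_divide computes_mem gm q(1)) (use q e piv in auto)
      then show ?thesis using Suc by (simp add: numeral_3_eq_3)
    qed
  qed
  have 3: "computes W F (n * 6 + n * 3) (\<Union>k<n. {?b k})" by (rule computes_then[OF 1 2])
  have 4: "(\<Union>q<n. {\<lambda>w. tri_solve (\<lambda>q. d q w) (\<lambda>q. e q w) (\<lambda>q. x q w) n q}) \<subseteq> (\<Union>k<n. {?b k})"
  proof (rule UN_least)
    fix q assume "q \<in> {..<n}"
    then have "n - 1 - q \<in> {..<n}" by auto
    then show "{\<lambda>w. tri_solve (\<lambda>q. d q w) (\<lambda>q. e q w) (\<lambda>q. x q w) n q} \<subseteq> (\<Union>k<n. {?b k})"
      unfolding tri_solve_def by (rule UN_upper)
  qed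
  show ?thesis by (rule computes_weaken[OF computes_subset[OF 3 4]]) simp
qed

lemma poisson_cost:
  fixes x :: "nat \<Rightarrow> 'w \<Rightarrow> complex"
  assumes c: "constants \<subseteq> F" and x: "\<And>q. q < N \<Longrightarrow> x q \<in> F"
  shows "computes W F (N * 3) (\<Union>q<N. {\<lambda>w. poisson N (\<lambda>q. x q w) q})"
proof -
  let ?s = "\<lambda>q w. \<Sum>s<q. x s w" and ?y = "\<lambda>q w. poisson N (\<lambda>q. x q w) q"
  have "computes W F (N * 3) (\<Union>q<N. {?s (Suc q), ?y q})"
  proof (rule computes_seq)
    fix q assume q: "q < N"
    let ?F = "F \<union> (\<Union>j<q. {?s (Suc j), ?y j})"
    have cF: "constants \<subseteq> ?F" using c by auto
    have sq: "computes W ?F 0 {?s q}"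
    proof (cases q)
      case 0
      then show ?thesis using computes_0[OF cF] by simp
    next
      case (Suc j)
      then show ?thesis by (intro computes_mem) auto
    qed
    have S: "computes W ?F (0 + 0 + 1) {\<lambda>w. ?s q w + x q w}"
      by (intro computes_add sq computes_mem) (use x q in auto)
    have Y: "computes W ?F 2 {?y q}"
    proof (cases q)
      case 0
      then show ?thesis using computes_weaken[OF computes_0[OF cF], of 2] by (simp add: poisson_def)
    next
      case (Suc j)
      have m: "computes W ?F 0 {?y j}" "computes W ?F 0 {?s (Suc j)}" using Suc by (auto intro!: computes_mem)
      have "computes W ?F (0 + (0 + 0 + 1) + 1) {\<lambda>w. ?y j w + ?s (Suc j) w / of_nat ((j + 1) * (N - 1 - j))}"
        by (intro computes_add computes_divide m computes_of_nat cF poisson_coeff_nonzero) (use q Suc in auto)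
      then show ?thesis using Suc by (simp add: poisson_def numeral_2_eq_2)
    qed
    have "computes W ?F (1 + 2) ({?s (Suc q)} \<union> {?y q})"
      by (rule computes_trans, use S in simp, rule computes_more_held[OF Y]) auto
    then show "computes W ?F 3 {?s (Suc q), ?y q}" by (simp add: insert_commute numeral_3_eq_3)
  qed
  then show ?thesis by (rule computes_subset) auto
qed

definition lap_inputs :: "nat \<Rightarrow> ('w \<Rightarrow> complex) set" where
  "lap_inputs N = {(\<lambda>w. laplacian_diag N m i j) | m i j. True}"

text \<open>There are at most \<open>2N\<close> off-diagonals, each solved in linear time, and the partial sums on the main diagonal
are accumulated.\<close>

lemma lap_solve_cost:
  fixes X :: "'w \<Rightarrow> nat \<Rightarrow> nat \<Rightarrow> complex"
  assumes N: "0 < N" and c: "constants \<subseteq> F" and L: "lap_inputs N \<subseteq> F" and X: "entries N N X \<subseteq> F"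
  shows "computes W F (30 * N\<^sup>2) (entries N N (\<lambda>w. lap_solve N (X w)))"
proof -
  have Xm: "(\<lambda>w. X w i j) \<in> F" if "i < N" "j < N" for i j using X that by (auto simp: entries_def)
  have Lm: "(\<lambda>w. laplacian_diag N m i j) \<in> F" for m i j using L by (auto simp: lap_inputs_def)
  let ?lo = "\<lambda>m q w. tri_solve (lap_main N m) (lap_off N m) (\<lambda>q. X w (q + m) q) (N - m) q"
  let ?up = "\<lambda>m q w. tri_solve (lap_main N m) (lap_off N m) (\<lambda>q. X w q (q + m)) (N - m) q"
  have lo: "computes W F (9 * N) (\<Union>q<N - Suc m. {?lo (Suc m) q})" if "m < N" for m
    by (rule computes_weaken[OF tri_solve_cost[where d = "\<lambda>q w. lap_main N (Suc m) q" and e = "\<lambda>q w. lap_off N (Suc m) q"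
            and x = "\<lambda>q w. X w (q + Suc m) q"]])
      (use Lm Xm lap_pivot_nonzero in auto)
  have up: "computes W F (9 * N) (\<Union>q<N - Suc m. {?up (Suc m) q})" if "m < N" for m
    by (rule computes_weaken[OF tri_solve_cost[where d = "\<lambda>q w. lap_main N (Suc m) q" and e = "\<lambda>q w. lap_off N (Suc m) q"
            and x = "\<lambda>q w. X w q (q + Suc m)"]])
      (use Lm Xm lap_pivot_nonzero in auto)
  have off: "computes W F (N * (9 * N) + N * (9 * N))
     ((\<Union>m<N. \<Union>q<N - Suc m. {?lo (Suc m) q}) \<union> (\<Union>m<N. \<Union>q<N - Suc m. {?up (Suc m) q}))"
    by (rule computes_trans[OF computes_family[OF lo] computes_more_held[OF computes_family[OF up]]]) auto
  let ?tr = "\<lambda>w. \<Sum>p<N. X w p p"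
  have tr: "computes W F (N * (0 + 1)) {?tr}"
    by (rule computes_sum[OF c computes_mem]) (use Xm in auto)
  let ?x = "\<lambda>q w. trace_free N (X w) q"
  have x: "computes W (F \<union> {?tr}) (N * 2) (\<Union>q<N. {?x q})"
  proof (rule computes_family)
    fix q assume "q < N"
    then have "computes W (F \<union> {?tr}) (0 + (0 + 0 + 1) + 1) {\<lambda>w. X w q q - ?tr w / of_nat N}"
      by (intro computes_diff computes_divide computes_of_nat computes_mem) (use Xm N c in auto)
    then show "computes W (F \<union> {?tr}) 2 {?x q}" by (simp add: trace_free_def numeral_2_eq_2)
  qed
  have x': "computes W F (N * (0 + 1) + N * 2) (\<Union>q<N. {?x q})" by (rule computes_then[OF tr x])
  let ?y = "\<lambda>q w. poisson N (trace_free N (X w)) q"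
  have y: "computes W (F \<union> (\<Union>q<N. {?x q})) (N * 3) (\<Union>q<N. {?y q})"
    using poisson_cost[of "F \<union> (\<Union>q<N. {?x q})" N ?x W] c by auto
  have y': "computes W F (N * (0 + 1) + N * 2 + N * 3) (\<Union>q<N. {?y q})" by (rule computes_then[OF x' y])
  let ?Fy = "F \<union> (\<Union>q<N. {?y q})"
  let ?t = "\<lambda>w. \<Sum>q<N. ?y q w"
  have t: "computes W ?Fy (N * (0 + 1)) {?t}"
    by (rule computes_sum) (use c in \<open>auto intro!: computes_mem\<close>)
  have z: "computes W (?Fy \<union> {?t}) (N * 2) (\<Union>q<N. {\<lambda>w. ?y q w - ?t w / of_nat N})"
  proof (rule computes_family)
    fix q assume "q < N"
    then have "computes W (?Fy \<union> {?t}) (0 + (0 + 0 + 1) + 1) {\<lambda>w. ?y q w - ?t w / of_nat N}"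
      by (intro computes_diff computes_divide computes_of_nat computes_mem) (use N c in auto)
    then show "computes W (?Fy \<union> {?t}) 2 {\<lambda>w. ?y q w - ?t w / of_nat N}"
      by (simp add: numeral_2_eq_2)
  qed
  have diag: "computes W F (N * (0 + 1) + N * 2 + N * 3 + (N * (0 + 1) + N * 2)) (\<Union>q<N. {\<lambda>w. ?y q w - ?t w / of_nat N})"
    by (rule computes_then[OF y' computes_then[OF t z]])
  let ?All = "((\<Union>m<N. \<Union>q<N - Suc m. {?lo (Suc m) q}) \<union> (\<Union>m<N. \<Union>q<N - Suc m. {?up (Suc m) q}))
     \<union> (\<Union>q<N. {\<lambda>w. ?y q w - ?t w / of_nat N})"
  have all: "computes W F (N * (9 * N) + N * (9 * N) + (N * (0 + 1) + N * 2 + N * 3 + (N * (0 + 1) + N * 2))) ?All"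
    by (rule computes_trans[OF off computes_more_held[OF diag]]) auto
  have sub: "entries N N (\<lambda>w. lap_solve N (X w)) \<subseteq> ?All"
  proof
    fix f assume "f \<in> entries N N (\<lambda>w. lap_solve N (X w))"
    then obtain i j where f: "f = (\<lambda>w. lap_solve N (X w) i j)" "i < N" "j < N" by (auto simp: entries_def)
    consider "i = j" | "j < i" | "i < j" by linarith
    then show "f \<in> ?All"
    proof cases
      case 1
      then have "f = (\<lambda>w. ?y i w - ?t w / of_nat N)" unfolding f(1) by (auto simp: lap_solve_def)
      then show ?thesis using f(2) by blast
    next
      case 2
      define m where "m = i - j - 1"
      have m: "i - j = Suc m" "m < N" "j < N - Suc m" using 2 f by (auto simp: m_def)
      have "f = ?lo (Suc m) j" unfolding f(1) using 2 m(1) by (auto simp: lap_solve_def)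
      then show ?thesis using m by blast
    next
      case 3
      define m where "m = j - i - 1"
      have m: "j - i = Suc m" "m < N" "i < N - Suc m" using 3 f by (auto simp: m_def)
      have "f = ?up (Suc m) i" unfolding f(1) using 3 m(1) by (auto simp: lap_solve_def)
      then show ?thesis using m by blast
    qed
  qed
  have "N * (9 * N) + N * (9 * N) + (N * (0 + 1) + N * 2 + N * 3 + (N * (0 + 1) + N * 2)) \<le> 30 * N\<^sup>2"
  proof -
    have "N \<le> N\<^sup>2" using N by (simp add: power2_eq_square)
    then show ?thesis by (simp add: power2_eq_square)
  qed
  then show ?thesis by (rule computes_weaken[OF computes_subset[OF all sub]])
qed

section \<open>The stages in low-rank form\<close>

subsection \<open>The vector field\<close>

definition skew_diagonal :: "nat \<Rightarrow> complex mat \<Rightarrow> bool" where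
  "skew_diagonal r S \<longleftrightarrow> S \<in> carrier_mat r r \<and> (\<forall>i<r. \<forall>j<r. i \<noteq> j \<longrightarrow> S $$ (i, j) = 0)
     \<and> (\<forall>i<r. cnj (S $$ (i, i)) = - S $$ (i, i))"

lemma skew_eigenvalue_imaginary:
  assumes W: "W \<in> u_alg N" and e: "eigenvalue W e"
  shows "cnj e = - e"
proof -
  note c = u_algD(1)[OF W]
  obtain v where v: "v \<in> carrier_vec N" "v \<noteq> 0\<^sub>v N" "W *\<^sub>v v = e \<cdot>\<^sub>v v"
    using e c unfolding eigenvalue_def eigenvector_def by auto
  have row: "(\<Sum>j<N. W $$ (i, j) * v $ j) = e * v $ i" if "i < N" for i
  proof -
    have "(W *\<^sub>v v) $ i = (\<Sum>j<N. W $$ (i, j) * v $ j)"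
      using that c v(1) by (simp add: scalar_prod_def atLeast0LessThan)
    then show ?thesis unfolding v(3) using that v(1) by simp
  qed
  define n where "n = (\<Sum>i<N. (cmod (v $ i))\<^sup>2)"
  define T where "T = (\<Sum>i<N. \<Sum>j<N. W $$ (i, j) * v $ j * cnj (v $ i))"
  have T: "T = e * of_real n"
  proof -
    have "T = (\<Sum>i<N. (\<Sum>j<N. W $$ (i, j) * v $ j) * cnj (v $ i))" unfolding T_def by (simp only: sum_distrib_right)
    also have "\<dots> = (\<Sum>i<N. e * (v $ i * cnj (v $ i)))" by (intro sum.cong) (auto simp: row)
    also have "\<dots> = e * of_real n" by (simp add: n_def complex_mult_cnj cmod_power2 flip: sum_distrib_left)
    finally show ?thesis .
  qed
  have "cnj T = (\<Sum>i<N. \<Sum>j<N. - (W $$ (j, i) * v $ i * cnj (v $ j)))"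
    unfolding T_def cnj_sum by (intro sum.cong refl) (auto simp: u_algD(3)[OF W])
  also have "\<dots> = - T" unfolding T_def sum_negf by (subst sum.swap) simp
  finally have "cnj e * of_real n = - e * of_real n" unfolding T by simp
  moreover have "n \<noteq> 0"
  proof
    assume "n = 0"
    then have "v $ i = 0" if "i < N" for i using that by (simp add: n_def sum_nonneg_eq_0_iff)
    then have "v = 0\<^sub>v N" using v(1) by (intro eq_vecI) auto
    with v(2) show False by simp
  qed
  ultimately have "(cnj e + e) * of_real n = 0" "complex_of_real n \<noteq> 0" by (simp_all add: algebra_simps)
  then show ?thesis by (simp add: eq_neg_iff_add_eq_0)
qed

lemma dominant_eigenvalue_matrix_skew:
  assumes W: "W \<in> su_alg N" and S: "is_dominant_eigenvalue_matrix N r W S"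
  shows "skew_diagonal r S"
proof -
  have Wu: "W \<in> u_alg N" using W by (simp add: su_alg_def)
  obtain es fs where es: "length es = r" "char_poly W = (\<Prod>e\<leftarrow>es @ fs. [:- e, 1:])" "S = mat_diag r (\<lambda>i. es ! i)"
    using S unfolding is_dominant_eigenvalue_matrix_def by blast
  have "cnj (es ! i) = - (es ! i)" if "i < r" for i
  proof (rule skew_eigenvalue_imaginary[OF Wu])
    have "es ! i \<in> set (es @ fs)" using that es(1) by simp
    then have "poly (char_poly W) (es ! i) = 0"
      unfolding es(2) poly_prod_list prod_list_zero_iff by force
    then show "eigenvalue W (es ! i)" using eigenvalue_root_char_poly[OF u_algD(1)[OF Wu]] by simp
  qed
  then show ?thesis unfolding skew_diagonal_def es(3) mat_diag_def by auto
qed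

lemma sandwich_diagonal_at:
  assumes S: "skew_diagonal r S" and U: "U \<in> carrier_mat N r" and nm: "n < N" "m < N"
  shows "(U * S * mat_adjoint U) $$ (n, m) = (\<Sum>c<r. U $$ (n, c) * S $$ (c, c) * cnj (U $$ (m, c)))"
proof -
  have Sc: "S \<in> carrier_mat r r" using S by (simp add: skew_diagonal_def)
  have "(U * S * mat_adjoint U) $$ (n, m) = (\<Sum>c<r. (U * S) $$ (n, c) * mat_adjoint U $$ (c, m))"
    by (rule mult_mat_at) (use U Sc nm in auto)
  also have "\<dots> = (\<Sum>c<r. U $$ (n, c) * S $$ (c, c) * cnj (U $$ (m, c)))"
  proof (rule sum.cong[OF refl])
    fix c assume c: "c \<in> {..<r}"
    have "(U * S) $$ (n, c) = (\<Sum>q<r. U $$ (n, q) * S $$ (q, c))"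
      by (rule mult_mat_at) (use U Sc nm c in auto)
    also have "\<dots> = (\<Sum>q<r. if q = c then U $$ (n, q) * S $$ (q, q) else 0)"
      using S c by (intro sum.cong) (auto simp: skew_diagonal_def)
    also have "\<dots> = U $$ (n, c) * S $$ (c, c)" using c by simp
    finally show "(U * S) $$ (n, c) * mat_adjoint U $$ (c, m) = U $$ (n, c) * S $$ (c, c) * cnj (U $$ (m, c))"
      using adjoint_at[OF U, of c m] c nm by simp
  qed
  finally show ?thesis .
qed

definition overlap :: "nat \<Rightarrow> complex mat \<Rightarrow> complex mat \<Rightarrow> nat \<Rightarrow> nat \<Rightarrow> complex" where
  "overlap N S U c d = (\<Sum>n<N. cnj (field_F N S U $$ (n, c)) * U $$ (n, d))"

context
  fixes N r :: nat and S U :: "complex mat"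
  assumes N: "2 \<le> N" and S: "skew_diagonal r S" and U: "U \<in> stiefel r N"
begin

private lemma Uc: "U \<in> carrier_mat N r"
  using U by (simp add: stiefel_def)

private lemma USU: "U * S * mat_adjoint U \<in> carrier_mat N N"
  using Uc S by (auto simp: skew_diagonal_def intro!: mult_carrier_mat[of _ N r])

private lemma lapc: "laplacian_inv N (U * S * mat_adjoint U) \<in> carrier_mat N N"
  by (rule laplacian_inv_carrier[OF USU]) (use N in simp)

lemma field_F_carrier: "field_F N S U \<in> carrier_mat N r"
  unfolding field_F_def using lapc Uc by simp

lemma field_F_at:
  assumes "n < N" "c < r"
  shows "field_F N S U $$ (n, c) = - inverse (of_real (hbar N)) *
     (\<Sum>m<N. lap_solve N (\<lambda>i j. \<Sum>q<r. U $$ (i, q) * S $$ (q, q) * cnj (U $$ (j, q))) n m * U $$ (m, c))"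
proof -
  have "laplacian_inv N (U * S * mat_adjoint U) $$ (n, m)
      = lap_solve N (\<lambda>i j. \<Sum>q<r. U $$ (i, q) * S $$ (q, q) * cnj (U $$ (j, q))) n m" if "m < N" for m
  proof -
    have eq: "trace_free_mat N (\<lambda>i j. (U * S * mat_adjoint U) $$ (i, j))
      = trace_free_mat N (\<lambda>i j. \<Sum>q<r. U $$ (i, q) * S $$ (q, q) * cnj (U $$ (j, q)))"
      unfolding trace_free_mat_def trace_free_def
      by (rule cong_mat) (auto simp: sandwich_diagonal_at[OF S Uc] simp del: index_mult_mat)
    have N0: "0 < N" using N by simp
    show ?thesis
      unfolding laplacian_inv_eq[OF USU N0]
      by (rule casimir_unique[OF _ _ N0 _ assms(1) that])
        (use casimir_lap_solve[OF N0, of "\<lambda>i j. (U * S * mat_adjoint U) $$ (i, j)"] in \<open>auto simp: eq simp del: index_mult_mat\<close>)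
  qed
  then have "(laplacian_inv N (U * S * mat_adjoint U) * U) $$ (n, c)
    = (\<Sum>m<N. lap_solve N (\<lambda>i j. \<Sum>q<r. U $$ (i, q) * S $$ (q, q) * cnj (U $$ (j, q))) n m * U $$ (m, c))"
    by (subst mult_mat_at[OF lapc Uc assms]) (simp del: index_mult_mat)
  then show ?thesis
    unfolding field_F_def using lapc Uc assms by (simp del: index_mult_mat(1))
qed

text \<open>\<open>F\<^sup>*U\<close> is a real multiple of \<open>U\<^sup>*P U\<close> with \<open>P\<close> skew-Hermitian; this uses that the eigenvalues in \<open>S\<close> are
imaginary.\<close>

lemma overlap_skew:
  assumes cd: "c < r" "d < r"
  shows "cnj (overlap N S U c d) = - overlap N S U d c"
proof -
  let ?P = "laplacian_inv N (U * S * mat_adjoint U)" and ?h = "inverse (of_real (hbar N)) :: complex"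
  have skew: "cnj (?P $$ (i, j)) = - ?P $$ (j, i)" if "i < N" "j < N" for i j
  proof -
    have "?P $$ (j, i) = - cnj (?P $$ (i, j))"
    proof (rule laplacian_inv_skew[OF USU _ _ that])
      fix i j assume ij: "i < N" "j < N"
      have "cnj (\<Sum>c<r. U $$ (i, c) * S $$ (c, c) * cnj (U $$ (j, c))) = - (\<Sum>c<r. U $$ (j, c) * S $$ (c, c) * cnj (U $$ (i, c)))"
        unfolding cnj_sum sum_negf[symmetric] using S by (intro sum.cong) (auto simp: skew_diagonal_def)
      then show "(U * S * mat_adjoint U) $$ (j, i) = - cnj ((U * S * mat_adjoint U) $$ (i, j))"
        unfolding sandwich_diagonal_at[OF S Uc ij] sandwich_diagonal_at[OF S Uc ij(2,1)] by simp
    qed (use N in simp)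
    then show ?thesis by simp
  qed
  have F: "field_F N S U $$ (n, c) = - ?h * (\<Sum>m<N. ?P $$ (n, m) * U $$ (m, c))" if "n < N" "c < r" for n c
    unfolding field_F_def using lapc Uc that mult_mat_at[OF lapc Uc that] by (simp del: index_mult_mat(1))
  have K: "overlap N S U c d = - ?h * (\<Sum>n<N. \<Sum>m<N. cnj (?P $$ (n, m)) * cnj (U $$ (m, c)) * U $$ (n, d))"
    if "c < r" "d < r" for c d
    unfolding overlap_def using that
    by (simp add: F sum_distrib_left sum_distrib_right mult.assoc)
  have "cnj (overlap N S U c d) = - ?h * (\<Sum>n<N. \<Sum>m<N. ?P $$ (n, m) * U $$ (m, c) * cnj (U $$ (n, d)))"
    unfolding K[OF cd] by simp
  also have "(\<Sum>n<N. \<Sum>m<N. ?P $$ (n, m) * U $$ (m, c) * cnj (U $$ (n, d)))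
      = (\<Sum>n<N. \<Sum>m<N. - (cnj (?P $$ (m, n)) * cnj (U $$ (n, d)) * U $$ (m, c)))"
    by (intro sum.cong refl) (auto simp: skew)
  also have "\<dots> = - (\<Sum>m<N. \<Sum>n<N. cnj (?P $$ (m, n)) * cnj (U $$ (n, d)) * U $$ (m, c))"
    unfolding sum_negf by (subst sum.swap) simp
  finally show ?thesis unfolding K[OF cd(2,1)] by simp
qed

lemma field_L_at:
  assumes nm: "n < N" "m < N"
  shows "field_L N S U $$ (n, m) = (\<Sum>c<r. field_F N S U $$ (n, c) * cnj (U $$ (m, c)))
    - (\<Sum>c<r. U $$ (n, c) * cnj (field_F N S U $$ (m, c)))
    + (\<Sum>c<r. \<Sum>d<r. U $$ (n, c) * overlap N S U c d * cnj (U $$ (m, d)))"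
proof -
  let ?F = "field_F N S U" and ?V = "mat_adjoint U"
  note F = field_F_carrier
  have V: "?V \<in> carrier_mat r N" using Uc by simp
  have UV: "U * ?V \<in> carrier_mat N N" and VF: "?V * ?F \<in> carrier_mat r r" using Uc F V by auto
  have "(1\<^sub>m N - U * ?V) * ?F = ?F - U * (?V * ?F)"
    using Uc F V UV by (simp add: minus_mult_distrib_mat[of _ N N _ _ r] assoc_mult_mat[of _ N r _ N _ r])
  then have "(1\<^sub>m N - U * ?V) * ?F * ?V = ?F * ?V - U * (?V * ?F) * ?V"
    using F V mult_carrier_mat[OF Uc VF] by (simp add: minus_mult_distrib_mat[of _ N r _ _ N])
  then have L: "field_L N S U = ?F * ?V - U * (?V * ?F) * ?V - U * mat_adjoint ?F"
    unfolding field_L_def by simp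
  have "cnj (overlap N S U d c) = (\<Sum>k<N. cnj (U $$ (k, c)) * ?F $$ (k, d))" for c d
    unfolding overlap_def by (simp add: mult.commute)
  then have VFat: "(?V * ?F) $$ (c, d) = - overlap N S U c d" if "c < r" "d < r" for c d
    using that overlap_skew[of d c]
    by (subst mult_mat_at[OF V F that]) (simp add: adjoint_at[OF Uc] )
  have A: "(U * (?V * ?F) * ?V) $$ (n, m) = - (\<Sum>c<r. \<Sum>d<r. U $$ (n, c) * overlap N S U c d * cnj (U $$ (m, d)))"
  proof -
    have "(U * (?V * ?F) * ?V) $$ (n, m) = (\<Sum>d<r. (\<Sum>c<r. U $$ (n, c) * (?V * ?F) $$ (c, d)) * ?V $$ (d, m))"
      using nm mult_mat_at[OF Uc VF nm(1)]
      by (subst mult_mat_at[OF mult_carrier_mat[OF Uc VF] V nm]) (simp del: index_mult_mat(1))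
    also have "\<dots> = (\<Sum>d<r. \<Sum>c<r. - (U $$ (n, c) * overlap N S U c d * cnj (U $$ (m, d))))"
      unfolding sum_distrib_right using nm by (intro sum.cong refl) (auto simp: VFat adjoint_at[OF Uc] simp del: index_mult_mat(1))
    also have "\<dots> = (\<Sum>c<r. \<Sum>d<r. - (U $$ (n, c) * overlap N S U c d * cnj (U $$ (m, d))))"
      by (rule sum.swap)
    finally show ?thesis by (simp add: sum_negf)
  qed
  have B: "(?F * ?V) $$ (n, m) = (\<Sum>c<r. ?F $$ (n, c) * cnj (U $$ (m, c)))"
    using nm by (subst mult_mat_at[OF F V nm]) (simp add: adjoint_at[OF Uc])
  have C: "(U * mat_adjoint ?F) $$ (n, m) = (\<Sum>c<r. U $$ (n, c) * cnj (?F $$ (m, c)))"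
    using nm by (subst mult_mat_at[OF Uc adjoint_carrier[OF F] nm]) (simp add: adjoint_at[OF F])
  show ?thesis
    unfolding L using nm A B C F V Uc mult_carrier_mat[OF mult_carrier_mat[OF Uc VF] V]
    by (simp del: index_mult_mat(1))
qed

text \<open>Replacing \<open>U\<^sup>*F\<close> by \<open>- F\<^sup>*U\<close> leaves \<open>U\<close> as the common left factor of all terms except \<open>F U\<^sup>*\<close>.\<close>

lemma field_L_factor:
  assumes nm: "n < N" "m < N"
  shows "field_L N S U $$ (n, m) = (\<Sum>c<r. field_F N S U $$ (n, c) * cnj (U $$ (m, c)))
    + (\<Sum>c<r. U $$ (n, c) * cnj (- (field_F N S U $$ (m, c) + (\<Sum>q<r. U $$ (m, q) * overlap N S U q c))))"
proof -
  have "cnj (- (field_F N S U $$ (m, c) + (\<Sum>q<r. U $$ (m, q) * overlap N S U q c)))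
     = - cnj (field_F N S U $$ (m, c)) + (\<Sum>q<r. overlap N S U c q * cnj (U $$ (m, q)))" if "c < r" for c
    using that by (simp add: overlap_skew sum_negf mult.commute)
  then have "(\<Sum>c<r. U $$ (n, c) * cnj (- (field_F N S U $$ (m, c) + (\<Sum>q<r. U $$ (m, q) * overlap N S U q c))))
    = (\<Sum>c<r. U $$ (n, c) * (- cnj (field_F N S U $$ (m, c)) + (\<Sum>q<r. overlap N S U c q * cnj (U $$ (m, q)))))"
    by (intro sum.cong) auto
  then show ?thesis
    unfolding field_L_at[OF nm]
    by (simp add: distrib_left sum.distrib sum_negf sum_distrib_left mult.assoc right_diff_distrib sum_subtractf)
qed

lemma field_L_u_alg: "field_L N S U \<in> u_alg N"
proof (rule u_algI)
  have "mat_adjoint (field_F N S U) \<in> carrier_mat r N" using field_F_carrier by simp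
  then show "field_L N S U \<in> carrier_mat N N"
    unfolding field_L_def using Uc field_F_carrier
    by (intro minus_carrier_mat mult_carrier_mat[of _ N r]) auto
  fix n m assume nm: "n < N" "m < N"
  have "cnj (\<Sum>c<r. \<Sum>d<r. U $$ (n, c) * overlap N S U c d * cnj (U $$ (m, d)))
    = (\<Sum>c<r. \<Sum>d<r. - (U $$ (m, d) * overlap N S U d c * cnj (U $$ (n, c))))"
    unfolding cnj_sum by (intro sum.cong refl) (auto simp: overlap_skew)
  also have "\<dots> = - (\<Sum>c<r. \<Sum>d<r. U $$ (m, c) * overlap N S U c d * cnj (U $$ (n, d)))"
    unfolding sum_negf by (subst sum.swap) simp
  finally have Z: "cnj (\<Sum>c<r. \<Sum>d<r. U $$ (n, c) * overlap N S U c d * cnj (U $$ (m, d)))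
    = - (\<Sum>c<r. \<Sum>d<r. U $$ (m, c) * overlap N S U c d * cnj (U $$ (n, d)))" .
  show "cnj (field_L N S U $$ (n, m)) = - field_L N S U $$ (m, n)"
    unfolding field_L_at[OF nm] field_L_at[OF nm(2,1)] complex_cnj_add complex_cnj_diff Z
    by (simp add: mult.commute)
qed

end

subsection \<open>The stages of a step\<close>

datatype step_data =
  Step_Data (eigs: "complex mat") (stage_coeffs: "nat \<Rightarrow> nat \<Rightarrow> real") (weights: "nat \<Rightarrow> real")
    (step_size: real) (start: "complex mat")

definition valid_data :: "nat \<Rightarrow> nat \<Rightarrow> step_data \<Rightarrow> bool" where
  "valid_data N r w \<longleftrightarrow> 2 \<le> N \<and> 1 \<le> r \<and> skew_diagonal r (eigs w) \<and> start w \<in> stiefel r N"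

text \<open>The weights serve as the coefficients of a last stage \<open>Ns + 1\<close>, at which the scheme returns its result.\<close>

definition tableau :: "nat \<Rightarrow> step_data \<Rightarrow> nat \<Rightarrow> nat \<Rightarrow> real" where
  "tableau Ns w i j = (if i \<le> Ns then stage_coeffs w i j else weights w j)"

definition stage_Omega :: "nat \<Rightarrow> nat \<Rightarrow> step_data \<Rightarrow> nat \<Rightarrow> complex mat" where
  "stage_Omega N Ns w i = rkmk_Omega N (cay N) (eigs w) (tableau Ns w) (step_size w) (start w) i"

definition stage_U :: "nat \<Rightarrow> nat \<Rightarrow> step_data \<Rightarrow> nat \<Rightarrow> complex mat" where
  "stage_U N Ns w i = rkmk_U N (cay N) (eigs w) (tableau Ns w) (step_size w) (start w) i"

definition stage_F :: "nat \<Rightarrow> nat \<Rightarrow> step_data \<Rightarrow> nat \<Rightarrow> complex mat" where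
  "stage_F N Ns w i = field_F N (eigs w) (stage_U N Ns w i)"

text \<open>The two factors of the field at stage \<open>i\<close>: \<open>\<L> = [F, U] [U, Z]\<^sup>*\<close> with \<open>Z = - (F + U (F\<^sup>*U))\<close>.\<close>

definition stage_X :: "nat \<Rightarrow> nat \<Rightarrow> nat \<Rightarrow> step_data \<Rightarrow> nat \<Rightarrow> nat \<Rightarrow> nat \<Rightarrow> complex" where
  "stage_X N r Ns w i n c = (if c < r then stage_F N Ns w i $$ (n, c) else stage_U N Ns w i $$ (n, c - r))"

definition stage_Y :: "nat \<Rightarrow> nat \<Rightarrow> nat \<Rightarrow> step_data \<Rightarrow> nat \<Rightarrow> nat \<Rightarrow> nat \<Rightarrow> complex" where
  "stage_Y N r Ns w i n c = (if c < r then stage_U N Ns w i $$ (n, c)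
     else - (stage_F N Ns w i $$ (n, c - r) +
        (\<Sum>q<r. stage_U N Ns w i $$ (n, q) * overlap N (eigs w) (stage_U N Ns w i) q (c - r))))"

text \<open>Multiplication by \<open>I - \<Omega>\<^sup>i/2\<close> from the left.\<close>

definition shift :: "nat \<Rightarrow> nat \<Rightarrow> step_data \<Rightarrow> nat \<Rightarrow> (nat \<Rightarrow> nat \<Rightarrow> complex) \<Rightarrow> nat \<Rightarrow> nat \<Rightarrow> complex" where
  "shift N Ns w i X n c = X n c - 1/2 * (\<Sum>k<N. stage_Omega N Ns w i $$ (n, k) * X k c)"

text \<open>The columns of all stages are numbered consecutively from 0; column \<open>p\<close> belongs to stage
\<open>p div (2 * r) + 1\<close>, as stages are numbered from 1.\<close>

definition low_X :: "nat \<Rightarrow> nat \<Rightarrow> nat \<Rightarrow> step_data \<Rightarrow> nat \<Rightarrow> nat \<Rightarrow> complex" where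
  "low_X N r Ns w n p =
     shift N Ns w (Suc (p div (2 * r))) (stage_X N r Ns w (Suc (p div (2 * r)))) n (p mod (2 * r))"

definition low_Y :: "nat \<Rightarrow> nat \<Rightarrow> nat \<Rightarrow> step_data \<Rightarrow> nat \<Rightarrow> nat \<Rightarrow> complex" where
  "low_Y N r Ns w n p =
     shift N Ns w (Suc (p div (2 * r))) (stage_Y N r Ns w (Suc (p div (2 * r)))) n (p mod (2 * r))"

definition low_weight :: "nat \<Rightarrow> nat \<Rightarrow> step_data \<Rightarrow> nat \<Rightarrow> nat \<Rightarrow> complex" where
  "low_weight r Ns w i p = of_real (step_size w) * of_real (tableau Ns w i (Suc (p div (2 * r))))"

definition gram :: "nat \<Rightarrow> nat \<Rightarrow> nat \<Rightarrow> step_data \<Rightarrow> nat \<Rightarrow> nat \<Rightarrow> complex" where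
  "gram N r Ns w p q = (\<Sum>n<N. cnj (low_Y N r Ns w n p) * low_X N r Ns w n q)"

text \<open>The matrix \<open>I - Y\<^sup>*X D\<^sub>i / 2\<close> of the small linear system of stage \<open>i\<close>.\<close>

definition core :: "nat \<Rightarrow> nat \<Rightarrow> nat \<Rightarrow> step_data \<Rightarrow> nat \<Rightarrow> nat \<Rightarrow> nat \<Rightarrow> complex" where
  "core N r Ns w i p q = (if p = q then 1 else 0) - 1/2 * (gram N r Ns w p q * low_weight r Ns w i q)"

lemma rkmk_Omega_coeffs_cong:
  assumes "\<And>k j. k \<le> i \<Longrightarrow> a k j = a' k j"
  shows "rkmk_Omega N \<Psi> S a dt U i = rkmk_Omega N \<Psi> S a' dt U i"
  using assms
proof (induction i rule: less_induct)
  case (less i)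
  show ?case
  proof (cases "i \<le> 1")
    case False
    have "rkmk_Omega N \<Psi> S a dt U j = rkmk_Omega N \<Psi> S a' dt U j" if "j \<in> {1..<i}" for j
      using less.IH[of j] less.prems that by auto
    then show ?thesis
      using less.prems[of i] False
      by (subst (1 2) rkmk_Omega.simps) (auto intro!: cong_mat sum.cong)
  qed (simp add: rkmk_Omega.simps)
qed

lemma rkmk_step_eq_stage:
  assumes "1 \<le> Ns"
  shows "rkmk_step N Ns (cay N) S a b dt U = stage_U N Ns (Step_Data S a b dt U) (Suc Ns)"
proof -
  let ?w = "Step_Data S a b dt U"
  have eq: "rkmk_Omega N (cay N) S a dt U i = rkmk_Omega N (cay N) S (tableau Ns ?w) dt U i" if "i \<le> Ns" for i
    using that by (intro rkmk_Omega_coeffs_cong) (simp add: tableau_def)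
  have "rkmk_Omega N (cay N) S (tableau Ns ?w) dt U (Suc Ns) =
    mat N N (\<lambda>pq. complex_of_real dt * (\<Sum>i\<in>{1..Ns}. complex_of_real (b i) *
          right_triv_tangent_inv N (cay N) (rkmk_Omega N (cay N) S a dt U i)
            (field_L N S (rkmk_U N (cay N) S a dt U i)) $$ pq))"
    using assms
    by (subst rkmk_Omega.simps)
      (auto simp: rkmk_U_def tableau_def[of Ns _ "Suc Ns"] eq atLeastLessThanSuc_atLeastAtMost intro!: cong_mat sum.cong)
  then show ?thesis
    using assms unfolding rkmk_step_def stage_U_def rkmk_U_def by simp
qed

locale rkmk_data =
  fixes N r Ns :: nat and w :: step_data
  assumes valid: "valid_data N r w"
begin

lemma N: "2 \<le> N" and r: "1 \<le> r" and S: "skew_diagonal r (eigs w)" and U: "start w \<in> stiefel r N"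
  using valid by (auto simp: valid_data_def)

abbreviation "\<Omega> \<equiv> stage_Omega N Ns w"
abbreviation "V \<equiv> stage_U N Ns w"
abbreviation "X \<equiv> stage_X N r Ns w"
abbreviation "Y \<equiv> stage_Y N r Ns w"
abbreviation "XX \<equiv> low_X N r Ns w"
abbreviation "YY \<equiv> low_Y N r Ns w"
abbreviation "wt \<equiv> low_weight r Ns w"

definition slope :: "nat \<Rightarrow> complex mat" where
  "slope i = right_triv_tangent_inv N (cay N) (\<Omega> i) (field_L N (eigs w) (V i))"

lemma Omega_rec: "\<Omega> i = (if i \<le> 1 then 0\<^sub>m N N else
   mat N N (\<lambda>pq. complex_of_real (step_size w) * (\<Sum>j\<in>{1..<i}. complex_of_real (tableau Ns w i j) * slope j $$ pq)))"
  unfolding stage_Omega_def slope_def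
  by (subst rkmk_Omega.simps) (auto simp: stage_U_def stage_Omega_def rkmk_U_def intro!: cong_mat sum.cong)

lemma V_rec: "V i = (if i = 1 then start w else cay N (\<Omega> i) * start w)"
  by (simp add: stage_U_def rkmk_U_def stage_Omega_def)

lemma slope_eq:
  assumes "\<Omega> i \<in> u_alg N" "V i \<in> stiefel r N"
  shows "slope i = halfminus N (\<Omega> i) * field_L N (eigs w) (V i) * mat_adjoint (halfminus N (\<Omega> i))"
  unfolding slope_def by (rule right_triv_tangent_inv_cay[OF assms(1) field_L_u_alg[OF N S assms(2)]])

lemma slope_u_alg:
  assumes "\<Omega> i \<in> u_alg N" "V i \<in> stiefel r N"
  shows "slope i \<in> u_alg N"
proof -
  let ?P = "halfminus N (\<Omega> i)" and ?L = "field_L N (eigs w) (V i)"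
  note L = field_L_u_alg[OF N S assms(2)]
  have P: "?P \<in> carrier_mat N N" using u_algD(1)[OF assms(1)] by simp
  note Lc = u_algD(1)[OF L]
  have PL: "?P * ?L \<in> carrier_mat N N" using P Lc by simp
  have "mat_adjoint (?P * ?L * mat_adjoint ?P) = ?P * (- ?L * mat_adjoint ?P)"
    using adjoint_mult[OF PL adjoint_carrier[OF P]] adjoint_mult[OF P Lc] u_algD(2)[OF L] adjoint_adjoint[OF P] by simp
  also have "\<dots> = - (?P * (?L * mat_adjoint ?P))"
    using carrier_matD[OF P] carrier_matD[OF Lc] by (simp del: index_minus_mat)
  also have "\<dots> = - (?P * ?L * mat_adjoint ?P)"
    unfolding mult_assoc_sq[OF P Lc adjoint_carrier[OF P]] ..
  finally show ?thesis
    unfolding slope_eq[OF assms] using mult_carrier_mat[OF PL adjoint_carrier[OF P]] by (simp add: u_alg_def)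
qed

text \<open>The slopes are skew-Hermitian as congruences of \<open>\<L>\<close>, hence so is every \<open>\<Omega>\<^sup>i\<close>; its Cayley transform is
unitary and keeps \<open>U\<close> on the Stiefel manifold.\<close>

lemma stages_valid:
  assumes "1 \<le> i"
  shows "\<Omega> i \<in> u_alg N \<and> V i \<in> stiefel r N"
  using assms
proof (induction i rule: less_induct)
  case (less i)
  have "\<Omega> i \<in> u_alg N"
  proof (cases "i \<le> 1")
    case True
    then show ?thesis by (auto simp: Omega_rec[of i] intro!: u_algI)
  next
    case False
    have "slope j \<in> u_alg N" if "j \<in> {1..<i}" for j
      using less.IH[of j] that slope_u_alg by auto
    then have s: "cnj (slope j $$ (n, m)) = - slope j $$ (m, n)" if "j \<in> {1..<i}" "n < N" "m < N" for j n m
      using that u_algD(3) by blast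
    show ?thesis
    proof (rule u_algI)
      show "\<Omega> i \<in> carrier_mat N N" by (simp add: Omega_rec[of i])
      fix n m assume nm: "n < N" "m < N"
      have "(\<Sum>j\<in>{1..<i}. complex_of_real (tableau Ns w i j) * cnj (slope j $$ (n, m)))
          = (\<Sum>j\<in>{1..<i}. - (complex_of_real (tableau Ns w i j) * slope j $$ (m, n)))"
        using nm by (intro sum.cong) (auto simp: s)
      then show "cnj (\<Omega> i $$ (n, m)) = - \<Omega> i $$ (m, n)"
        using nm False by (simp add: Omega_rec[of i] sum_negf)
    qed
  qed
  then show ?case using U cay_stiefel[of "\<Omega> i" N "start w" r] by (simp add: V_rec)
qed

lemma slope_factor:
  assumes i: "1 \<le> i" and nm: "n < N" "m < N"
  shows "slope i $$ (n, m) = (\<Sum>c<2 * r. shift N Ns w i (X i) n c * cnj (shift N Ns w i (Y i) m c))"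
proof -
  have O: "\<Omega> i \<in> u_alg N" and Vi: "V i \<in> stiefel r N" using stages_valid[OF i] by auto
  let ?P = "halfminus N (\<Omega> i)" and ?L = "field_L N (eigs w) (V i)"
  have Oc: "\<Omega> i \<in> carrier_mat N N" by (rule u_algD(1)[OF O])
  have P: "?P \<in> carrier_mat N N" using Oc by simp
  have Lc: "?L \<in> carrier_mat N N" by (rule u_algD(1)[OF field_L_u_alg[OF N S Vi]])
  have L: "?L $$ (k, l) = (\<Sum>c<2 * r. X i k c * cnj (Y i l c))" if "k < N" "l < N" for k l
  proof -
    have "(\<Sum>c<2 * r. X i k c * cnj (Y i l c))
      = (\<Sum>c<r. X i k c * cnj (Y i l c)) + (\<Sum>c<r. X i k (r + c) * cnj (Y i l (r + c)))"
    proof -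
      have "{..<2 * r} = {..<r} \<union> {r..<2 * r}" by auto
      moreover have "(\<Sum>c\<in>{r..<2 * r}. X i k c * cnj (Y i l c)) = (\<Sum>c<r. X i k (r + c) * cnj (Y i l (r + c)))"
        by (rule sum.reindex_bij_witness[of _ "\<lambda>c. r + c" "\<lambda>c. c - r"]) auto
      ultimately show ?thesis by (simp add: sum.union_disjoint ivl_disj_int)
    qed
    then show ?thesis
      unfolding field_L_factor[OF N S Vi that] by (simp add: stage_X_def stage_Y_def stage_F_def)
  qed
  have sh: "shift N Ns w i Z k c = (\<Sum>l<N. ?P $$ (k, l) * Z l c)" if "k < N" for Z k c
  proof -
    have "(\<Sum>l<N. ?P $$ (k, l) * Z l c) = (\<Sum>l<N. (if k = l then Z l c else 0) - 1/2 * (\<Omega> i $$ (k, l) * Z l c))"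
      using that Oc by (intro sum.cong) (auto simp: algebra_simps)
    also have "\<dots> = Z k c - 1/2 * (\<Sum>l<N. \<Omega> i $$ (k, l) * Z l c)"
      using that by (simp add: sum_subtractf sum_distrib_left)
    finally show ?thesis by (simp add: shift_def)
  qed
  have "slope i $$ (n, m) = (\<Sum>k<N. \<Sum>l<N. ?P $$ (n, k) * ?L $$ (k, l) * mat_adjoint ?P $$ (l, m))"
    unfolding slope_eq[OF O Vi] by (rule triple_mult_at[OF P Lc adjoint_carrier[OF P] nm])
  also have "\<dots> = (\<Sum>k<N. \<Sum>l<N. \<Sum>c<2 * r. (?P $$ (n, k) * X i k c) * cnj (?P $$ (m, l) * Y i l c))"
    using nm by (intro sum.cong refl) (auto simp: L adjoint_at[OF P] sum_distrib_left sum_distrib_right mult_ac)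
  also have "\<dots> = (\<Sum>k<N. \<Sum>c<2 * r. \<Sum>l<N. (?P $$ (n, k) * X i k c) * cnj (?P $$ (m, l) * Y i l c))"
    by (intro sum.cong refl sum.swap)
  also have "\<dots> = (\<Sum>c<2 * r. \<Sum>k<N. \<Sum>l<N. (?P $$ (n, k) * X i k c) * cnj (?P $$ (m, l) * Y i l c))"
    by (rule sum.swap)
  also have "\<dots> = (\<Sum>c<2 * r. shift N Ns w i (X i) n c * cnj (shift N Ns w i (Y i) m c))"
    unfolding sh[OF nm(1)] sh[OF nm(2)] cnj_sum sum_product ..
  finally show ?thesis .
qed

lemma Omega_low_rank:
  assumes i: "1 \<le> i" and nm: "n < N" "m < N"
  shows "\<Omega> i $$ (n, m) = (\<Sum>p<(i - 1) * (2 * r). wt i p * XX n p * cnj (YY m p))"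
proof (cases "i \<le> 1")
  case True
  then show ?thesis using nm by (simp add: Omega_rec[of i])
next
  case False
  let ?k = "2 * r"
  have k: "0 < ?k" using r by simp
  let ?g = "\<lambda>p. wt i p * XX n p * cnj (YY m p)"
  have "\<Omega> i $$ (n, m) = of_real (step_size w) * (\<Sum>j\<in>{1..<i}. of_real (tableau Ns w i j) * slope j $$ (n, m))"
    using False nm by (simp add: Omega_rec[of i])
  also have "(\<Sum>j\<in>{1..<i}. complex_of_real (tableau Ns w i j) * slope j $$ (n, m))
     = (\<Sum>b<i - 1. of_real (tableau Ns w i (Suc b)) * slope (Suc b) $$ (n, m))"
    by (rule sum.reindex_bij_witness[of _ Suc "\<lambda>j. j - 1"]) auto
  also have "of_real (step_size w) * \<dots> = (\<Sum>b<i - 1. \<Sum>c<?k. ?g (b * ?k + c))"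
    unfolding sum_distrib_left
  proof (rule sum.cong[OF refl])
    fix b
    have "of_real (step_size w) * (of_real (tableau Ns w i (Suc b)) * slope (Suc b) $$ (n, m))
      = (\<Sum>c<?k. of_real (step_size w) * of_real (tableau Ns w i (Suc b))
           * (shift N Ns w (Suc b) (X (Suc b)) n c * cnj (shift N Ns w (Suc b) (Y (Suc b)) m c)))"
      by (simp add: slope_factor nm sum_distrib_left mult.assoc)
    also have "\<dots> = (\<Sum>c<?k. ?g (b * ?k + c))"
    proof (rule sum.cong[OF refl])
      fix c assume "c \<in> {..<?k}"
      then have "(b * ?k + c) div ?k = b" "(b * ?k + c) mod ?k = c" using k by auto
      then show "of_real (step_size w) * of_real (tableau Ns w i (Suc b))
           * (shift N Ns w (Suc b) (X (Suc b)) n c * cnj (shift N Ns w (Suc b) (Y (Suc b)) m c)) = ?g (b * ?k + c)"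
        unfolding low_weight_def low_X_def low_Y_def by (simp only: mult.assoc)
    qed
    finally show "of_real (step_size w) * (of_real (tableau Ns w i (Suc b)) * slope (Suc b) $$ (n, m))
      = (\<Sum>c<?k. ?g (b * ?k + c))" .
  qed
  also have "\<dots> = (\<Sum>b<i - 1. sum ?g {b * ?k..<b * ?k + ?k})"
  proof (rule sum.cong[OF refl])
    fix b
    show "(\<Sum>c<?k. ?g (b * ?k + c)) = sum ?g {b * ?k..<b * ?k + ?k}"
      by (rule sum.reindex_bij_witness[of _ "\<lambda>p. p - b * ?k" "\<lambda>c. b * ?k + c"]) auto
  qed
  also have "\<dots> = sum ?g {..<(i - 1) * ?k}" by (rule sum.nat_group)
  finally show ?thesis .
qed

lemma shift_low_rank:
  assumes i: "1 \<le> i" and n: "n < N"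
  shows "shift N Ns w i Z n c = Z n c
     - 1/2 * (\<Sum>q<(i - 1) * (2 * r). XX n q * (wt i q * (\<Sum>m<N. cnj (YY m q) * Z m c)))"
proof -
  have "(\<Sum>k<N. \<Omega> i $$ (n, k) * Z k c) = (\<Sum>k<N. \<Sum>q<(i - 1) * (2 * r). wt i q * XX n q * cnj (YY k q) * Z k c)"
    using n by (intro sum.cong refl) (auto simp: Omega_low_rank[OF i] sum_distrib_right)
  also have "\<dots> = (\<Sum>q<(i - 1) * (2 * r). \<Sum>k<N. wt i q * XX n q * cnj (YY k q) * Z k c)"
    by (rule sum.swap)
  finally show ?thesis by (simp add: shift_def sum_distrib_left mult_ac)
qed

text \<open>If \<open>u = Y\<^sup>*X D u / 2\<close>, then \<open>v = X D u\<close> satisfies \<open>v = \<Omega> v / 2\<close>, so \<open>v = 0\<close> by \<open>skew_fixed_vector\<close>, and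
\<open>u = Y\<^sup>*v / 2 = 0\<close>.\<close>

lemma core_injective:
  assumes i: "1 \<le> i"
  defines "k \<equiv> (i - 1) * (2 * r)"
  assumes z: "\<And>p. p < k \<Longrightarrow> (\<Sum>q<k. core N r Ns w i p q * u q) = 0" and p: "p < k"
  shows "u p = 0"
proof -
  define v where "v n = (\<Sum>q<k. XX n q * (wt i q * u q))" for n
  have u: "u p = 1/2 * (\<Sum>n<N. cnj (YY n p) * v n)" if "p < k" for p
  proof -
    have "(\<Sum>q<k. core N r Ns w i p q * u q)
      = (\<Sum>q<k. (if p = q then u q else 0) - 1/2 * (gram N r Ns w p q * (wt i q * u q)))"
      unfolding core_def by (intro sum.cong) (auto simp: algebra_simps)
    also have "\<dots> = u p - 1/2 * (\<Sum>q<k. gram N r Ns w p q * (wt i q * u q))"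
      using that by (simp add: sum_subtractf sum_distrib_left)
    finally have "u p = 1/2 * (\<Sum>q<k. gram N r Ns w p q * (wt i q * u q))" unfolding z[OF that] by simp
    also have "(\<Sum>q<k. gram N r Ns w p q * (wt i q * u q)) = (\<Sum>q<k. \<Sum>n<N. cnj (YY n p) * XX n q * (wt i q * u q))"
      unfolding gram_def sum_distrib_right ..
    also have "\<dots> = (\<Sum>n<N. \<Sum>q<k. cnj (YY n p) * XX n q * (wt i q * u q))" by (rule sum.swap)
    also have "\<dots> = (\<Sum>n<N. cnj (YY n p) * v n)" unfolding v_def sum_distrib_left by (simp only: mult.assoc)
    finally show ?thesis .
  qed
  have "v n = 0" if n: "n < N" for n
  proof (rule skew_fixed_vector[OF conjunct1[OF stages_valid[OF i]] _ n])
    fix n assume n: "n < N"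
    have "(\<Sum>j<N. \<Omega> i $$ (n, j) * v j) = (\<Sum>j<N. \<Sum>p<k. wt i p * XX n p * cnj (YY j p) * v j)"
      using n unfolding k_def by (intro sum.cong refl) (auto simp: Omega_low_rank[OF i] sum_distrib_right)
    also have "\<dots> = (\<Sum>p<k. \<Sum>j<N. wt i p * XX n p * cnj (YY j p) * v j)" by (rule sum.swap)
    also have "\<dots> = (\<Sum>p<k. XX n p * (wt i p * (\<Sum>j<N. cnj (YY j p) * v j)))"
      by (simp add: sum_distrib_left mult_ac)
    also have "\<dots> = (\<Sum>p<k. XX n p * (wt i p * (2 * u p)))"
    proof (rule sum.cong[OF refl])
      fix p assume "p \<in> {..<k}"
      then have "(\<Sum>j<N. cnj (YY j p) * v j) = 2 * u p" using u[of p] by (simp add: mult.commute)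
      then show "XX n p * (wt i p * (\<Sum>j<N. cnj (YY j p) * v j)) = XX n p * (wt i p * (2 * u p))" by (simp only:)
    qed
    also have "\<dots> = 2 * v n" unfolding v_def by (simp add: sum_distrib_left mult_ac)
    finally show "v n = 1/2 * (\<Sum>j<N. \<Omega> i $$ (n, j) * v j)" by simp
  qed
  then show ?thesis using u[OF p] by simp
qed

text \<open>Take \<open>c = Y\<^sup>*V\<close> with \<open>V = (I - \<Omega>/2)\<^sup>-\<^sup>1 U\<close>.  Then \<open>cay(\<Omega>) U = 2V - U = U + \<Omega> V = U + X D c\<close>, and multiplying
\<open>U = V - \<Omega> V / 2\<close> by \<open>Y\<^sup>*\<close> gives the linear system for \<open>c\<close>.\<close>

lemma stage_U_low_rank:
  assumes i: "1 \<le> i"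
  defines "k \<equiv> (i - 1) * (2 * r)"
  shows "\<exists>c. (\<forall>p<k. \<forall>q<r. (\<Sum>s<k. core N r Ns w i p s * c s q) = (\<Sum>n<N. cnj (YY n p) * start w $$ (n, q)))
     \<and> (\<forall>n<N. \<forall>q<r. V i $$ (n, q) = start w $$ (n, q) + (\<Sum>p<k. XX n p * (wt i p * c p q)))"
proof (cases "i = 1")
  case True
  then show ?thesis by (simp add: V_rec k_def)
next
  case False
  have O: "\<Omega> i \<in> u_alg N" using stages_valid[OF i] by simp
  note Oc = u_algD(1)[OF O] and R = resolvent[OF O]
  let ?R = "resolvent N (\<Omega> i)"
  have Uc: "start w \<in> carrier_mat N r" using U by (simp add: stiefel_def)
  define Z where "Z = ?R * start w"
  have Zc: "Z \<in> carrier_mat N r" using R(1) Uc by (simp add: Z_def)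
  have PZ: "halfminus N (\<Omega> i) * Z = start w"
    unfolding Z_def using assoc_mult_mat[of "halfminus N (\<Omega> i)" N N ?R N "start w" r] Oc R Uc by simp
  define c where "c p q = (\<Sum>n<N. cnj (YY n p) * Z $$ (n, q))" for p q
  have OZ: "(\<Sum>j<N. \<Omega> i $$ (n, j) * Z $$ (j, q)) = (\<Sum>p<k. XX n p * (wt i p * c p q))" if "n < N" for n q
  proof -
    have "(\<Sum>j<N. \<Omega> i $$ (n, j) * Z $$ (j, q)) = (\<Sum>j<N. \<Sum>p<k. wt i p * XX n p * cnj (YY j p) * Z $$ (j, q))"
      using that unfolding k_def by (intro sum.cong refl) (auto simp: Omega_low_rank[OF i] sum_distrib_right)
    also have "\<dots> = (\<Sum>p<k. \<Sum>j<N. wt i p * XX n p * cnj (YY j p) * Z $$ (j, q))" by (rule sum.swap)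
    finally show ?thesis by (simp add: c_def sum_distrib_left mult_ac)
  qed
  have Zeq: "Z $$ (n, q) = start w $$ (n, q) + 1/2 * (\<Sum>j<N. \<Omega> i $$ (n, j) * Z $$ (j, q))" if nq: "n < N" "q < r" for n q
  proof -
    have "start w $$ (n, q) = (\<Sum>j<N. halfminus N (\<Omega> i) $$ (n, j) * Z $$ (j, q))"
      unfolding PZ[symmetric] by (rule mult_mat_at[OF half_carrier(1)[OF Oc] Zc nq])
    also have "\<dots> = (\<Sum>j<N. (if n = j then Z $$ (j, q) else 0) - 1/2 * (\<Omega> i $$ (n, j) * Z $$ (j, q)))"
      using nq Oc by (intro sum.cong) (auto simp: algebra_simps)
    also have "\<dots> = Z $$ (n, q) - 1/2 * (\<Sum>j<N. \<Omega> i $$ (n, j) * Z $$ (j, q))"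
      using nq by (simp add: sum_subtractf sum_distrib_left)
    finally show ?thesis by simp
  qed
  have sys: "(\<Sum>s<k. core N r Ns w i p s * c s q) = (\<Sum>n<N. cnj (YY n p) * start w $$ (n, q))"
    if pq: "p < k" "q < r" for p q
  proof -
    have "(\<Sum>s<k. core N r Ns w i p s * c s q)
      = (\<Sum>s<k. (if p = s then c s q else 0) - 1/2 * (gram N r Ns w p s * (wt i s * c s q)))"
      unfolding core_def by (intro sum.cong) (auto simp: algebra_simps)
    also have "\<dots> = c p q - 1/2 * (\<Sum>s<k. gram N r Ns w p s * (wt i s * c s q))"
      using pq by (simp add: sum_subtractf sum_distrib_left)
    also have "(\<Sum>s<k. gram N r Ns w p s * (wt i s * c s q)) = (\<Sum>s<k. \<Sum>n<N. cnj (YY n p) * XX n s * (wt i s * c s q))"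
      unfolding gram_def sum_distrib_right ..
    also have "\<dots> = (\<Sum>n<N. \<Sum>s<k. cnj (YY n p) * XX n s * (wt i s * c s q))" by (rule sum.swap)
    also have "\<dots> = (\<Sum>n<N. cnj (YY n p) * (\<Sum>j<N. \<Omega> i $$ (n, j) * Z $$ (j, q)))"
      by (intro sum.cong refl) (auto simp: OZ sum_distrib_left mult.assoc)
    also have "c p q - 1/2 * \<dots> = (\<Sum>n<N. cnj (YY n p) * (Z $$ (n, q) - 1/2 * (\<Sum>j<N. \<Omega> i $$ (n, j) * Z $$ (j, q))))"
    proof -
      have gen: "(\<Sum>n<N. f n) - 1/2 * (\<Sum>n<N. g n) = (\<Sum>n<N. f n - 1/2 * g n)" for f g :: "nat \<Rightarrow> complex"
        by (simp add: sum_subtractf sum_distrib_left)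
      show ?thesis unfolding c_def gen by (intro sum.cong refl) (simp add: algebra_simps)
    qed
    also have "\<dots> = (\<Sum>n<N. cnj (YY n p) * start w $$ (n, q))"
    proof (rule sum.cong[OF refl])
      fix n assume "n \<in> {..<N}"
      then have "Z $$ (n, q) - 1/2 * (\<Sum>j<N. \<Omega> i $$ (n, j) * Z $$ (j, q)) = start w $$ (n, q)"
        using Zeq[of n q] pq by (simp only: lessThan_iff add_diff_cancel_right')
      then show "cnj (YY n p) * (Z $$ (n, q) - 1/2 * (\<Sum>j<N. \<Omega> i $$ (n, j) * Z $$ (j, q))) = cnj (YY n p) * start w $$ (n, q)"
        by (simp only:)
    qed
    finally show ?thesis .
  qed
  have Vi: "V i $$ (n, q) = start w $$ (n, q) + (\<Sum>p<k. XX n p * (wt i p * c p q))" if nq: "n < N" "q < r" for n q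
  proof -
    have "V i = (2 \<cdot>\<^sub>m ?R - 1\<^sub>m N) * start w" using False by (simp add: V_rec cay_eq(3)[OF O])
    also have "\<dots> = 2 \<cdot>\<^sub>m Z - start w"
      unfolding Z_def using R(1) Uc
      by (simp add: minus_mult_distrib_mat[of _ N N _ _ r] mult_smult_assoc_mat[of _ N N _ r])
    finally have "V i $$ (n, q) = 2 * Z $$ (n, q) - start w $$ (n, q)" using nq Zc Uc by simp
    then show ?thesis using Zeq[OF nq] OZ[OF nq(1), of q] by simp
  qed
  show ?thesis using sys Vi by blast
qed

end

section \<open>The cost of a Runge--Kutta Munthe-Kaas step\<close>

definition step_env :: "nat \<Rightarrow> step_data \<Rightarrow> rkmk_input \<Rightarrow> complex" where
  "step_env N w = rkmk_env N (eigs w) (stage_coeffs w) (weights w) (step_size w) (start w)"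

definition step_inputs :: "nat \<Rightarrow> (step_data \<Rightarrow> complex) set" where
  "step_inputs N = range (\<lambda>v w. step_env N w v) \<union> constants"

lemma step_inputs_mem:
  "(\<lambda>w. start w $$ (n, q)) \<in> step_inputs N"
  "(\<lambda>w. eigs w $$ (q, q)) \<in> step_inputs N"
  "(\<lambda>w. complex_of_real (step_size w)) \<in> step_inputs N"
  "(\<lambda>w. complex_of_real (hbar N)) \<in> step_inputs N"
  "(\<lambda>w. complex_of_real (tableau Ns w i j)) \<in> step_inputs N"
  "lap_inputs N \<subseteq> step_inputs N"
  "constants \<subseteq> step_inputs N"
proof -
  have e: "f \<in> step_inputs N" if "f = (\<lambda>w. step_env N w v)" for f v
    unfolding step_inputs_def that by blast
  show "(\<lambda>w. start w $$ (n, q)) \<in> step_inputs N" by (rule e[of _ "In_U n q"]) (simp add: step_env_def)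
  show "(\<lambda>w. eigs w $$ (q, q)) \<in> step_inputs N" by (rule e[of _ "In_S q"]) (simp add: step_env_def)
  show "(\<lambda>w. complex_of_real (step_size w)) \<in> step_inputs N" by (rule e[of _ In_dt]) (simp add: step_env_def)
  show "(\<lambda>w. complex_of_real (hbar N)) \<in> step_inputs N" by (rule e[of _ In_hbar]) (simp add: step_env_def)
  show "(\<lambda>w. complex_of_real (tableau Ns w i j)) \<in> step_inputs N"
    by (rule e[of _ "if i \<le> Ns then In_a i j else In_b j"]) (simp add: step_env_def tableau_def)
  show "lap_inputs N \<subseteq> step_inputs N"
  proof
    fix f :: "step_data \<Rightarrow> complex" assume "f \<in> lap_inputs N"
    then obtain m i j where "f = (\<lambda>w. laplacian_diag N m i j)" by (auto simp: lap_inputs_def)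
    then show "f \<in> step_inputs N" by (intro e[of _ "In_lap m i j"]) (simp add: step_env_def)
  qed
  show "constants \<subseteq> step_inputs N" by (simp add: step_inputs_def)
qed

lemma computes_half: "constants \<subseteq> F \<Longrightarrow> computes W F 1 {\<lambda>w. 1/2}"
proof -
  assume c: "constants \<subseteq> F"
  have "computes W F (0 + 0 + 1) {\<lambda>w. 1/2}"
    by (intro computes_divide computes_1 computes_numeral c) simp
  then show ?thesis by simp
qed

lemma computes_delta: "constants \<subseteq> F \<Longrightarrow> computes W F 0 {\<lambda>w. if p = q then 1 else 0}"
  by (cases "p = q") (auto intro: computes_0 computes_1)

lemma computes_low_weight:
  assumes "step_inputs N \<subseteq> F"
  shows "computes W F 1 {\<lambda>w. low_weight r Ns w i p}"
proof -
  have "computes W F (0 + 0 + 1) {\<lambda>w. complex_of_real (step_size w) * complex_of_real (tableau Ns w i (Suc (p div (2 * r))))}"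
    by (intro computes_mult computes_mem) (use assms step_inputs_mem in blast)+
  then show ?thesis by (simp add: low_weight_def)
qed

lemma computes_conj_product_sum:
  assumes "constants \<subseteq> F" "\<And>n. n < N \<Longrightarrow> f n \<in> F" "\<And>n. n < N \<Longrightarrow> g n \<in> F"
  shows "computes W F (3 * N) {\<lambda>w. \<Sum>n<N. cnj (f n w) * g n w}"
proof -
  have "computes W F (N * (0 + 1 + 0 + 1 + 1)) {\<lambda>w. \<Sum>n<N. cnj (f n w) * g n w}"
    by (intro computes_sum computes_mult computes_cnj computes_mem assms)
  then show ?thesis by (rule computes_weaken) simp
qed

lemma computes_low_rank_sum:
  assumes F: "step_inputs N \<subseteq> F" "\<And>p. p < k \<Longrightarrow> f p \<in> F" "\<And>p. p < k \<Longrightarrow> g p \<in> F"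
  shows "computes W F (4 * k) {\<lambda>w. \<Sum>p<k. f p w * (low_weight r Ns w i p * g p w)}"
proof -
  have "constants \<subseteq> F" using F(1) step_inputs_mem(7) by blast
  then have "computes W F (k * (0 + (1 + 0 + 1) + 1 + 1)) {\<lambda>w. \<Sum>p<k. f p w * (low_weight r Ns w i p * g p w)}"
    by (intro computes_sum computes_mult computes_low_weight[OF F(1)] computes_mem F(2,3))
  then show ?thesis by (rule computes_weaken) simp
qed

lemma entries_mem: "entries n m A \<subseteq> F \<Longrightarrow> i < n \<Longrightarrow> j < m \<Longrightarrow> (\<lambda>w. A w i j) \<in> F"
  by (auto simp: entries_def)

lemma definite_cong:
  assumes "\<And>i j. i < k \<Longrightarrow> j < k \<Longrightarrow> A i j = B i j"
  shows "definite k A = definite k B"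
proof -
  have "(\<Sum>j<k. (\<Sum>s<k. v s * A s j) * cnj (v j)) = (\<Sum>j<k. (\<Sum>s<k. v s * B s j) * cnj (v j))" for v
    using assms by (intro sum.cong refl arg_cong2[of _ _ _ _ "(*)"]) auto
  then show ?thesis by (simp add: definite_def)
qed

text \<open>What is kept from the first \<open>m\<close> stages.  Keeping the entries of \<open>Y\<^sup>*X\<close> is essential: recomputing them in
every stage would cost \<open>O(N r\<^sup>2 Ns\<^sup>3)\<close> in total.\<close>

definition low_rank_held :: "nat \<Rightarrow> nat \<Rightarrow> nat \<Rightarrow> nat \<Rightarrow> (step_data \<Rightarrow> complex) set" where
  "low_rank_held N r Ns m = entries N (m * (2 * r)) (low_X N r Ns) \<union> entries N (m * (2 * r)) (low_Y N r Ns)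
     \<union> entries (m * (2 * r)) (m * (2 * r)) (gram N r Ns)"

definition update_cost :: "nat \<Rightarrow> nat \<Rightarrow> nat \<Rightarrow> nat" where
  "update_cost N r k = k * k * 5 + k * r * (3 * N) + k * (k + r) * (3 * k) + k * (k * (k + r) * 3)
     + N * r * (4 * k + 1)"

text \<open>The normal equations of \<open>core_injective\<close> are formed with all \<open>r\<close> right-hand sides appended as columns
\<open>k, \<dots>, k + r - 1\<close>, and one elimination solves them all.\<close>

lemma stage_U_cost:
  assumes W: "\<And>w. w \<in> W \<Longrightarrow> valid_data N r w" and F: "step_inputs N \<subseteq> F" and H: "low_rank_held N r Ns m \<subseteq> F"
  shows "computes W F (update_cost N r (m * (2 * r))) (entries N r (\<lambda>w n q. stage_U N Ns w (Suc m) $$ (n, q)))"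
proof -
  define k where "k = m * (2 * r)"
  let ?i = "Suc m"
  have c: "constants \<subseteq> F" using F step_inputs_mem(7) by blast
  have XX: "(\<lambda>w. low_X N r Ns w n p) \<in> F" and YY: "(\<lambda>w. low_Y N r Ns w n p) \<in> F" if "n < N" "p < k" for n p
    using entries_mem[of N k "low_X N r Ns" F n p] entries_mem[of N k "low_Y N r Ns" F n p] H that
    by (auto simp: low_rank_held_def k_def)
  have G: "(\<lambda>w. gram N r Ns w p q) \<in> F" if "p < k" "q < k" for p q
    using entries_mem[of k k "gram N r Ns" F p q] H that by (auto simp: low_rank_held_def k_def)
  let ?core = "\<lambda>w. core N r Ns w ?i"
  have 1: "computes W F (k * k * 5) (entries k k ?core)"
  proof (rule computes_entries)
    fix p q assume "p < k" "q < k"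
    then have "computes W F (0 + (1 + (0 + 1 + 1) + 1) + 1)
        {\<lambda>w. (if p = q then 1 else 0) - 1/2 * (gram N r Ns w p q * low_weight r Ns w ?i q)}"
      by (intro computes_diff computes_mult computes_delta computes_half computes_low_weight[OF F] computes_mem c G)
    then show "computes W F 5 {\<lambda>w. ?core w p q}" by (simp add: core_def eval_nat_numeral)
  qed
  let ?B = "\<lambda>w p q. \<Sum>n<N. cnj (low_Y N r Ns w n p) * start w $$ (n, q)"
  have 2: "computes W F (k * r * (3 * N)) (entries k r ?B)"
  proof (rule computes_entries)
    fix p q assume "p < k" "q < r"
    then show "computes W F (3 * N) {\<lambda>w. ?B w p q}"
      by (intro computes_conj_product_sum c YY) (use F step_inputs_mem(1) in blast)+
  qed
  let ?F2 = "F \<union> (entries k k ?core \<union> entries k r ?B)"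
  have 12: "computes W F (k * k * 5 + k * r * (3 * N)) (entries k k ?core \<union> entries k r ?B)"
    by (rule computes_trans[OF 1 computes_more_held[OF 2]]) auto
  \<comment> \<open>the normal equations, augmented by their right-hand sides\<close>
  define A where "A w p j = (if j < k then \<Sum>q<k. cnj (?core w q p) * ?core w q j
      else \<Sum>q<k. cnj (?core w q p) * ?B w q (j - k))" for w p j
  have c2: "constants \<subseteq> ?F2" using c by auto
  have 3: "computes W ?F2 (k * (k + r) * (3 * k)) (entries k (k + r) A)"
  proof (rule computes_entries)
    fix p j assume pj: "p < k" "j < k + r"
    show "computes W ?F2 (3 * k) {\<lambda>w. A w p j}"
    proof (cases "j < k")
      case True
      then show ?thesis unfolding A_def if_P[OF True]
        by (intro computes_conj_product_sum c2 entries_mem[of k k ?core ?F2]) (use pj in auto)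
    next
      case False
      then have "j - k < r" using pj by auto
      then show ?thesis unfolding A_def if_not_P[OF False]
        by (intro computes_conj_product_sum c2 entries_mem[of k k ?core ?F2] entries_mem[of k r ?B ?F2]) (use pj in auto)
    qed
  qed
  have def: "definite k (A w)" if w: "w \<in> W" for w
  proof -
    interpret rkmk_data N r Ns w by standard (rule W[OF w])
    have "definite k (\<lambda>i j. \<Sum>q<k. cnj (?core w q i) * ?core w q j)"
    proof (rule normal_equations_definite)
      fix u assume z: "\<And>q. q < k \<Longrightarrow> (\<Sum>j<k. ?core w q j * u j) = 0"
      have k': "(?i - 1) * (2 * r) = k" by (simp add: k_def)
      have "u j = 0" if "j < k" for j
        by (rule core_injective[of ?i u j, unfolded k', OF _ z that]) simp
      then show "\<forall>j<k. u j = 0" by blast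
    qed
    then show ?thesis by (subst definite_cong[of k _ "\<lambda>i j. \<Sum>q<k. cnj (?core w q i) * ?core w q j"]) (auto simp: A_def)
  qed
  let ?g = "\<lambda>w. gauss_jordan_step (A w) k"
  have 4: "computes W (?F2 \<union> entries k (k + r) A) (k * (k * (k + r) * 3)) (entries k (k + r) ?g)"
    by (rule gauss_jordan_cost) (use def in auto)
  have 5: "computes W F (k * k * 5 + k * r * (3 * N) + (k * (k + r) * (3 * k) + k * (k * (k + r) * 3))) (entries k (k + r) ?g)"
    by (rule computes_then[OF 12 computes_then[OF 3 4]])
  let ?F5 = "F \<union> entries k (k + r) ?g"
  have 6: "computes W ?F5 (N * r * (4 * k + 1)) (entries N r (\<lambda>w n q. stage_U N Ns w ?i $$ (n, q)))"
  proof (rule computes_entries)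
    fix n q assume nq: "n < N" "q < r"
    have "computes W ?F5 (0 + 4 * k + 1)
      {\<lambda>w. start w $$ (n, q) + (\<Sum>p<k. low_X N r Ns w n p * (low_weight r Ns w ?i p * ?g w p (k + q)))}"
      by (intro computes_add computes_low_rank_sum[where N = N] computes_mem entries_mem[of k "k + r" ?g ?F5])
        (use nq F XX step_inputs_mem(1)[of n q N] in auto)
    then have "computes W ?F5 (4 * k + 1)
      {\<lambda>w. start w $$ (n, q) + (\<Sum>p<k. low_X N r Ns w n p * (low_weight r Ns w ?i p * ?g w p (k + q)))}" by simp
    then show "computes W ?F5 (4 * k + 1) {\<lambda>w. stage_U N Ns w ?i $$ (n, q)}"
    proof (rule computes_cong)
      fix w assume w: "w \<in> W"
      interpret rkmk_data N r Ns w by standard (rule W[OF w])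
      have k': "(?i - 1) * (2 * r) = k" by (simp add: k_def)
      from stage_U_low_rank[of ?i, unfolded k'] obtain c
        where c: "\<forall>p<k. \<forall>q<r. (\<Sum>s<k. ?core w p s * c s q) = ?B w p q"
        and V: "\<forall>n<N. \<forall>q<r. V ?i $$ (n, q) = start w $$ (n, q) + (\<Sum>p<k. XX n p * (wt ?i p * c p q))"
        by auto
      have V: "V ?i $$ (n, q) = start w $$ (n, q) + (\<Sum>p<k. XX n p * (wt ?i p * c p q))"
        using V nq by blast
      have g: "?g w p (k + q) = c p q" if p: "p < k" for p
      proof (rule gauss_jordan_solves[OF def[OF w] _ p])
        fix i assume i: "i < k"
        have "(\<Sum>j<k. A w i j * c j q) = (\<Sum>j<k. \<Sum>s<k. cnj (?core w s i) * (?core w s j * c j q))"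
          by (intro sum.cong refl) (simp add: A_def sum_distrib_right mult.assoc)
        also have "\<dots> = (\<Sum>s<k. \<Sum>j<k. cnj (?core w s i) * (?core w s j * c j q))" by (rule sum.swap)
        also have "\<dots> = (\<Sum>s<k. cnj (?core w s i) * ?B w s q)"
          unfolding sum_distrib_left[symmetric] using nq by (intro sum.cong refl) (simp add: c)
        finally show "(\<Sum>j<k. A w i j * c j q) = A w i (k + q)" by (simp add: A_def)
      qed
      show "start w $$ (n, q) + (\<Sum>p<k. XX n p * (wt ?i p * ?g w p (k + q))) = V ?i $$ (n, q)"
        unfolding V by (intro arg_cong2[of _ _ _ _ "(+)"] refl sum.cong) (simp add: g)
    qed
  qed
  have "computes W F (k * k * 5 + k * r * (3 * N) + (k * (k + r) * (3 * k) + k * (k * (k + r) * 3)) + N * r * (4 * k + 1))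
      (entries N r (\<lambda>w n q. stage_U N Ns w ?i $$ (n, q)))"
    by (rule computes_then[OF 5 6])
  then show ?thesis unfolding update_cost_def k_def[symmetric] by (simp only: add.assoc)
qed

definition field_cost :: "nat \<Rightarrow> nat \<Rightarrow> nat" where
  "field_cost N r = N * N * (4 * r) + 30 * N\<^sup>2 + N * r * (2 * N + 3)"

lemma stage_F_cost:
  assumes W: "\<And>w. w \<in> W \<Longrightarrow> valid_data N r w" and N: "2 \<le> N" and F: "step_inputs N \<subseteq> F" and i: "1 \<le> i"
    and U: "entries N r (\<lambda>w n q. stage_U N Ns w i $$ (n, q)) \<subseteq> F"
  shows "computes W F (field_cost N r) (entries N r (\<lambda>w n q. stage_F N Ns w i $$ (n, q)))"
proof -
  have c: "constants \<subseteq> F" using F step_inputs_mem(7) by blast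
  have Um: "(\<lambda>w. stage_U N Ns w i $$ (n, q)) \<in> F" if "n < N" "q < r" for n q
    using entries_mem[OF U that] .
  let ?S = "\<lambda>w n m. \<Sum>q<r. stage_U N Ns w i $$ (n, q) * eigs w $$ (q, q) * cnj (stage_U N Ns w i $$ (m, q))"
  have 1: "computes W F (N * N * (4 * r)) (entries N N ?S)"
  proof (rule computes_entries)
    fix n m assume "n < N" "m < N"
    then have "computes W F (r * (0 + 0 + 1 + (0 + 1) + 1 + 1)) {\<lambda>w. ?S w n m}"
      by (intro computes_sum computes_mult computes_cnj computes_mem c Um) (use F step_inputs_mem(2) in blast)+
    then show "computes W F (4 * r) {\<lambda>w. ?S w n m}" by (simp add: mult.commute eval_nat_numeral)
  qed
  let ?F1 = "F \<union> entries N N ?S"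
  have 2: "computes W ?F1 (30 * N\<^sup>2) (entries N N (\<lambda>w. lap_solve N (?S w)))"
    by (rule lap_solve_cost) (use N c F step_inputs_mem(6)[of N] in auto)
  let ?F2 = "F \<union> entries N N (\<lambda>w. lap_solve N (?S w))"
  have 3: "computes W ?F2 (N * r * (2 * N + 3)) (entries N r (\<lambda>w n q. stage_F N Ns w i $$ (n, q)))"
  proof (rule computes_entries)
    fix n q assume nq: "n < N" "q < r"
    have c2: "constants \<subseteq> ?F2" using c by auto
    have h: "complex_of_real (hbar N) \<noteq> 0"
    proof -
      have "1 < (real N)\<^sup>2" using N by (simp add: one_less_power)
      then show ?thesis by (simp add: hbar_def)
    qed
    have "computes W ?F2 (0 + 0 + 1 + 1 + N * (0 + 0 + 1 + 1) + 1)
      {\<lambda>w. - (1 / complex_of_real (hbar N)) * (\<Sum>m<N. lap_solve N (?S w) n m * stage_U N Ns w i $$ (m, q))}"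
      by (intro computes_mult computes_uminus computes_divide computes_sum computes_1 c2 computes_mem)
        (use nq h F step_inputs_mem(4)[of N] Um entries_mem[of N N "\<lambda>w. lap_solve N (?S w)" ?F2] in auto)
    then have "computes W ?F2 (2 * N + 3)
      {\<lambda>w. - (1 / complex_of_real (hbar N)) * (\<Sum>m<N. lap_solve N (?S w) n m * stage_U N Ns w i $$ (m, q))}"
      by (rule computes_weaken) simp
    then show "computes W ?F2 (2 * N + 3) {\<lambda>w. stage_F N Ns w i $$ (n, q)}"
    proof (rule computes_cong)
      fix w assume w: "w \<in> W"
      interpret rkmk_data N r Ns w by standard (rule W[OF w])
      show "- (1 / complex_of_real (hbar N)) * (\<Sum>m<N. lap_solve N (?S w) n m * stage_U N Ns w i $$ (m, q))
        = stage_F N Ns w i $$ (n, q)"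
        unfolding stage_F_def field_F_at[OF N S conjunct2[OF stages_valid[OF i]] nq] by (simp add: inverse_eq_divide)
    qed
  qed
  show ?thesis
    unfolding field_cost_def add.assoc by (rule computes_then[OF 1 computes_then[OF 2 computes_more_held[OF 3]], unfolded add.assoc]) auto
qed

definition factor_cost :: "nat \<Rightarrow> nat \<Rightarrow> nat \<Rightarrow> nat" where
  "factor_cost N r k = r * r * (3 * N) + N * (2 * r) * (2 * r + 2)
     + 2 * (k * (2 * r) * (3 * N) + N * (2 * r) * (4 * k + 3))
     + 2 * ((k + 2 * r) * (2 * r) * (3 * N))"

text \<open>The product \<open>\<Omega>\<^sup>i Z\<close> is evaluated from the right, as \<open>X (D (Y\<^sup>*Z))\<close>.\<close>

lemma shift_cost:
  assumes W: "\<And>w. w \<in> W \<Longrightarrow> valid_data N r w" and F: "step_inputs N \<subseteq> F" and H: "low_rank_held N r Ns m \<subseteq> F"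
    and Z: "entries N (2 * r) Z \<subseteq> F"
  shows "computes W F (m * (2 * r) * (2 * r) * (3 * N) + N * (2 * r) * (4 * (m * (2 * r)) + 3))
    (entries N (2 * r) (\<lambda>w. shift N Ns w (Suc m) (Z w)))"
proof -
  define k where "k = m * (2 * r)"
  have c: "constants \<subseteq> F" using F step_inputs_mem(7) by blast
  have XX: "(\<lambda>w. low_X N r Ns w n p) \<in> F" and YY: "(\<lambda>w. low_Y N r Ns w n p) \<in> F" if "n < N" "p < k" for n p
    using entries_mem[of N k "low_X N r Ns" F n p] entries_mem[of N k "low_Y N r Ns" F n p] H that
    by (auto simp: low_rank_held_def k_def)
  let ?T = "\<lambda>w q c. \<Sum>n<N. cnj (low_Y N r Ns w n q) * Z w n c"
  have 1: "computes W F (k * (2 * r) * (3 * N)) (entries k (2 * r) ?T)"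
    by (intro computes_entries computes_conj_product_sum c YY entries_mem[OF Z])
  let ?F1 = "F \<union> entries k (2 * r) ?T"
  have c1: "constants \<subseteq> ?F1" using c by auto
  have 2: "computes W ?F1 (N * (2 * r) * (4 * k + 3)) (entries N (2 * r) (\<lambda>w. shift N Ns w (Suc m) (Z w)))"
  proof (rule computes_entries)
    fix n c assume nc: "n < N" "c < 2 * r"
    have "computes W ?F1 (0 + (1 + 4 * k + 1) + 1)
      {\<lambda>w. Z w n c - 1/2 * (\<Sum>q<k. low_X N r Ns w n q * (low_weight r Ns w (Suc m) q * ?T w q c))}"
      by (intro computes_diff computes_mult computes_half c1 computes_low_rank_sum[where N = N] computes_mem
          entries_mem[of k "2 * r" ?T ?F1])
        (use nc F XX entries_mem[OF Z] in auto)
    then have "computes W ?F1 (4 * k + 3)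
      {\<lambda>w. Z w n c - 1/2 * (\<Sum>q<k. low_X N r Ns w n q * (low_weight r Ns w (Suc m) q * ?T w q c))}"
      by (rule computes_weaken) simp
    then show "computes W ?F1 (4 * k + 3) {\<lambda>w. shift N Ns w (Suc m) (Z w) n c}"
    proof (rule computes_cong)
      fix w assume w: "w \<in> W"
      interpret rkmk_data N r Ns w by standard (rule W[OF w])
      show "Z w n c - 1/2 * (\<Sum>q<k. XX n q * (wt (Suc m) q * ?T w q c)) = shift N Ns w (Suc m) (Z w) n c"
        using shift_low_rank[of "Suc m" n "Z w" c] nc by (simp add: k_def)
    qed
  qed
  show ?thesis unfolding k_def[symmetric] by (rule computes_then[OF 1 2])
qed

text \<open>The new entries of \<open>Y\<^sup>*X\<close> are those in the last \<open>2r\<close> rows or columns.\<close>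

lemma stage_factor_cost:
  assumes W: "\<And>w. w \<in> W \<Longrightarrow> valid_data N r w" and F: "step_inputs N \<subseteq> F" and H: "low_rank_held N r Ns m \<subseteq> F"
    and U: "entries N r (\<lambda>w n q. stage_U N Ns w (Suc m) $$ (n, q)) \<subseteq> F"
    and V: "entries N r (\<lambda>w n q. stage_F N Ns w (Suc m) $$ (n, q)) \<subseteq> F"
  shows "computes W F (factor_cost N r (m * (2 * r))) (low_rank_held N r Ns (Suc m))"
proof -
  let ?i = "Suc m"
  define k where "k = m * (2 * r)"
  have c: "constants \<subseteq> F" using F step_inputs_mem(7) by blast
  let ?K = "\<lambda>w. overlap N (eigs w) (stage_U N Ns w ?i)"
  have 1: "computes W F (r * r * (3 * N)) (entries r r ?K)"
  proof (rule computes_entries)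
    fix a b assume "a < r" "b < r"
    then have "computes W F (3 * N) {\<lambda>w. \<Sum>n<N. cnj (stage_F N Ns w ?i $$ (n, a)) * stage_U N Ns w ?i $$ (n, b)}"
      by (intro computes_conj_product_sum c entries_mem[OF U] entries_mem[OF V])
    then show "computes W F (3 * N) {\<lambda>w. ?K w a b}" by (simp add: overlap_def stage_F_def)
  qed
  let ?F1 = "F \<union> entries r r ?K"
  let ?Y = "\<lambda>w. stage_Y N r Ns w ?i" and ?X = "\<lambda>w. stage_X N r Ns w ?i"
  have c1: "constants \<subseteq> ?F1" using c by auto
  have 2: "computes W ?F1 (N * (2 * r) * (2 * r + 2)) (entries N (2 * r) ?Y)"
  proof (rule computes_entries)
    fix n b assume nb: "n < N" "b < 2 * r"
    show "computes W ?F1 (2 * r + 2) {\<lambda>w. ?Y w n b}"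
    proof (cases "b < r")
      case True
      then show ?thesis unfolding stage_Y_def if_P[OF True]
        by (intro computes_weaken[OF computes_mem[of _ ?F1], of _ "2 * r + 2"]) (use entries_mem[OF U, of n b] nb in auto)
    next
      case False
      have b: "b - r < r" using nb False by auto
      have "computes W ?F1 (0 + r * (0 + 0 + 1 + 1) + 1 + 1) {\<lambda>w. - (stage_F N Ns w ?i $$ (n, b - r) +
          (\<Sum>q<r. stage_U N Ns w ?i $$ (n, q) * ?K w q (b - r)))}"
        by (intro computes_uminus computes_add computes_sum computes_mult c1 computes_mem)
          (use nb b entries_mem[OF U] entries_mem[OF V] entries_mem[of r r ?K ?F1] in auto)
      then have "computes W ?F1 (2 * r + 2) {\<lambda>w. - (stage_F N Ns w ?i $$ (n, b - r) +
          (\<Sum>q<r. stage_U N Ns w ?i $$ (n, q) * ?K w q (b - r)))}" by (rule computes_weaken) simp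
      then show ?thesis unfolding stage_Y_def if_not_P[OF False] .
    qed
  qed
  have 12: "computes W F (r * r * (3 * N) + N * (2 * r) * (2 * r + 2)) (entries N (2 * r) ?Y)"
    by (rule computes_then[OF 1 2])
  have X: "entries N (2 * r) ?X \<subseteq> F"
  proof
    fix f assume "f \<in> entries N (2 * r) ?X"
    then obtain n b where f: "f = (\<lambda>w. ?X w n b)" "n < N" "b < 2 * r" by (auto simp: entries_def)
    show "f \<in> F"
    proof (cases "b < r")
      case True
      then show ?thesis unfolding f(1) stage_X_def if_P[OF True] by (intro entries_mem[OF V] f)
    next
      case False
      then have "b - r < r" using f by auto
      then show ?thesis unfolding f(1) stage_X_def if_not_P[OF False] by (intro entries_mem[OF U] f)
    qed
  qed
  let ?F2 = "F \<union> entries N (2 * r) ?Y"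
  let ?SX = "entries N (2 * r) (\<lambda>w. shift N Ns w ?i (?X w))" and ?SY = "entries N (2 * r) (\<lambda>w. shift N Ns w ?i (?Y w))"
  let ?sc = "k * (2 * r) * (3 * N) + N * (2 * r) * (4 * k + 3)"
  have 3: "computes W ?F2 ?sc ?SX"
    unfolding k_def by (rule shift_cost) (use W F H X in auto)
  have 4: "computes W (?F2 \<union> ?SX) ?sc ?SY"
    unfolding k_def by (rule shift_cost) (use W F H in auto)
  have 34: "computes W F (r * r * (3 * N) + N * (2 * r) * (2 * r + 2) + (?sc + ?sc)) (?SX \<union> ?SY)"
    by (rule computes_then[OF 12 computes_trans[OF 3 4]])
  let ?F4 = "F \<union> (?SX \<union> ?SY)"
  have c4: "constants \<subseteq> ?F4" using c by auto
  have XXm: "(\<lambda>w. low_X N r Ns w n p) \<in> ?F4" and YYm: "(\<lambda>w. low_Y N r Ns w n p) \<in> ?F4"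
    if "n < N" "p < k + 2 * r" for n p
  proof -
    show "(\<lambda>w. low_X N r Ns w n p) \<in> ?F4"
    proof (cases "p < k")
      case True
      then show ?thesis using entries_mem[of N k "low_X N r Ns" ?F4 n p] H that by (auto simp: low_rank_held_def k_def)
    next
      case False
      then have p: "p div (2 * r) = m" "p mod (2 * r) < 2 * r"
        using that by (auto simp: k_def div_nat_eqI algebra_simps)
      show ?thesis
        unfolding low_X_def p(1) by (rule entries_mem[of N "2 * r" "\<lambda>w. shift N Ns w ?i (?X w)"]) (use that p in auto)
    qed
    show "(\<lambda>w. low_Y N r Ns w n p) \<in> ?F4"
    proof (cases "p < k")
      case True
      then show ?thesis using entries_mem[of N k "low_Y N r Ns" ?F4 n p] H that by (auto simp: low_rank_held_def k_def)
    next
      case False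
      then have p: "p div (2 * r) = m" "p mod (2 * r) < 2 * r"
        using that by (auto simp: k_def div_nat_eqI algebra_simps)
      show ?thesis
        unfolding low_Y_def p(1) by (rule entries_mem[of N "2 * r" "\<lambda>w. shift N Ns w ?i (?Y w)"]) (use that p in auto)
    qed
  qed
  have gm: "computes W ?F4 (3 * N) {\<lambda>w. gram N r Ns w p q}" if "p < k + 2 * r" "q < k + 2 * r" for p q
    unfolding gram_def by (intro computes_conj_product_sum c4 XXm YYm that)
  let ?G1 = "entries (k + 2 * r) (2 * r) (\<lambda>w p b. gram N r Ns w p (k + b))"
  let ?G2 = "entries (2 * r) (k + 2 * r) (\<lambda>w b p. gram N r Ns w (k + b) p)"
  have 5: "computes W ?F4 ((k + 2 * r) * (2 * r) * (3 * N)) ?G1"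
    by (intro computes_entries gm) auto
  have 6: "computes W (?F4 \<union> ?G1) (2 * r * (k + 2 * r) * (3 * N)) ?G2"
    by (rule computes_more_held[of _ ?F4], intro computes_entries gm) auto
  have 7: "computes W F (r * r * (3 * N) + N * (2 * r) * (2 * r + 2) + (?sc + ?sc)
      + ((k + 2 * r) * (2 * r) * (3 * N) + 2 * r * (k + 2 * r) * (3 * N))) (?SX \<union> ?SY \<union> (?G1 \<union> ?G2))"
    by (rule computes_trans[OF 34 computes_trans[OF 5 6]])
  have 8: "computes W F (r * r * (3 * N) + N * (2 * r) * (2 * r + 2) + (?sc + ?sc)
      + ((k + 2 * r) * (2 * r) * (3 * N) + 2 * r * (k + 2 * r) * (3 * N))) (F \<union> (?SX \<union> ?SY \<union> (?G1 \<union> ?G2)))"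
    by (rule computes_keep[OF 7 held_mem])
  have k': "Suc m * (2 * r) = k + 2 * r" by (simp add: k_def)
  have "low_rank_held N r Ns (Suc m) \<subseteq> F \<union> (?SX \<union> ?SY \<union> (?G1 \<union> ?G2))"
  proof
    fix f assume "f \<in> low_rank_held N r Ns (Suc m)"
    then consider "f \<in> entries N (k + 2 * r) (low_X N r Ns)" | "f \<in> entries N (k + 2 * r) (low_Y N r Ns)"
      | "f \<in> entries (k + 2 * r) (k + 2 * r) (gram N r Ns)"
      unfolding low_rank_held_def k' by blast
    then show "f \<in> F \<union> (?SX \<union> ?SY \<union> (?G1 \<union> ?G2))"
    proof cases
      case 1
      then show ?thesis using XXm by (auto simp: entries_def[of N "k + 2 * r"])
    next
      case 2
      then show ?thesis using YYm by (auto simp: entries_def[of N "k + 2 * r"])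
    next
      case 3
      then obtain p q where f: "f = (\<lambda>w. gram N r Ns w p q)" "p < k + 2 * r" "q < k + 2 * r"
        by (auto simp: entries_def)
      consider "p < k" "q < k" | "k \<le> q" | "k \<le> p" by linarith
      then show ?thesis
      proof cases
        case 1
        then show ?thesis using H unfolding f(1) low_rank_held_def k_def[symmetric]
          by (intro UnI1 entries_mem[of k k "gram N r Ns"]) auto
      next
        case 2
        then obtain b where "q = k + b" using le_Suc_ex by blast
        then have "f \<in> ?G1" using f by (auto simp: entries_def)
        then show ?thesis by blast
      next
        case 3
        then obtain b where "p = k + b" using le_Suc_ex by blast
        then have "f \<in> ?G2" using f by (auto simp: entries_def)
        then show ?thesis by blast
      qed
    qed
  qed
  from computes_subset[OF 8 this] show ?thesis
    unfolding factor_cost_def k_def[symmetric] by (rule computes_weaken) (simp add: algebra_simps)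
qed

lemma stages_cost:
  assumes W: "\<And>w. w \<in> W \<Longrightarrow> valid_data N r w" and N: "2 \<le> N"
    and bound: "\<And>m. m < M \<Longrightarrow> update_cost N r (m * (2 * r)) + field_cost N r + factor_cost N r (m * (2 * r)) \<le> C"
  shows "computes W (step_inputs N) (M * C) (low_rank_held N r Ns M)"
  using bound
proof (induction M)
  case 0
  then show ?case by (auto simp: low_rank_held_def entries_def intro!: computes_held)
next
  case (Suc m)
  let ?F = "step_inputs N \<union> low_rank_held N r Ns m"
  let ?U = "entries N r (\<lambda>w n q. stage_U N Ns w (Suc m) $$ (n, q))"
    and ?V = "entries N r (\<lambda>w n q. stage_F N Ns w (Suc m) $$ (n, q))"
  have 1: "computes W ?F (update_cost N r (m * (2 * r))) ?U"
    by (rule stage_U_cost) (use W in auto)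
  have 2: "computes W (?F \<union> ?U) (field_cost N r) ?V"
    by (rule stage_F_cost) (use W N in auto)
  have 3: "computes W (?F \<union> (?U \<union> ?V)) (factor_cost N r (m * (2 * r))) (low_rank_held N r Ns (Suc m))"
    by (rule stage_factor_cost) (use W in auto)
  have "computes W ?F (update_cost N r (m * (2 * r)) + field_cost N r + factor_cost N r (m * (2 * r))) (low_rank_held N r Ns (Suc m))"
    by (rule computes_then[OF computes_trans[OF 1 2] 3])
  then have "computes W ?F C (low_rank_held N r Ns (Suc m))"
    by (rule computes_weaken) (use Suc.prems in auto)
  from computes_then[OF Suc.IH this] Suc.prems show ?case by (simp add: add.commute)
qed

text \<open>With \<open>K = 2 r Ns\<close>, both \<open>k\<close> and \<open>r\<close> are at most \<open>K\<close>, and every monomial of the cost is bounded by one of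
\<open>K\<^sup>3\<close>, \<open>N r K\<close> and \<open>N\<^sup>2 r\<close>.\<close>

lemma stage_cost_bound:
  assumes "k \<le> 2 * r * Ns" "1 \<le> r" "1 \<le> Ns"
  shows "update_cost N r k + field_cost N r + factor_cost N r k
    \<le> 200 * (N * r\<^sup>2 * Ns) + 136 * (r ^ 3 * Ns ^ 3) + 36 * (N\<^sup>2 * r)"
proof -
  define K where "K = 2 * r * Ns"
  have K: "k \<le> K" "r \<le> K" "1 \<le> K" "2 * r \<le> K" using assms by (auto simp: K_def)
  have a1: "k * k \<le> K * K * K"
    using mult_le_mono[OF mult_le_mono[OF K(1) K(1)] K(3)] by simp
  have a2: "k * k * k \<le> K * K * K" by (intro mult_le_mono K)
  have a3: "k * k * r \<le> K * K * K" by (intro mult_le_mono K)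
  have b1: "N * r * k \<le> N * r * K" by (intro mult_le_mono K order_refl)
  have b2: "N * r \<le> N * r * K" using mult_le_mono[OF order_refl K(3), of "N * r"] by simp
  have b3: "N * r * r \<le> N * r * K" by (intro mult_le_mono K order_refl)
  have d: "N * N \<le> N * N * r" using mult_le_mono[OF order_refl assms(2), of "N * N"] by simp
  have "update_cost N r k + field_cost N r + factor_cost N r k = 5 * (k * k) + 6 * (k * k * k) + 6 * (k * k * r)
      + 47 * (N * r * k) + 20 * (N * r) + 31 * (N * r * r) + 30 * (N * N) + 6 * (N * N * r)"
    unfolding update_cost_def field_cost_def factor_cost_def
    by (simp add: algebra_simps power2_eq_square)
  also have "\<dots> \<le> 17 * (K * K * K) + 100 * (N * r * K) + 36 * (N * N * r)"
  proof -
    have "5 * x1 + 6 * x2 + 6 * x3 + 47 * y1 + 20 * y2 + 31 * y3 + 30 * z1 + 6 * z2 \<le> 17 * x + 100 * y + 36 * z2"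
      if "x1 \<le> x" "x2 \<le> x" "x3 \<le> x" "y1 \<le> y" "y2 \<le> y" "y3 \<le> y" "z1 \<le> z2"
      for x1 x2 x3 y1 y2 y3 z1 z2 x y :: nat
      using that by linarith
    from this[OF a1 a2 a3 b1 b2 b3 d] show ?thesis .
  qed
  also have "\<dots> = 200 * (N * r\<^sup>2 * Ns) + 136 * (r ^ 3 * Ns ^ 3) + 36 * (N\<^sup>2 * r)"
    unfolding K_def by (simp add: power2_eq_square power3_eq_cube algebra_simps)
  finally show ?thesis .
qed

lemma step_cost:
  assumes "2 \<le> N" "1 \<le> r" "1 \<le> Ns"
  shows "computes {w. valid_data N r w} (step_inputs N)
    (400 * (N * r\<^sup>2 * Ns\<^sup>2) + 272 * (r ^ 3 * Ns ^ 4) + 72 * (N\<^sup>2 * r * Ns))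
    (entries N r (\<lambda>w n q. stage_U N Ns w (Suc Ns) $$ (n, q)))"
proof -
  let ?W = "{w. valid_data N r w}"
  define C where "C = 200 * (N * r\<^sup>2 * Ns) + 136 * (r ^ 3 * Ns ^ 3) + 36 * (N\<^sup>2 * r)"
  have C: "update_cost N r (m * (2 * r)) + field_cost N r + factor_cost N r (m * (2 * r)) \<le> C" if "m \<le> Ns" for m
    unfolding C_def by (rule stage_cost_bound) (use that assms in auto)
  have 1: "computes ?W (step_inputs N) (Ns * C) (low_rank_held N r Ns Ns)"
    by (rule stages_cost) (use C assms in auto)
  have 2: "computes ?W (step_inputs N \<union> low_rank_held N r Ns Ns) (update_cost N r (Ns * (2 * r)))
      (entries N r (\<lambda>w n q. stage_U N Ns w (Suc Ns) $$ (n, q)))"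
    by (rule stage_U_cost) auto
  have "Ns * C + update_cost N r (Ns * (2 * r)) \<le> Ns * C + C" using C[of Ns] by simp
  also have "\<dots> \<le> 2 * (Ns * C)" using assms by simp
  also have "\<dots> = 400 * (N * r\<^sup>2 * Ns\<^sup>2) + 272 * (r ^ 3 * Ns ^ 4) + 72 * (N\<^sup>2 * r * Ns)"
    unfolding C_def by (simp add: power2_eq_square power3_eq_cube power4_eq_xxxx algebra_simps)
  finally show ?thesis by (rule computes_weaken[OF computes_then[OF 1 2]])
qed

theorem proposition4p1:
  "\<exists>c1 c2 c3 :: real. \<forall>N r Ns :: nat. 2 \<le> N \<and> 1 \<le> r \<and> r \<le> N \<and> 1 \<le> Ns \<longrightarrow>
     (\<exists>(cs :: rkmk_input instr list) out.
        real (length cs) \<le> c1 * (real N * real r ^ 2 * real Ns ^ 2)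
                          + c2 * (real r ^ 3 * real Ns ^ 4)
                          + c3 * (real N ^ 2 * real r * real Ns) \<and>
        (\<forall>W0 S0 (a :: nat \<Rightarrow> nat \<Rightarrow> real) (b :: nat \<Rightarrow> real) (dt :: real) U.
           W0 \<in> su_alg N \<and> is_dominant_eigenvalue_matrix N r W0 S0 \<and> is_explicit_rk Ns a \<and> 0 < dt \<and>
           U \<in> stiefel r N \<longrightarrow>
           slp_computes cs out (rkmk_env N S0 a b dt U) (rkmk_step N Ns (cay N) S0 a b dt U)))"
proof (rule exI[of _ 400], rule exI[of _ 272], rule exI[of _ 72], intro allI impI)
  fix N r Ns :: nat
  assume "2 \<le> N \<and> 1 \<le> r \<and> r \<le> N \<and> 1 \<le> Ns"
  then have a: "2 \<le> N" "1 \<le> r" "1 \<le> Ns" by auto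
  let ?Y = "\<lambda>w n q. stage_U N Ns w (Suc Ns) $$ (n, q)"
  let ?k = "400 * (N * r\<^sup>2 * Ns\<^sup>2) + 272 * (r ^ 3 * Ns ^ 4) + 72 * (N\<^sup>2 * r * Ns)"
  have "\<exists>cs out. length cs \<le> ?k \<and> (\<forall>w\<in>{w. valid_data N r w}. \<forall>M\<in>carrier_mat N r.
      (\<forall>i<N. \<forall>j<r. M $$ (i, j) = ?Y w i j) \<longrightarrow> slp_computes cs out (step_env N w) M)"
    by (rule computes_program[OF step_cost[OF a, unfolded step_inputs_def]]) (use a in auto)
  then obtain cs out where len: "length cs \<le> ?k"
    and cs: "\<forall>w\<in>{w. valid_data N r w}. \<forall>M\<in>carrier_mat N r. (\<forall>i<N. \<forall>j<r. M $$ (i, j) = ?Y w i j) \<longrightarrow>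
       slp_computes cs out (step_env N w) M" by (elim exE conjE)
  have "real (length cs) \<le> real ?k" using len by (rule of_nat_mono)
  also have "\<dots> = 400 * (real N * real r ^ 2 * real Ns ^ 2) + 272 * (real r ^ 3 * real Ns ^ 4)
      + 72 * (real N ^ 2 * real r * real Ns)" by simp
  finally have bound: "real (length cs) \<le> 400 * (real N * real r ^ 2 * real Ns ^ 2) + 272 * (real r ^ 3 * real Ns ^ 4)
      + 72 * (real N ^ 2 * real r * real Ns)" .
  have "slp_computes cs out (rkmk_env N S0 a b dt U) (rkmk_step N Ns (cay N) S0 a b dt U)"
    if W0: "W0 \<in> su_alg N" "is_dominant_eigenvalue_matrix N r W0 S0" and U: "U \<in> stiefel r N" for W0 S0 a b dt U
  proof -
    let ?w = "Step_Data S0 a b dt U"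
    have v: "valid_data N r ?w"
      using a U dominant_eigenvalue_matrix_skew[OF W0] by (simp add: valid_data_def)
    interpret rkmk_data N r Ns ?w by standard (rule v)
    have "stage_U N Ns ?w (Suc Ns) \<in> carrier_mat N r"
      using stages_valid[of "Suc Ns"] by (simp add: stiefel_def)
    then have "slp_computes cs out (step_env N ?w) (stage_U N Ns ?w (Suc Ns))"
      using cs[THEN bspec, of ?w] v by simp
    then show ?thesis
      unfolding rkmk_step_eq_stage[OF a(3)] by (simp add: step_env_def)
  qed
  with bound show "\<exists>cs out. real (length cs) \<le> 400 * (real N * real r ^ 2 * real Ns ^ 2)
        + 272 * (real r ^ 3 * real Ns ^ 4) + 72 * (real N ^ 2 * real r * real Ns) \<and>
      (\<forall>W0 S0 a b dt U. W0 \<in> su_alg N \<and> is_dominant_eigenvalue_matrix N r W0 S0 \<and> is_explicit_rk Ns a \<and> 0 < dt \<and>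
         U \<in> stiefel r N \<longrightarrow>
         slp_computes cs out (rkmk_env N S0 a b dt U) (rkmk_step N Ns (cay N) S0 a b dt U))"
    by blast
qed

end
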